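(* Let $\Delta$ be a thick masure, let $X$ be its twin building at infinity and let $G\le\mathrm{Aut}(\Delta)$ be a group of vectorially Weyl automorphisms. If $G$ acts strongly transitively on $\Delta$, then the action of $G$ induced on $X$ is strongly transitive as well.
   Context: \emph{Model apartment.} Let $V$ be a finite-dimensional real vector space, $I$ a nonempty finite set, $(\alpha_i)_{i\in I}$ a linearly independent family in $V^*$, $(\alpha_i^\vee)_{i\in I}$ a family in $V$ such that $(\alpha_j(\alpha_i^\vee))_{i,j}$ is a (possibly decomposable) generalized Cartan matrix. Put $r_i(v)=v-\alpha_i(v)\alpha_i^\vee$, $S=\{r_i\}_{i\in I}$, $W^v=\langle S\rangle\subset GL(V)$ (a Coxeter group), $\Phi=\{w\alpha_i\}$ (real roots; for $\alpha=w\alpha_i$, $\alpha^\vee=w\alpha_i^\vee$, $r_\alpha=wr_iw^{-1}$), $\Phi_{im}$ = imaginary roots of the associated Kac--Moody algebra. For $J\subset I$ (identified with a subset of $S$): $W^v(J)=\langle r_i: i\in J\rangle$ and $F^v(J)=\{v:\alpha_i(v)=0\ (i\in J),\ \alpha_i(v)>0\ (i\notin J)\}$; $C^v_f=F^v(\emptyset)$. Vectorial faces of sign $\pm$ and type $J$ are the $\pm wF^v(J)$, $w\in W^v$; chambers: $J=\emptyset$; panels: $|J|=1$; $J$ and the face are spherical if $W^v(J)$ is finite. $\mathcal T$ (resp. $\mathcal T^\circ$) is the union of positive (resp. positive spherical) faces. The model apartment $\mathbb A$ is $V$ as an affine space with walls $M(\alpha,k)=\{v:\alpha(v)+k=0\}$,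 $\alpha\in\Phi$, $k\in\Lambda_\alpha$, where $0\in\Lambda_\alpha\subset\mathbb R$ is infinite; put $\Lambda_\alpha=\mathbb R$ for $\alpha\in\Phi_{im}$. $D(\alpha,k)=\{v:\alpha(v)+k\ge0\}$. $W^a$ is generated by the affine reflections in the walls $M(\alpha,k)$ with linear part $r_\alpha$, and is assumed to permute the walls. $\mathrm{Aut}(\mathbb A)$: affine bijections permuting the pairs ($M(\alpha,k)$ a wall, $\alpha^\vee$). $x\le y$ iff $y-x\in\mathcal T$; $x\overset{\circ}{<}y$ iff $y-x\in\mathcal T^\circ$. \emph{Filters.} Subsets are identified with the filter of their supersets; a set contains a filter if it is a member of it. The enclosure $cl_{\mathbb A}(F)$ of a filter $F$ consists of the sets containing some member of $F$ of the form $\bigcap_{\alpha\in\Phi\cup\Phi_{im}}D(\alpha,k_\alpha)$, $k_\alpha\in\Lambda_\alpha\cup\{\infty\}$. The support of $F$ is the smallest affine subspace containing it. Local face: $F^\ell(x,F^v)=\mathrm{germ}_x(x+F^v)$ (local chamber, local panel if $F^v$ is a chamber, panel); closed face: enclosure of a local face. Sector-face: $x+F^v$ (base point $x$, direction $F^v$); its shortenings are $x+\xi+F^v$, $\xi\in F^v$; its germ is the filter of sets containing a shortening; sector: $F^v$ a chamber. Chimney: $\mathfrak r(F,F^v)=cl_{\mathbb A}(F+F^v)$, $F$ a local face; splayed if $F^v$ is spherical, solid if the direction of its support has finite pointwise stabilizer in $W^v$; its germ is the filter of sets containing some $\mathfrak r(F+\xi,F^v)$, $\xi\in F^v$. A ray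 or segment from $x$ through $y\ne x$ is preordered if $x\le y$ or $y\le x$, generic if $x\overset{\circ}{<}y$ or $y\overset{\circ}{<}x$. \emph{Masures.} An apartment is a set $A$ with a set $Isom^w(\mathbb A,A)$ of bijections of the form $\{f_0\circ w: w\in W^a\}$. A bijection $\varphi:A\to A'$ of apartments is an isomorphism (resp. Weyl, resp. vectorially Weyl) if $f'^{-1}\varphi f$ lies in $\mathrm{Aut}(\mathbb A)$ (resp. $W^a$, resp. $(W^v\ltimes V)\cap\mathrm{Aut}(\mathbb A)$) for $f\in Isom^w(\mathbb A,A)$, $f'\in Isom^w(\mathbb A,A')$. All notions transfer from $\mathbb A$ to apartments. A masure $(\Delta,\mathcal A)$ is a set $\Delta$ covered by a family $\mathcal A$ of subsets (apartments) with: (MA1) each $A\in\mathcal A$ has a structure of apartment; (MA2) if $F$ is a point, germ of preordered interval, generic ray or solid chimney in $A$ and $A'$ is another apartment containing $F$, then $A\cap A'\supset cl_A(F)$ and some Weyl-isomorphism $A\to A'$ fixes $cl_A(F)$ pointwise; (MA3) if $\mathfrak R$ is the germ of a splayed chimney and $F$ a closed face or germ of a solid chimney, some apartment contains $\mathfrak R$ and $F$; (MA4) if $A,A'$ both contain $\mathfrak R,F$ as in (MA3), then $A\cap A'\supset cl_A(\mathfrak R\cup F)$ and some Weyl-isomorphism $A\to A'$ fixes $cl_A(\mathfrak R\cup F)$ pointwise; (MAO) if $x,y\in A\cap A'$ and $x\le_A y$, then $[x,y]_A=[x,y]_{A'}$. $\Delta$ is thick if each local panel is contained in (the closure of) at least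 three local chambers. $\mathrm{Aut}(\Delta)$: bijections $\varphi$ of $\Delta$ permuting $\mathcal A$ such that each $\varphi|_A:A\to\varphi(A)$ is an isomorphism; $\varphi$ is vectorially Weyl if all $\varphi|_A$ are. \emph{Boundary.} Spherical sector-faces are parallel if, after shortening, they lie in a common apartment and are translates of each other there. Parallel classes of spherical sector-faces are the ideal faces (ideal chambers, ideal panels), with sign and type of the direction. Ideal faces of sign $\pm$ form a building $\partial\Delta_\pm$ of type $(W^v,S)$, and $\partial\Delta=(\partial\Delta_+,\partial\Delta_-)$ is a twin building with twin apartments $\partial A$, $A\in\mathcal A$ (ideal faces represented in $A$); vectorially Weyl automorphisms act on it preserving types. \emph{Strong transitivity.} $G$ acts strongly transitively on $\Delta$ if every isomorphism whose existence is asserted in (MA2) and (MA4) may be chosen to be the restriction of an element of $G$. $G$ acts strongly transitively on the twin building $\partial\Delta$ if it is transitive on the set of twin apartments and, for every twin apartment $(A_-,A_+)$, its stabilizer in $G$ is transitive on the set $\mathrm{Ch}(A_+)$ of chambers of $A_+$. *)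

theory Defs
  imports "HOL-Analysis.Analysis"
begin

section \<open>The model apartment\<close>

text \<open>
  The space V is a Euclidean space type (only its structure of finite-dimensional real
  vector space, with the canonical topology, is used), the index set is a finite type, and
  elements of the dual of V are functions to the reals. The Kac--Moody algebra of the datum
  lives on the real vector space \<open>'g\<close> and has V as its Cartan subalgebra, embedded by \<open>cartan\<close>.
\<close>

record ('v, 'i, 'g) apartment_datum =
  sroot :: "'i \<Rightarrow> 'v \<Rightarrow> real"
  scoroot :: "'i \<Rightarrow> 'v"
  Lam :: "('v \<Rightarrow> real) \<Rightarrow> real set"
  lie :: "'g \<Rightarrow> 'g \<Rightarrow> 'g"
  cartan :: "'v \<Rightarrow> 'g"
  gen_e :: "'i \<Rightarrow> 'g"
  gen_f :: "'i \<Rightarrow> 'g"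

inductive_set generated :: "('v \<Rightarrow> 'v) set \<Rightarrow> ('v \<Rightarrow> 'v) set" for S where
  gen_id: "id \<in> generated S"
| gen_step: "s \<in> S \<Longrightarrow> w \<in> generated S \<Longrightarrow> s \<circ> w \<in> generated S"
| gen_inv: "s \<in> S \<Longrightarrow> w \<in> generated S \<Longrightarrow> inv s \<circ> w \<in> generated S"

definition srefl :: "('v::real_vector, 'i, 'g, 'z) apartment_datum_scheme \<Rightarrow> 'i \<Rightarrow> 'v \<Rightarrow> 'v" where
  "srefl D i v = v - sroot D i v *\<^sub>R scoroot D i"

definition Wv_par :: "('v::real_vector, 'i, 'g, 'z) apartment_datum_scheme \<Rightarrow> 'i set \<Rightarrow> ('v \<Rightarrow> 'v) set" where
  "Wv_par D J = generated (srefl D ` J)"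

definition Wv :: "('v::real_vector, 'i, 'g, 'z) apartment_datum_scheme \<Rightarrow> ('v \<Rightarrow> 'v) set" where
  "Wv D = Wv_par D UNIV"

text \<open>Real roots together with their coroots: the pairs of \<open>w \<alpha>\<^sub>i\<close> and \<open>w \<alpha>\<^sub>i\<^sup>\<or>\<close>.\<close>

definition root_pairs :: "('v::real_vector, 'i, 'g, 'z) apartment_datum_scheme \<Rightarrow> (('v \<Rightarrow> real) \<times> 'v) set" where
  "root_pairs D = {(sroot D i \<circ> inv w, w (scoroot D i)) | w i. w \<in> Wv D}"

definition real_roots :: "('v::real_vector, 'i, 'g, 'z) apartment_datum_scheme \<Rightarrow> ('v \<Rightarrow> real) set" where
  "real_roots D = fst ` root_pairs D"

text \<open>
  Kac's characterisation of the Kac--Moody algebra: generated by the Cartan subalgebra and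
  the \<open>e\<^sub>i, f\<^sub>i\<close>, with the usual relations, and without nonzero ideal meeting the Cartan
  subalgebra trivially. The real (split) form is used; it has the same roots as the complex one.
\<close>

definition kac_moody_algebra :: "('v::real_vector, 'i, 'g::real_vector, 'z) apartment_datum_scheme \<Rightarrow> bool" where
  "kac_moody_algebra D \<longleftrightarrow>
     bilinear (lie D) \<and>
     (\<forall>x. lie D x x = 0) \<and>
     (\<forall>x y z. lie D x (lie D y z) + lie D y (lie D z x) + lie D z (lie D x y) = 0) \<and>
     linear (cartan D) \<and> inj (cartan D) \<and>
     (\<forall>u v. lie D (cartan D u) (cartan D v) = 0) \<and>
     (\<forall>v i. lie D (cartan D v) (gen_e D i) = sroot D i v *\<^sub>R gen_e D i) \<and>
     (\<forall>v i. lie D (cartan D v) (gen_f D i) = - (sroot D i v *\<^sub>R gen_f D i)) \<and>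
     (\<forall>i j. lie D (gen_e D i) (gen_f D j) = (if i = j then cartan D (scoroot D i) else 0)) \<and>
     (\<forall>U. subspace U \<and> range (cartan D) \<union> range (gen_e D) \<union> range (gen_f D) \<subseteq> U \<and>
          (\<forall>x\<in>U. \<forall>y\<in>U. lie D x y \<in> U) \<longrightarrow> U = UNIV) \<and>
     (\<forall>N. subspace N \<and> (\<forall>x. \<forall>y\<in>N. lie D x y \<in> N) \<and> N \<inter> range (cartan D) = {0} \<longrightarrow> N = {0})"

definition kac_moody_roots :: "('v, 'i, 'g::real_vector, 'z) apartment_datum_scheme \<Rightarrow> ('v \<Rightarrow> real) set" where
  "kac_moody_roots D =
     {\<gamma>. \<gamma> \<noteq> (\<lambda>_. 0) \<and> (\<exists>x. x \<noteq> 0 \<and> (\<forall>v. lie D (cartan D v) x = \<gamma> v *\<^sub>R x))}"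

definition imaginary_roots :: "('v::real_vector, 'i, 'g::real_vector, 'z) apartment_datum_scheme \<Rightarrow> ('v \<Rightarrow> real) set" where
  "imaginary_roots D = kac_moody_roots D - real_roots D"

definition hyp :: "('v \<Rightarrow> real) \<Rightarrow> real \<Rightarrow> 'v set" where
  "hyp \<alpha> k = {v. \<alpha> v + k = 0}"

definition walls :: "('v::real_vector, 'i, 'g, 'z) apartment_datum_scheme \<Rightarrow> 'v set set" where
  "walls D = {hyp \<alpha> k | \<alpha> k. \<alpha> \<in> real_roots D \<and> k \<in> Lam D \<alpha>}"

definition Wa :: "('v::real_vector, 'i, 'g, 'z) apartment_datum_scheme \<Rightarrow> ('v \<Rightarrow> 'v) set" where
  "Wa D = generated {(\<lambda>v. v - (\<alpha> v + k) *\<^sub>R a) | \<alpha> a k. (\<alpha>, a) \<in> root_pairs D \<and> k \<in> Lam D \<alpha>}"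

text \<open>
  As \<open>hyp \<alpha> k\<close> and \<open>hyp (- \<alpha>) (- k)\<close> are the same set, the clause
  \<open>hyp \<alpha> k \<in> walls D \<longrightarrow> k \<in> Lam D \<alpha>\<close> says that \<open>Lam D\<close> describes the walls consistently,
  so that half-apartments, and hence enclosures, are compatible with the affine Weyl group.
\<close>

definition model_apartment :: "('v::euclidean_space, 'i::finite, 'g::real_vector, 'z) apartment_datum_scheme \<Rightarrow> bool" where
  "model_apartment D \<longleftrightarrow>
     (\<forall>i. linear (sroot D i)) \<and>
     (\<forall>c. (\<forall>v. (\<Sum>i\<in>UNIV. c i * sroot D i v) = 0) \<longrightarrow> (\<forall>i. c i = 0)) \<and>
     (\<forall>i. sroot D i (scoroot D i) = 2) \<and>
     (\<forall>i j. i \<noteq> j \<longrightarrow> sroot D j (scoroot D i) \<in> \<int> \<and> sroot D j (scoroot D i) \<le> 0) \<and>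
     (\<forall>i j. sroot D j (scoroot D i) = 0 \<longrightarrow> sroot D i (scoroot D j) = 0) \<and>
     kac_moody_algebra D \<and>
     (\<forall>\<alpha>\<in>real_roots D. 0 \<in> Lam D \<alpha> \<and> infinite (Lam D \<alpha>)) \<and>
     (\<forall>\<alpha>\<in>real_roots D. \<forall>k. hyp \<alpha> k \<in> walls D \<longrightarrow> k \<in> Lam D \<alpha>) \<and>
     (\<forall>w\<in>Wa D. (`) w ` walls D = walls D)"

definition wall_coroot_pairs :: "('v::real_vector, 'i, 'g, 'z) apartment_datum_scheme \<Rightarrow> ('v set \<times> 'v) set" where
  "wall_coroot_pairs D = {(hyp \<alpha> k, a) | \<alpha> a k. (\<alpha>, a) \<in> root_pairs D \<and> k \<in> Lam D \<alpha>}"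

definition Aut_apartment :: "('v::real_vector, 'i, 'g, 'z) apartment_datum_scheme \<Rightarrow> ('v \<Rightarrow> 'v) set" where
  "Aut_apartment D =
     {(\<lambda>v. L v + c) | L c. linear L \<and> bij L \<and>
        (\<lambda>(M, a). ((\<lambda>v. L v + c) ` M, L a)) ` wall_coroot_pairs D = wall_coroot_pairs D}"

definition vectorial_Weyl_affine :: "('v::real_vector, 'i, 'g, 'z) apartment_datum_scheme \<Rightarrow> ('v \<Rightarrow> 'v) set" where
  "vectorial_Weyl_affine D = {(\<lambda>v. w v + c) | w c. w \<in> Wv D}"

section \<open>Vectorial faces\<close>

definition std_face :: "('v, 'i, 'g, 'z) apartment_datum_scheme \<Rightarrow> 'i set \<Rightarrow> 'v set" where
  "std_face D J = {v. (\<forall>i\<in>J. sroot D i v = 0) \<and> (\<forall>i. i \<notin> J \<longrightarrow> sroot D i v > 0)}"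

text \<open>The sign \<open>\<sigma>\<close> of a face is the real number 1 or -1; \<open>\<J>\<close> is the set of allowed types.\<close>

definition vec_faces :: "('v::real_vector, 'i, 'g, 'z) apartment_datum_scheme \<Rightarrow> real \<Rightarrow> 'i set set \<Rightarrow> 'v set set" where
  "vec_faces D \<sigma> \<J> = {(\<lambda>v. \<sigma> *\<^sub>R w v) ` std_face D J | w J. w \<in> Wv D \<and> J \<in> \<J>}"

definition signed_faces :: "('v::real_vector, 'i, 'g, 'z) apartment_datum_scheme \<Rightarrow> 'i set set \<Rightarrow> 'v set set" where
  "signed_faces D \<J> = vec_faces D 1 \<J> \<union> vec_faces D (- 1) \<J>"

definition spherical_types :: "('v::real_vector, 'i, 'g, 'z) apartment_datum_scheme \<Rightarrow> 'i set set" where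
  "spherical_types D = {J. finite (Wv_par D J)}"

definition tits_cone :: "('v::real_vector, 'i, 'g, 'z) apartment_datum_scheme \<Rightarrow> 'v set" where
  "tits_cone D = \<Union> (vec_faces D 1 UNIV)"

definition tits_cone_sph :: "('v::real_vector, 'i, 'g, 'z) apartment_datum_scheme \<Rightarrow> 'v set" where
  "tits_cone_sph D = \<Union> (vec_faces D 1 (spherical_types D))"

definition apt_le :: "('v::real_vector, 'i, 'g, 'z) apartment_datum_scheme \<Rightarrow> 'v \<Rightarrow> 'v \<Rightarrow> bool" where
  "apt_le D x y \<longleftrightarrow> y - x \<in> tits_cone D"

definition apt_less_sph :: "('v::real_vector, 'i, 'g, 'z) apartment_datum_scheme \<Rightarrow> 'v \<Rightarrow> 'v \<Rightarrow> bool" where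
  "apt_less_sph D x y \<longleftrightarrow> y - x \<in> tits_cone_sph D"

section \<open>Filters in the model apartment\<close>

text \<open>
  A set S is identified with \<open>principal S\<close>; S contains the filter F iff \<open>F \<le> principal S\<close>, and
  the union of two filters is their supremum.
\<close>

definition enclosed :: "('v::real_vector, 'i, 'g::real_vector, 'z) apartment_datum_scheme \<Rightarrow> 'v set \<Rightarrow> bool" where
  "enclosed D E \<longleftrightarrow>
     (\<exists>\<kappa> :: ('v \<Rightarrow> real) \<Rightarrow> real option.
        (\<forall>\<alpha>\<in>real_roots D. \<forall>k. \<kappa> \<alpha> = Some k \<longrightarrow> k \<in> Lam D \<alpha>) \<and>
        E = {v. \<forall>\<alpha>\<in>real_roots D \<union> imaginary_roots D. \<forall>k. \<kappa> \<alpha> = Some k \<longrightarrow> \<alpha> v + k \<ge> 0})"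

definition encl :: "('v::real_vector, 'i, 'g::real_vector, 'z) apartment_datum_scheme \<Rightarrow> 'v filter \<Rightarrow> 'v filter" where
  "encl D F = (INF E\<in>{E. enclosed D E \<and> F \<le> principal E}. principal E)"

lemma enclosed_UNIV: "enclosed D UNIV"
  unfolding enclosed_def by (rule exI[of _ "\<lambda>_. None"]) simp

lemma enclosed_Int:
  assumes "enclosed D E" "enclosed D E'"
  shows "enclosed D (E \<inter> E')"
proof -
  obtain \<kappa> where k: "\<forall>\<alpha>\<in>real_roots D. \<forall>k. \<kappa> \<alpha> = Some k \<longrightarrow> k \<in> Lam D \<alpha>"
    "E = {v. \<forall>\<alpha>\<in>real_roots D \<union> imaginary_roots D. \<forall>k. \<kappa> \<alpha> = Some k \<longrightarrow> \<alpha> v + k \<ge> 0}"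
    using assms(1) unfolding enclosed_def by blast
  obtain \<kappa>' where k': "\<forall>\<alpha>\<in>real_roots D. \<forall>k. \<kappa>' \<alpha> = Some k \<longrightarrow> k \<in> Lam D \<alpha>"
    "E' = {v. \<forall>\<alpha>\<in>real_roots D \<union> imaginary_roots D. \<forall>k. \<kappa>' \<alpha> = Some k \<longrightarrow> \<alpha> v + k \<ge> 0}"
    using assms(2) unfolding enclosed_def by blast
  define \<mu> where "\<mu> \<alpha> = (case \<kappa> \<alpha> of None \<Rightarrow> \<kappa>' \<alpha>
      | Some k \<Rightarrow> (case \<kappa>' \<alpha> of None \<Rightarrow> Some k | Some k' \<Rightarrow> Some (min k k')))" for \<alpha>
  have mu: "(\<forall>k. \<mu> \<alpha> = Some k \<longrightarrow> \<alpha> v + k \<ge> 0) \<longleftrightarrow>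
      (\<forall>k. \<kappa> \<alpha> = Some k \<longrightarrow> \<alpha> v + k \<ge> 0) \<and> (\<forall>k. \<kappa>' \<alpha> = Some k \<longrightarrow> \<alpha> v + k \<ge> 0)" for \<alpha> v
    by (auto simp: \<mu>_def min_def split: option.splits)
  have "\<forall>\<alpha>\<in>real_roots D. \<forall>k. \<mu> \<alpha> = Some k \<longrightarrow> k \<in> Lam D \<alpha>"
    using k(1) k'(1) by (auto simp: \<mu>_def min_def split: option.splits)
  moreover have "E \<inter> E' =
      {v. \<forall>\<alpha>\<in>real_roots D \<union> imaginary_roots D. \<forall>k. \<mu> \<alpha> = Some k \<longrightarrow> \<alpha> v + k \<ge> 0}"
    unfolding mu k(2) k'(2) by blast
  ultimately show ?thesis unfolding enclosed_def by blast
qed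

lemma eventually_encl:
  "eventually P (encl D F) \<longleftrightarrow> (\<exists>E. enclosed D E \<and> F \<le> principal E \<and> (\<forall>v\<in>E. P v))"
proof -
  have "eventually P (encl D F) \<longleftrightarrow>
      (\<exists>E\<in>{E. enclosed D E \<and> F \<le> principal E}. eventually P (principal E))"
    unfolding encl_def
  proof (rule eventually_INF_base)
    show "{E. enclosed D E \<and> F \<le> principal E} \<noteq> {}" using enclosed_UNIV by fastforce
  next
    fix E E' assume "E \<in> {E. enclosed D E \<and> F \<le> principal E}" "E' \<in> {E. enclosed D E \<and> F \<le> principal E}"
    then have "E \<inter> E' \<in> {E. enclosed D E \<and> F \<le> principal E}"
      using enclosed_Int by (auto simp flip: inf_principal)
    then show "\<exists>x\<in>{E. enclosed D E \<and> F \<le> principal E}. principal x \<le> inf (principal E) (principal E')"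
      by (intro bexI[of _ "E \<inter> E'"]) auto
  qed
  then show ?thesis by (auto simp: eventually_principal)
qed

definition support :: "'v::real_vector filter \<Rightarrow> 'v set" where
  "support F = \<Inter> {E. affine E \<and> F \<le> principal E}"

definition germ :: "'v::topological_space \<Rightarrow> 'v set \<Rightarrow> 'v filter" where
  "germ x S = inf (nhds x) (principal S)"

definition local_face :: "'v::real_normed_vector \<Rightarrow> 'v set \<Rightarrow> 'v filter" where
  "local_face x Fv = germ x ((+) x ` Fv)"

definition filter_closure :: "'v::topological_space filter \<Rightarrow> 'v filter" where
  "filter_closure F = (INF S\<in>{S. F \<le> principal S}. principal (closure S))"

definition closed_faces :: "('v::real_normed_vector, 'i, 'g::real_vector, 'z) apartment_datum_scheme \<Rightarrow> 'v filter set" where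
  "closed_faces D = {encl D (local_face x Fv) | x Fv. Fv \<in> signed_faces D UNIV}"

definition chimney :: "('v::real_normed_vector, 'i, 'g::real_vector, 'z) apartment_datum_scheme
    \<Rightarrow> 'v \<Rightarrow> 'v set \<Rightarrow> 'v set \<Rightarrow> 'v filter" where
  "chimney D x F1 Fv =
     encl D (filtermap (\<lambda>(u, v). u + v) (prod_filter (local_face x F1) (principal Fv)))"

definition chimney_germ :: "('v::real_normed_vector, 'i, 'g::real_vector, 'z) apartment_datum_scheme
    \<Rightarrow> 'v \<Rightarrow> 'v set \<Rightarrow> 'v set \<Rightarrow> 'v filter" where
  "chimney_germ D x F1 Fv = (INF \<xi>\<in>Fv. chimney D (x + \<xi>) F1 Fv)"

definition solid :: "('v::real_vector, 'i, 'g, 'z) apartment_datum_scheme \<Rightarrow> 'v filter \<Rightarrow> bool" where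
  "solid D F \<longleftrightarrow> finite {w \<in> Wv D. \<forall>u\<in>support F. \<forall>v\<in>support F. w (v - u) = v - u}"

definition solid_chimneys :: "('v::real_normed_vector, 'i, 'g::real_vector, 'z) apartment_datum_scheme \<Rightarrow> 'v filter set" where
  "solid_chimneys D =
     {chimney D x F1 Fv | x F1 Fv. F1 \<in> signed_faces D UNIV \<and> Fv \<in> signed_faces D UNIV \<and>
        solid D (chimney D x F1 Fv)}"

definition solid_chimney_germs :: "('v::real_normed_vector, 'i, 'g::real_vector, 'z) apartment_datum_scheme \<Rightarrow> 'v filter set" where
  "solid_chimney_germs D =
     {chimney_germ D x F1 Fv | x F1 Fv. F1 \<in> signed_faces D UNIV \<and> Fv \<in> signed_faces D UNIV \<and>
        solid D (chimney D x F1 Fv)}"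

definition splayed_chimney_germs :: "('v::real_normed_vector, 'i, 'g::real_vector, 'z) apartment_datum_scheme \<Rightarrow> 'v filter set" where
  "splayed_chimney_germs D =
     {chimney_germ D x F1 Fv | x F1 Fv. F1 \<in> signed_faces D UNIV \<and>
        Fv \<in> signed_faces D (spherical_types D)}"

definition preordered_segment_germs :: "('v::real_normed_vector, 'i, 'g, 'z) apartment_datum_scheme \<Rightarrow> 'v filter set" where
  "preordered_segment_germs D =
     {germ x (closed_segment x y) | x y. x \<noteq> y \<and> (apt_le D x y \<or> apt_le D y x)}"

definition generic_rays :: "('v::real_vector, 'i, 'g, 'z) apartment_datum_scheme \<Rightarrow> 'v set set" where
  "generic_rays D =
     {{x + t *\<^sub>R (y - x) | t. t \<ge> 0} | x y. x \<noteq> y \<and> (apt_less_sph D x y \<or> apt_less_sph D y x)}"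

section \<open>Masures\<close>

text \<open>The underlying set of the masure is the type \<open>'d\<close>; \<open>charts M A\<close> is the set of
  Weyl-isomorphisms from the model apartment to the apartment A.\<close>

record ('v, 'i, 'g, 'd) masure_datum = "('v, 'i, 'g) apartment_datum" +
  apts :: "'d set set"
  charts :: "'d set \<Rightarrow> ('v \<Rightarrow> 'd) set"

definition iso_within :: "('v, 'i, 'g, 'd, 'z) masure_datum_scheme \<Rightarrow> ('v \<Rightarrow> 'v) set
    \<Rightarrow> 'd set \<Rightarrow> 'd set \<Rightarrow> ('d \<Rightarrow> 'd) \<Rightarrow> bool" where
  "iso_within M \<Gamma> A A' \<phi> \<longleftrightarrow>
     bij_betw \<phi> A A' \<and> (\<forall>f\<in>charts M A. \<forall>f'\<in>charts M A'. inv f' \<circ> \<phi> \<circ> f \<in> \<Gamma>)"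

definition apartment_iso :: "('v::real_vector, 'i, 'g, 'd, 'z) masure_datum_scheme \<Rightarrow> 'd set \<Rightarrow> 'd set \<Rightarrow> ('d \<Rightarrow> 'd) \<Rightarrow> bool" where
  "apartment_iso M = iso_within M (Aut_apartment M)"

definition Weyl_iso :: "('v::real_vector, 'i, 'g, 'd, 'z) masure_datum_scheme \<Rightarrow> 'd set \<Rightarrow> 'd set \<Rightarrow> ('d \<Rightarrow> 'd) \<Rightarrow> bool" where
  "Weyl_iso M = iso_within M (Wa M)"

definition vectorially_Weyl_iso :: "('v::real_vector, 'i, 'g, 'd, 'z) masure_datum_scheme \<Rightarrow> 'd set \<Rightarrow> 'd set \<Rightarrow> ('d \<Rightarrow> 'd) \<Rightarrow> bool" where
  "vectorially_Weyl_iso M = iso_within M (vectorial_Weyl_affine M \<inter> Aut_apartment M)"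

definition Weyl_iso_fixing :: "('v::real_vector, 'i, 'g, 'd, 'z) masure_datum_scheme \<Rightarrow> 'd set \<Rightarrow> 'd set
    \<Rightarrow> 'd filter \<Rightarrow> ('d \<Rightarrow> 'd) \<Rightarrow> bool" where
  "Weyl_iso_fixing M A A' K \<phi> \<longleftrightarrow> Weyl_iso M A A' \<phi> \<and> eventually (\<lambda>z. \<phi> z = z) K"

definition transferred :: "('v, 'i, 'g, 'd, 'z) masure_datum_scheme \<Rightarrow> 'v filter set \<Rightarrow> 'd filter set" where
  "transferred M \<F> = {filtermap f F | A f F. A \<in> apts M \<and> f \<in> charts M A \<and> F \<in> \<F>}"

text \<open>The enclosure of a filter contained in an apartment with chart f.\<close>

definition encl_in :: "('v::real_vector, 'i, 'g::real_vector, 'd, 'z) masure_datum_scheme \<Rightarrow> ('v \<Rightarrow> 'd) \<Rightarrow> 'd filter \<Rightarrow> 'd filter" where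
  "encl_in M f K = filtermap f (encl M (filtercomap f K))"

definition MA2_filters :: "('v::real_normed_vector, 'i, 'g::real_vector, 'z) apartment_datum_scheme \<Rightarrow> 'v filter set" where
  "MA2_filters D =
     {principal {x} | x. True} \<union> preordered_segment_germs D \<union>
     principal ` generic_rays D \<union> solid_chimneys D"

definition MA3_pairs :: "('v::real_normed_vector, 'i, 'g::real_vector, 'd, 'z) masure_datum_scheme \<Rightarrow> ('d filter \<times> 'd filter) set" where
  "MA3_pairs M =
     transferred M (splayed_chimney_germs M) \<times>
     transferred M (closed_faces M \<union> solid_chimney_germs M)"

text \<open>The situations to which (MA2) and (MA4) apply: two apartments A, A' and the enclosure in A
  which is asserted to lie in both and to be fixed by an isomorphism.\<close>

definition MA2_situations :: "('v::real_normed_vector, 'i, 'g::real_vector, 'd, 'z) masure_datum_scheme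
    \<Rightarrow> ('d set \<times> 'd set \<times> 'd filter) set" where
  "MA2_situations M =
     {(A, A', encl_in M f (filtermap f F)) | A A' f F.
        A \<in> apts M \<and> A' \<in> apts M \<and> f \<in> charts M A \<and> F \<in> MA2_filters M \<and>
        filtermap f F \<le> principal A'}"

definition MA4_situations :: "('v::real_normed_vector, 'i, 'g::real_vector, 'd, 'z) masure_datum_scheme
    \<Rightarrow> ('d set \<times> 'd set \<times> 'd filter) set" where
  "MA4_situations M =
     {(A, A', encl_in M f (sup R F)) | A A' f R F.
        A \<in> apts M \<and> A' \<in> apts M \<and> f \<in> charts M A \<and> (R, F) \<in> MA3_pairs M \<and>
        sup R F \<le> principal A \<and> sup R F \<le> principal A'}"

definition masure :: "('v::euclidean_space, 'i::finite, 'g::real_vector, 'd, 'z) masure_datum_scheme \<Rightarrow> bool" where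
  "masure M \<longleftrightarrow>
     model_apartment M \<and>
     \<Union> (apts M) = UNIV \<and>
     \<comment> \<open>(MA1)\<close>
     (\<forall>A\<in>apts M. \<exists>f0. bij_betw f0 UNIV A \<and> charts M A = {f0 \<circ> w | w. w \<in> Wa M}) \<and>
     \<comment> \<open>(MA2)\<close>
     (\<forall>(A, A', K)\<in>MA2_situations M. K \<le> principal (A \<inter> A') \<and> (\<exists>\<phi>. Weyl_iso_fixing M A A' K \<phi>)) \<and>
     \<comment> \<open>(MA3)\<close>
     (\<forall>(R, F)\<in>MA3_pairs M. \<exists>A\<in>apts M. R \<le> principal A \<and> F \<le> principal A) \<and>
     \<comment> \<open>(MA4)\<close>
     (\<forall>(A, A', K)\<in>MA4_situations M. K \<le> principal (A \<inter> A') \<and> (\<exists>\<phi>. Weyl_iso_fixing M A A' K \<phi>)) \<and>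
     \<comment> \<open>(MAO)\<close>
     (\<forall>A\<in>apts M. \<forall>A'\<in>apts M. \<forall>f\<in>charts M A. \<forall>f'\<in>charts M A'. \<forall>x\<in>A \<inter> A'. \<forall>y\<in>A \<inter> A'.
        apt_le M (inv f x) (inv f y) \<longrightarrow>
        f ` closed_segment (inv f x) (inv f y) = f' ` closed_segment (inv f' x) (inv f' y))"

definition local_panels :: "('v::real_normed_vector, 'i, 'g, 'd, 'z) masure_datum_scheme \<Rightarrow> 'd filter set" where
  "local_panels M = transferred M {local_face x Fv | x Fv. Fv \<in> signed_faces M {J. card J = 1}}"

definition covering_chambers :: "('v::real_normed_vector, 'i, 'g, 'd, 'z) masure_datum_scheme \<Rightarrow> 'd filter \<Rightarrow> 'd filter set" where
  "covering_chambers M P =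
     {filtermap f (local_face x Cv) | A f x Cv.
        A \<in> apts M \<and> f \<in> charts M A \<and> Cv \<in> signed_faces M {{}} \<and>
        P \<le> filtermap f (filter_closure (local_face x Cv))}"

definition thick :: "('v::real_normed_vector, 'i, 'g, 'd, 'z) masure_datum_scheme \<Rightarrow> bool" where
  "thick M \<longleftrightarrow>
     (\<forall>P\<in>local_panels M. \<exists>\<C>\<subseteq>covering_chambers M P. finite \<C> \<and> card \<C> = 3)"

definition Aut_masure :: "('v::real_vector, 'i, 'g, 'd, 'z) masure_datum_scheme \<Rightarrow> ('d \<Rightarrow> 'd) set" where
  "Aut_masure M =
     {\<phi>. bij \<phi> \<and> (`) \<phi> ` apts M = apts M \<and> (\<forall>A\<in>apts M. apartment_iso M A (\<phi> ` A) \<phi>)}"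

definition vectorially_Weyl :: "('v::real_vector, 'i, 'g, 'd, 'z) masure_datum_scheme \<Rightarrow> ('d \<Rightarrow> 'd) \<Rightarrow> bool" where
  "vectorially_Weyl M \<phi> \<longleftrightarrow> (\<forall>A\<in>apts M. vectorially_Weyl_iso M A (\<phi> ` A) \<phi>)"

definition automorphism_group :: "('v::real_vector, 'i, 'g, 'd, 'z) masure_datum_scheme \<Rightarrow> ('d \<Rightarrow> 'd) set \<Rightarrow> bool" where
  "automorphism_group M G \<longleftrightarrow>
     G \<subseteq> Aut_masure M \<and> id \<in> G \<and> (\<forall>g\<in>G. inv g \<in> G) \<and> (\<forall>g\<in>G. \<forall>h\<in>G. g \<circ> h \<in> G)"

definition strongly_transitive_masure :: "('v::real_normed_vector, 'i, 'g::real_vector, 'd, 'z) masure_datum_scheme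
    \<Rightarrow> ('d \<Rightarrow> 'd) set \<Rightarrow> bool" where
  "strongly_transitive_masure M G \<longleftrightarrow>
     (\<forall>(A, A', K)\<in>MA2_situations M \<union> MA4_situations M. \<exists>g\<in>G. Weyl_iso_fixing M A A' K g)"

section \<open>The twin building at infinity\<close>

definition shortening :: "('v::real_vector, 'i, 'g, 'd, 'z) masure_datum_scheme \<Rightarrow> 'd set \<Rightarrow> 'd set \<Rightarrow> bool" where
  "shortening M s t \<longleftrightarrow>
     (\<exists>A f x Fv \<xi>. A \<in> apts M \<and> f \<in> charts M A \<and>
        Fv \<in> signed_faces M (spherical_types M) \<and> \<xi> \<in> Fv \<and>
        s = f ` (+) x ` Fv \<and> t = f ` (+) (x + \<xi>) ` Fv)"

definition parallel :: "('v::real_vector, 'i, 'g, 'd, 'z) masure_datum_scheme \<Rightarrow> 'd set \<Rightarrow> 'd set \<Rightarrow> bool" where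
  "parallel M s s' \<longleftrightarrow>
     (\<exists>A f x x' Fv. A \<in> apts M \<and> f \<in> charts M A \<and>
        Fv \<in> signed_faces M (spherical_types M) \<and>
        shortening M s (f ` (+) x ` Fv) \<and> shortening M s' (f ` (+) x' ` Fv))"

text \<open>An ideal face is a parallel class, i.e. a set of spherical sector-faces of the masure.\<close>

definition ideal_faces_in :: "('v::real_vector, 'i, 'g, 'd, 'z) masure_datum_scheme
    \<Rightarrow> 'd set \<Rightarrow> real \<Rightarrow> 'i set set \<Rightarrow> 'd set set set" where
  "ideal_faces_in M A \<sigma> \<J> =
     {Collect (parallel M (f ` (+) x ` Fv)) | f x Fv.
        f \<in> charts M A \<and> Fv \<in> vec_faces M \<sigma> (\<J> \<inter> spherical_types M)}"

definition ideal_chambers :: "('v::real_vector, 'i, 'g, 'd, 'z) masure_datum_scheme \<Rightarrow> real \<Rightarrow> 'd set set set" where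
  "ideal_chambers M \<sigma> = (\<Union>A\<in>apts M. ideal_faces_in M A \<sigma> {{}})"

text \<open>Twin apartments are pairs of sets of ideal faces, negative part first.\<close>

definition twin_apartments :: "('v::real_vector, 'i, 'g, 'd, 'z) masure_datum_scheme
    \<Rightarrow> ('d set set set \<times> 'd set set set) set" where
  "twin_apartments M = {(ideal_faces_in M A (- 1) UNIV, ideal_faces_in M A 1 UNIV) | A. A \<in> apts M}"

definition act_ideal :: "('d \<Rightarrow> 'd) \<Rightarrow> 'd set set \<Rightarrow> 'd set set" where
  "act_ideal g c = (`) g ` c"

definition act_twin :: "('d \<Rightarrow> 'd) \<Rightarrow> 'd set set set \<times> 'd set set set \<Rightarrow> 'd set set set \<times> 'd set set set" where
  "act_twin g = map_prod ((`) (act_ideal g)) ((`) (act_ideal g))"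

definition strongly_transitive_boundary :: "('v::real_vector, 'i, 'g, 'd, 'z) masure_datum_scheme
    \<Rightarrow> ('d \<Rightarrow> 'd) set \<Rightarrow> bool" where
  "strongly_transitive_boundary M G \<longleftrightarrow>
     (\<forall>P\<in>twin_apartments M. \<forall>Q\<in>twin_apartments M. \<exists>g\<in>G. act_twin g P = Q) \<and>
     (\<forall>P\<in>twin_apartments M.
        \<forall>c\<in>snd P \<inter> ideal_chambers M 1. \<forall>c'\<in>snd P \<inter> ideal_chambers M 1.
          \<exists>g\<in>G. act_twin g P = P \<and> act_ideal g c = c')"

end

theory Submission
  imports Defs
begin

text \<open>
  Two sector germs always lie in a common apartment, and an apartment can be moved by \<open>G\<close> onto
  any other one with which it shares a sector germ. So \<open>G\<close> is transitive on apartments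
  (\<open>apartments_transitive\<close>), and hence on twin apartments, because a vectorially Weyl automorphism
  maps parallel sector-faces to parallel ones and preserves their signs and types.

  For the chambers of a twin apartment \<open>\<partial>A\<close> it is enough to find, for every chart of \<open>A\<close> and every
  simple reflection, an element of \<open>G\<close> which stabilizes \<open>A\<close> and moves the fundamental chamber as that
  reflection does (\<open>panel_reflection\<close>). Let \<open>F\<^sub>1\<close> and \<open>F\<^sub>2\<close> be the local chambers of \<open>A\<close> at the origin on
  both sides of the wall, and let \<open>F\<^sub>3\<close> be a third local chamber which covers their common panel; it
  exists as the masure is thick. By (MA3) some apartment \<open>A\<^sub>1\<close> contains \<open>F\<^sub>3\<close> and the germ of the sector
  of \<open>A\<close> that starts with \<open>F\<^sub>1\<close>. The enclosure of this germ and of a point contains the parallel sector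
  based at the point, so by (MA4) an element \<open>g\<^sub>1\<close> of \<open>G\<close> maps \<open>A\<close> onto \<open>A\<^sub>1\<close> and fixes \<open>F\<^sub>1\<close> and the panel.
  Since \<open>F\<^sub>3 \<noteq> F\<^sub>1\<close>, it maps \<open>F\<^sub>2\<close> to \<open>F\<^sub>3\<close> (\<open>unfold_along_panel\<close>). In the same way some \<open>g\<^sub>2\<close> maps
  \<open>A\<close> onto an apartment \<open>A\<^sub>2\<close> and \<open>F\<^sub>1\<close> to \<open>F\<^sub>3\<close>. A closed chamber is a solid chimney, so by (MA2) some
  element of \<open>G\<close> maps \<open>A\<^sub>1\<close> onto \<open>A\<^sub>2\<close> and fixes \<open>F\<^sub>3\<close>. Composed with \<open>g\<^sub>1\<close> and with the inverse of \<open>g\<^sub>2\<close> it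
  stabilizes \<open>A\<close> and maps \<open>F\<^sub>2\<close> to \<open>F\<^sub>3\<close>, to \<open>F\<^sub>3\<close>, to \<open>F\<^sub>1\<close>: it exchanges the two sides of the wall.

  That an apartment has only two local chambers on a panel is a fact about the Weyl group
  (\<open>chambers_of_panel\<close>). It rests on the theorem that a real root has a constant sign on the
  fundamental chamber (\<open>root_sign\<close>), which is proved by induction on the length of words, with the
  classification of the Cartan matrices of rank two as its core.

  The element found in this way controls the direction of the image of a sector, but not its base
  point. So it remains to see that the parallel class of a sector does not depend on the base point
  (\<open>ideal_chamber_translate\<close>), and that an ideal chamber which is represented in \<open>A\<close> is represented by
  a sector of \<open>A\<close>, not by a smaller sector-face (\<open>ideal_chamber_in_apartment\<close>). In both cases one set is
  a sector-face in two apartments, and the change of charts is determined along rays by (MA2); as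
  \<open>W\<^sup>v\<close> acts freely on chambers, it is a single element of \<open>W\<^sup>a\<close> on the whole sector
  (\<open>chart_change_on_sector\<close>).
\<close>

section \<open>Groups generated by bijections\<close>

lemma generated_comp:
  assumes "u \<in> generated S" "w \<in> generated S"
  shows "u \<circ> w \<in> generated S"
  using assms by (induction) (auto simp: comp_assoc intro: generated.intros)

lemma generated_base: "s \<in> S \<Longrightarrow> s \<in> generated S"
  using generated.gen_step[OF _ generated.gen_id] by fastforce

lemma generated_bij:
  assumes "\<And>s. s \<in> S \<Longrightarrow> bij s" "w \<in> generated S"
  shows "bij w"
  using assms(2) by induction (simp_all only: bij_id bij_comp assms(1) bij_imp_bij_inv)

lemma generated_inv:
  assumes "\<And>s. s \<in> S \<Longrightarrow> bij s" "w \<in> generated S"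
  shows "inv w \<in> generated S"
  using assms(2)
proof induction
  case gen_id
  show ?case unfolding inv_id by (rule generated.gen_id)
next
  case (gen_step s w)
  have "inv (s \<circ> w) = inv w \<circ> inv s"
    by (rule o_inv_distrib) (use gen_step assms(1) generated_bij[OF assms(1)] in blast)+
  moreover have "inv s \<circ> id \<in> generated S"
    by (rule generated.gen_inv[OF gen_step(1) generated.gen_id])
  ultimately show ?case using gen_step(3) generated_comp[of "inv w" S "inv s"] by (metis comp_id)
next
  case (gen_inv s w)
  have "inv (inv s \<circ> w) = inv w \<circ> inv (inv s)"
    by (rule o_inv_distrib) (use gen_inv assms(1) generated_bij[OF assms(1)] bij_imp_bij_inv in blast)+
  also have "inv (inv s) = s" using inv_inv_eq assms(1) gen_inv by blast
  finally show ?case using gen_inv generated_comp[OF _ generated_base] by metis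
qed

section \<open>Words in the simple reflections\<close>

definition chamber :: "('v, 'i, 'g, 'z) apartment_datum_scheme \<Rightarrow> 'v set" where
  "chamber D = std_face D {}"

locale apartment_model =
  fixes D :: "('v::euclidean_space, 'i::finite, 'g::real_vector, 'z) apartment_datum_scheme"
  assumes model: "model_apartment D"
begin

abbreviation \<alpha> where "\<alpha> \<equiv> sroot D"
abbreviation h where "h \<equiv> scoroot D"
abbreviation s where "s \<equiv> srefl D"
abbreviation C where "C \<equiv> chamber D"

lemmas model_conditions = model[unfolded model_apartment_def]

lemma linear_root: "linear (\<alpha> i)"
  by (rule model_conditions[THEN conjunct1, rule_format])

lemma root_indep: "\<forall>v. (\<Sum>i\<in>UNIV. c i * \<alpha> i v) = 0 \<Longrightarrow> c i = 0"
  by (rule model_conditions[THEN conjunct2, THEN conjunct1, THEN spec, THEN mp, THEN spec])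

lemma root_coroot: "\<alpha> i (h i) = 2"
  by (rule model_conditions[THEN conjunct2, THEN conjunct2, THEN conjunct1, rule_format])

lemma cartan_entry: "i \<noteq> j \<Longrightarrow> \<alpha> j (h i) \<in> \<int> \<and> \<alpha> j (h i) \<le> 0"
  by (rule model_conditions[THEN conjunct2, THEN conjunct2, THEN conjunct2, THEN conjunct1, rule_format])

lemma cartan_entry_zero: "\<alpha> j (h i) = 0 \<Longrightarrow> \<alpha> i (h j) = 0"
  by (rule model_conditions[THEN conjunct2, THEN conjunct2, THEN conjunct2, THEN conjunct2, THEN conjunct1, rule_format])

lemma Lie_algebra: "kac_moody_algebra D"
  by (rule model_conditions[THEN conjunct2, THEN conjunct2, THEN conjunct2, THEN conjunct2, THEN conjunct2, THEN conjunct1, rule_format])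

lemma Lam_root: "\<beta> \<in> real_roots D \<Longrightarrow> 0 \<in> Lam D \<beta> \<and> infinite (Lam D \<beta>)"
  by (rule model_conditions[THEN conjunct2, THEN conjunct2, THEN conjunct2, THEN conjunct2, THEN conjunct2, THEN conjunct2, THEN conjunct1, rule_format])

lemmas root_simps =
  linear_add[OF linear_root] linear_diff[OF linear_root] linear_cmul[OF linear_root]
  linear_0[OF linear_root] linear_neg[OF linear_root]

lemma root_srefl: "\<alpha> j (s i v) = \<alpha> j v - \<alpha> i v * \<alpha> j (h i)"
  by (simp add: srefl_def root_simps)

lemma srefl_invol: "s i (s i v) = v"
  unfolding srefl_def[of D i "s i v"] by (simp add: root_srefl root_coroot) (simp add: srefl_def)

lemma srefl_comp: "s i \<circ> s i = id"
  by (auto simp: srefl_invol)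

lemma bij_srefl: "bij (s i)"
  by (rule o_bij[OF srefl_comp srefl_comp])

lemma inv_srefl: "inv (s i) = s i"
  by (rule inv_unique_comp[OF srefl_comp srefl_comp])

lemma linear_srefl: "linear (s i)"
  by (rule linearI) (auto simp: srefl_def root_simps algebra_simps)

definition word_prod :: "'i list \<Rightarrow> 'v \<Rightarrow> 'v" where
  "word_prod xs = foldr (\<lambda>i w. s i \<circ> w) xs id"

lemma word_prod_Nil [simp]: "word_prod [] = id" and word_prod_Cons [simp]: "word_prod (i # xs) = s i \<circ> word_prod xs"
  by (simp_all add: word_prod_def)

lemma word_prod_append: "word_prod (xs @ ys) = word_prod xs \<circ> word_prod ys"
  by (induction xs) auto

lemma Wv_eq_words: "Wv D = range word_prod"
proof
  show "Wv D \<subseteq> range word_prod"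
  proof
    fix w assume "w \<in> Wv D"
    then show "w \<in> range word_prod" unfolding Wv_def Wv_par_def
    proof induction
      case gen_id
      show ?case by (metis word_prod_Nil rangeI)
    next
      case (gen_step r w)
      then obtain i xs where "r = s i" "w = word_prod xs" by blast
      then have "r \<circ> w = word_prod (i # xs)" by simp
      then show ?case by blast
    next
      case (gen_inv r w)
      then obtain i xs where "r = s i" "w = word_prod xs" by blast
      then have "inv r \<circ> w = word_prod (i # xs)" by (simp add: inv_srefl)
      then show ?case by blast
    qed
  qed
  have "word_prod xs \<in> Wv D" for xs
    unfolding Wv_def Wv_par_def
    by (induction xs) (simp_all only: word_prod_Nil word_prod_Cons generated.gen_id generated.gen_step rangeI)
  then show "range word_prod \<subseteq> Wv D" by blast
qed

text \<open>
  The length of an element of the linear group \<open>W\<^sup>v\<close>, not of a matrix of its action on the roots: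
  for this length, an element that preserves the fundamental chamber is the identity on all of V
  (\<open>Wv_eq_id\<close>), also in directions that no root detects.
\<close>

definition len :: "('v \<Rightarrow> 'v) \<Rightarrow> nat" where
  "len w = (LEAST n. \<exists>xs. length xs = n \<and> word_prod xs = w)"

lemma len_le_length: "len (word_prod xs) \<le> length xs"
  unfolding len_def by (rule Least_le) blast

lemma reduced_word_exists:
  assumes "w \<in> Wv D"
  obtains xs where "word_prod xs = w" "length xs = len w"
proof -
  obtain ys where "word_prod ys = w" using assms unfolding Wv_eq_words by auto
  then have "\<exists>xs. length xs = len w \<and> word_prod xs = w"
    unfolding len_def by (intro LeastI[of "\<lambda>n. \<exists>xs. length xs = n \<and> word_prod xs = w" "length ys"]) blast
  then show ?thesis using that by blast
qed

lemma len_append: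
  assumes "w \<in> Wv D"
  shows "len (word_prod xs \<circ> w) \<le> length xs + len w"
proof -
  obtain ys where "word_prod ys = w" "length ys = len w" using reduced_word_exists[OF assms] .
  then show ?thesis using len_le_length[of "xs @ ys"] by (simp add: word_prod_append)
qed

lemma Wv_comp: "u \<in> Wv D \<Longrightarrow> w \<in> Wv D \<Longrightarrow> u \<circ> w \<in> Wv D"
  unfolding Wv_def Wv_par_def by (rule generated_comp)

lemma Wv_id [simp]: "id \<in> Wv D"
  unfolding Wv_def Wv_par_def by (rule generated.gen_id)

lemma Wv_srefl [simp]: "s i \<in> Wv D"
  unfolding Wv_def Wv_par_def by (auto intro: generated_base)

lemma Wv_bij: "w \<in> Wv D \<Longrightarrow> bij w"
  unfolding Wv_def Wv_par_def by (erule generated_bij[rotated]) (auto simp: bij_srefl)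

lemma Wv_inv: "w \<in> Wv D \<Longrightarrow> inv w \<in> Wv D"
  unfolding Wv_def Wv_par_def by (erule generated_inv[rotated]) (auto simp: bij_srefl)

lemma Wv_linear: "w \<in> Wv D \<Longrightarrow> linear w"
proof -
  have "linear (word_prod xs)" for xs
    by (induction xs) (simp_all only: word_prod_Nil word_prod_Cons linear_id linear_compose linear_srefl)
  then show "w \<in> Wv D \<Longrightarrow> linear w" unfolding Wv_eq_words by auto
qed

section \<open>Rank two\<close>

fun alt_word :: "'i \<Rightarrow> 'i \<Rightarrow> nat \<Rightarrow> 'i list" where
  "alt_word i j 0 = []"
| "alt_word i j (Suc n) = i # alt_word j i n"

lemma alt_word_numeral:
  "alt_word i j 1 = [i]" "alt_word i j 2 = [i, j]" "alt_word i j 3 = [i, j, i]"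
  "alt_word i j 4 = [i, j, i, j]" "alt_word i j 5 = [i, j, i, j, i]" "alt_word i j 6 = [i, j, i, j, i, j]"
  by (simp_all add: eval_nat_numeral)

lemma length_alt_word [simp]: "length (alt_word i j n) = n"
  by (induction n arbitrary: i j) auto

lemma set_alt_word: "set (alt_word i j n) \<subseteq> {i, j}"
  by (induction n arbitrary: i j) fastforce+

lemma alt_word_add: "\<exists>zs. set zs \<subseteq> {i, j} \<and> alt_word i j (m + n) = alt_word i j m @ zs"
proof (induction m arbitrary: i j)
  case 0
  show ?case using set_alt_word[of i j n] by auto
next
  case (Suc m)
  then show ?case by (metis alt_word.simps(2) append_Cons insert_commute add_Suc)
qed

text \<open>
  Equal neighbours in a word cancel, so a word in two letters that admits no shorter word for the same
  element must alternate.
\<close>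

lemma word_alt_or_shorter:
  assumes "set ys \<subseteq> {i, j}"
  shows "ys = alt_word i j (length ys) \<or> ys = alt_word j i (length ys) \<or>
     (\<exists>zs. set zs \<subseteq> {i, j} \<and> length zs < length ys \<and> word_prod zs = word_prod ys)"
  using assms
proof (induction ys)
  case Nil
  show ?case by simp
next
  case (Cons r ys)
  have r: "r = i \<or> r = j" and ys: "set ys \<subseteq> {i, j}" using Cons.prems by auto
  consider "ys = alt_word i j (length ys)" | "ys = alt_word j i (length ys)"
    | zs where "set zs \<subseteq> {i, j}" "length zs < length ys" "word_prod zs = word_prod ys"
    using Cons.IH[OF ys] by blast
  then show ?case
  proof cases
    case 3
    then show ?thesis using r by (intro disjI2 exI[of _ "r # zs"]) auto
  next
    case 1
    show ?thesis
    proof (cases "ys = [] \<or> r = j")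
      case True
      then show ?thesis using 1 r by auto
    next
      case False
      then obtain zs where zs: "ys = i # zs" using 1 by (metis alt_word.simps(2) length_0_conv not0_implies_Suc)
      have "word_prod (r # ys) = word_prod zs" using False r zs by (auto simp: srefl_invol)
      then show ?thesis using zs ys by (intro disjI2 exI[of _ zs]) auto
    qed
  next
    case 2
    show ?thesis
    proof (cases "ys = [] \<or> r = i")
      case True
      then show ?thesis using 2 r by auto
    next
      case False
      then obtain zs where zs: "ys = j # zs" using 2 by (metis alt_word.simps(2) length_0_conv not0_implies_Suc)
      have "word_prod (r # ys) = word_prod zs" using False r zs by (auto simp: srefl_invol)
      then show ?thesis using zs ys by (intro disjI2 exI[of _ zs]) auto
    qed
  qed
qed

text \<open>
  Both reflections preserve the affine plane through \<open>v\<close> spanned by the two coroots. In coordinates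
  \<open>(p, q)\<close> on this plane an identity between words becomes an identity between polynomials. The
  coroots may be linearly dependent; the coordinates are then not unique, but equal coordinates still
  give equal points.
\<close>

lemma srefl_plane:
  shows "s i (v + p *\<^sub>R h i + q *\<^sub>R h j) = v + (- \<alpha> i v - p - q * \<alpha> i (h j)) *\<^sub>R h i + q *\<^sub>R h j"
    and "s j (v + p *\<^sub>R h i + q *\<^sub>R h j) = v + p *\<^sub>R h i + (- \<alpha> j v - q - p * \<alpha> j (h i)) *\<^sub>R h j"
  by (simp_all add: srefl_def root_simps root_coroot algebra_simps) (simp_all add: scaleR_2 flip: scaleR_add_left)

lemma srefl_plane0:
  "s i v = v + (- \<alpha> i v) *\<^sub>R h i + 0 *\<^sub>R h j"
  "s j v = v + 0 *\<^sub>R h i + (- \<alpha> j v) *\<^sub>R h j"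
  by (simp_all add: srefl_def)

text \<open>
  The braid relations on the whole of V for the Cartan matrices of finite type A1 + A1, A2, B2 and
  G2, normalised so that the first off-diagonal entry is 0 or -1.
\<close>

lemma braid_one:
  assumes a: "\<alpha> i (h j) = - a" and b: "\<alpha> j (h i) = - b"
    and m: "(a = 0 \<and> b = 0 \<and> m = 2) \<or> (a = 1 \<and> b = 1 \<and> m = 3) \<or> (a = 1 \<and> b = 2 \<and> m = 4) \<or> (a = 1 \<and> b = 3 \<and> m = 6)"
  shows "word_prod (alt_word i j m) = word_prod (alt_word j i m)"
proof
  fix v
  define x y where "x = \<alpha> i v" and "y = \<alpha> j v"
  have r: "s i (v + p *\<^sub>R h i + q *\<^sub>R h j) = v + (- x - p + a * q) *\<^sub>R h i + q *\<^sub>R h j"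
    "s j (v + p *\<^sub>R h i + q *\<^sub>R h j) = v + p *\<^sub>R h i + (- y - q + b * p) *\<^sub>R h j" for p q
    unfolding srefl_plane a b x_def y_def by simp_all
  have r0: "s i v = v + (- x) *\<^sub>R h i + 0 *\<^sub>R h j" "s j v = v + 0 *\<^sub>R h i + (- y) *\<^sub>R h j"
    unfolding x_def y_def by (rule srefl_plane0)+
  have eq: "p = p' \<Longrightarrow> q = q' \<Longrightarrow> v + p *\<^sub>R h i + q *\<^sub>R h j = v + p' *\<^sub>R h i + q' *\<^sub>R h j" for p q p' q' :: real
    by simp
  show "word_prod (alt_word i j m) v = word_prod (alt_word j i m) v"
    using m
    apply (elim disjE conjE)
       apply (simp_all only: alt_word_numeral word_prod_Cons word_prod_Nil o_apply id_apply r r0)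
       apply (rule eq; simp add: algebra_simps)+
    done
qed

lemma braid:
  assumes a: "\<alpha> i (h j) = - a" and b: "\<alpha> j (h i) = - b"
    and m: "(a = 0 \<and> b = 0 \<and> m = 2) \<or> (a = 1 \<and> b = 1 \<and> m = 3) \<or>
      (a = 1 \<and> b = 2 \<or> a = 2 \<and> b = 1) \<and> m = 4 \<or> (a = 1 \<and> b = 3 \<or> a = 3 \<and> b = 1) \<and> m = 6"
  shows "word_prod (alt_word i j m) = word_prod (alt_word j i m)"
  using m braid_one[OF a b, of m] braid_one[OF b a, of m] by metis

lemma root_comb_srefl:
  assumes a: "\<alpha> i (h j) = - a" and b: "\<alpha> j (h i) = - b"
  shows "x * \<alpha> i (s j v) + y * \<alpha> j (s j v) = x * \<alpha> i v + (a * x - y) * \<alpha> j v"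
    and "x * \<alpha> i (s i v) + y * \<alpha> j (s i v) = (b * y - x) * \<alpha> i v + y * \<alpha> j v"
  by (simp_all add: root_srefl root_coroot a b algebra_simps)

text \<open>
  If \<open>a * b \<ge> 4\<close>, the simple roots generate an infinite dihedral group. Applying the two reflections
  alternately to a combination with nonnegative coefficients keeps the coefficients nonnegative,
  because the inequality \<open>2 x \<ge> b y\<close> before a reflection in the second root turns into \<open>2 y \<ge> a x\<close>
  after it, and conversely. Both halves are proved in one induction.
\<close>

lemma infinite_rank_two:
  assumes a: "\<alpha> i (h j) = - a" and b: "\<alpha> j (h i) = - b"
    and ab: "a \<ge> 0" "b \<ge> 0" "a * b \<ge> 4"
  shows "x \<ge> 0 \<Longrightarrow> y \<ge> 0 \<Longrightarrow> x > 0 \<or> y > 0 \<Longrightarrow> 2 * x \<ge> b * y \<Longrightarrow>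
      \<exists>x' y'. x' \<ge> 0 \<and> y' \<ge> 0 \<and> (x' > 0 \<or> y' > 0) \<and>
        (\<forall>v. x * \<alpha> i (word_prod (alt_word j i k) v) + y * \<alpha> j (word_prod (alt_word j i k) v) = x' * \<alpha> i v + y' * \<alpha> j v)"
    and "x \<ge> 0 \<Longrightarrow> y \<ge> 0 \<Longrightarrow> x > 0 \<or> y > 0 \<Longrightarrow> 2 * y \<ge> a * x \<Longrightarrow>
      \<exists>x' y'. x' \<ge> 0 \<and> y' \<ge> 0 \<and> (x' > 0 \<or> y' > 0) \<and>
        (\<forall>v. x * \<alpha> i (word_prod (alt_word i j k) v) + y * \<alpha> j (word_prod (alt_word i j k) v) = x' * \<alpha> i v + y' * \<alpha> j v)"
proof (induction k arbitrary: x y)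
  case 0
  {
    case 1
    then show ?case by (intro exI[of _ x] exI[of _ y]) simp
  next
    case 2
    then show ?case by (intro exI[of _ x] exI[of _ y]) simp
  }
next
  case (Suc k)
  have pos: "a > 0" "b > 0" using ab by (metis less_eq_real_def mult_zero_left mult_zero_right not_numeral_le_zero)+
  {
    case 1
    have "a * (2 * x) \<ge> a * (b * y)" using 1 pos by simp
    moreover have "a * b * y \<ge> 4 * y" using ab 1 by (intro mult_right_mono) auto
    ultimately have y: "a * x - y \<ge> y" and ax: "a * x \<ge> 2 * y" by (simp_all add: algebra_simps)
    have "x > 0" using 1 pos by (metis less_eq_real_def mult_pos_pos mult_zero_right not_less)
    then have "a * x > 0" using pos by simp
    then have "\<exists>x' y'. x' \<ge> 0 \<and> y' \<ge> 0 \<and> (x' > 0 \<or> y' > 0) \<and>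
        (\<forall>v. x * \<alpha> i (word_prod (alt_word i j k) v) + (a * x - y) * \<alpha> j (word_prod (alt_word i j k) v) = x' * \<alpha> i v + y' * \<alpha> j v)"
      using y ax 1 by (intro Suc.IH(2)) auto
    then show ?case unfolding alt_word.simps word_prod_Cons o_apply root_comb_srefl[OF a b] .
  next
    case 2
    have "b * (2 * y) \<ge> b * (a * x)" using 2 pos by simp
    moreover have "a * b * x \<ge> 4 * x" using ab 2 by (intro mult_right_mono) auto
    ultimately have y: "b * y - x \<ge> x" and ax: "b * y \<ge> 2 * x" by (simp_all add: algebra_simps)
    have "y > 0" using 2 pos by (metis less_eq_real_def mult_pos_pos mult_zero_right not_less)
    then have "b * y > 0" using pos by simp
    then have "\<exists>x' y'. x' \<ge> 0 \<and> y' \<ge> 0 \<and> (x' > 0 \<or> y' > 0) \<and>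
        (\<forall>v. (b * y - x) * \<alpha> i (word_prod (alt_word j i k) v) + y * \<alpha> j (word_prod (alt_word j i k) v) = x' * \<alpha> i v + y' * \<alpha> j v)"
      using y ax 2 by (intro Suc.IH(1)) auto
    then show ?case unfolding alt_word.simps word_prod_Cons o_apply root_comb_srefl[OF a b] .
  }
qed

text \<open>
  If \<open>a * b \<le> 3\<close>, only words shorter than the order \<open>m\<close> of the product of the two reflections have to
  be considered, and the coefficients are a short list of polynomials in \<open>a\<close> and \<open>b\<close>.
\<close>

lemma finite_rank_two:
  assumes a: "\<alpha> i (h j) = - a" and b: "\<alpha> j (h i) = - b"
    and m: "(a = 0 \<and> b = 0 \<and> m = 2) \<or> (a = 1 \<and> b = 1 \<and> m = 3) \<or>
      (a = 1 \<and> b = 2 \<or> a = 2 \<and> b = 1) \<and> m = 4 \<or> (a = 1 \<and> b = 3 \<or> a = 3 \<and> b = 1) \<and> m = 6"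
    and k: "k < m"
  shows "\<exists>x y. x \<ge> 0 \<and> y \<ge> 0 \<and> (x > 0 \<or> y > 0) \<and>
        (\<forall>v. \<alpha> i (word_prod (alt_word j i k) v) = x * \<alpha> i v + y * \<alpha> j v)"
proof -
  have r: "\<alpha> j (s j v) = - \<alpha> j v" "\<alpha> i (s i v) = - \<alpha> i v"
    "\<alpha> i (s j v) = \<alpha> i v + a * \<alpha> j v" "\<alpha> j (s i v) = \<alpha> j v + b * \<alpha> i v" for v
    by (simp_all add: root_srefl root_coroot a b)
  have c: "\<exists>x y. x \<ge> 0 \<and> y \<ge> 0 \<and> (x > 0 \<or> y > 0) \<and> (\<forall>v. f v = x * \<alpha> i v + y * \<alpha> j v)"
    if "x \<ge> 0" "y \<ge> 0" "x > 0 \<or> y > 0" "\<And>v. f v = x * \<alpha> i v + y * \<alpha> j v" for x y :: real and f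
    using that by blast
  have e: "\<alpha> i (word_prod (alt_word j i 0) v) = 1 * \<alpha> i v + 0 * \<alpha> j v"
    "\<alpha> i (word_prod (alt_word j i 1) v) = 1 * \<alpha> i v + a * \<alpha> j v"
    "\<alpha> i (word_prod (alt_word j i 2) v) = (a * b - 1) * \<alpha> i v + a * \<alpha> j v"
    "\<alpha> i (word_prod (alt_word j i 3) v) = (a * b - 1) * \<alpha> i v + (a * (a * b - 2)) * \<alpha> j v"
    "\<alpha> i (word_prod (alt_word j i 4) v) = ((a * b)\<^sup>2 - 3 * (a * b) + 1) * \<alpha> i v + (a * (a * b - 2)) * \<alpha> j v"
    "\<alpha> i (word_prod (alt_word j i 5) v) = ((a * b)\<^sup>2 - 3 * (a * b) + 1) * \<alpha> i v + (a * ((a * b)\<^sup>2 - 4 * (a * b) + 3)) * \<alpha> j v" for v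
    by (simp_all only: alt_word.simps(1) alt_word_numeral word_prod_Cons word_prod_Nil o_apply id_apply r)
      (simp_all add: algebra_simps power2_eq_square)
  consider "k = 0" | "k = 1" | "k = 2" | "k = 3" | "k = 4" | "k = 5" using m k by linarith
  then show ?thesis
  proof cases
    assume k: "k = 0"
    show ?thesis unfolding k by (rule c[OF _ _ _ e(1)]) auto
  next
    assume k: "k = 1"
    show ?thesis unfolding k by (rule c[OF _ _ _ e(2)]) (use m in auto)
  next
    assume k2: "k = 2"
    show ?thesis unfolding k2 by (rule c[OF _ _ _ e(3)]) (use m k k2 in auto)
  next
    assume k3: "k = 3"
    show ?thesis unfolding k3 by (rule c[OF _ _ _ e(4)]) (use m k k3 in auto)
  next
    assume k4: "k = 4"
    show ?thesis unfolding k4 by (rule c[OF _ _ _ e(5)]) (use m k k4 in auto)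
  next
    assume k5: "k = 5"
    show ?thesis unfolding k5 by (rule c[OF _ _ _ e(6)]) (use m k k5 in auto)
  qed
qed

text \<open>
  By integrality, if the product of the two entries is below 4, it is 0, 1, 2 or 3, and
  the entries themselves are known.
\<close>

lemma cartan_rank_two:
  assumes ij: "i \<noteq> j"
  obtains a b where "\<alpha> i (h j) = - a" "\<alpha> j (h i) = - b" "a \<ge> 0" "b \<ge> 0" "a * b \<ge> 4"
  | a b m where "\<alpha> i (h j) = - a" "\<alpha> j (h i) = - b"
    "(a = 0 \<and> b = 0 \<and> m = (2::nat)) \<or> (a = 1 \<and> b = 1 \<and> m = 3) \<or>
      (a = 1 \<and> b = 2 \<or> a = 2 \<and> b = 1) \<and> m = 4 \<or> (a = 1 \<and> b = 3 \<or> a = 3 \<and> b = 1) \<and> m = 6"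
proof -
  obtain p q :: int where pq: "\<alpha> i (h j) = - of_int p" "\<alpha> j (h i) = - of_int q"
    using cartan_entry[OF ij] cartan_entry[OF ij[symmetric]] by (metis Ints_cases add.inverse_inverse of_int_minus)
  have nn: "p \<ge> 0" "q \<ge> 0"
    using cartan_entry[OF ij] cartan_entry[OF ij[symmetric]] unfolding pq by auto
  have z: "p = 0 \<longleftrightarrow> q = 0"
    using cartan_entry_zero[of i j] cartan_entry_zero[of j i] unfolding pq by auto
  consider "p * q \<ge> 4" | "p = 0" "q = 0" | "p * q < 4" "p \<ge> 1" "q \<ge> 1"
    using z nn by linarith
  then show ?thesis
  proof cases
    case 1
    then have "real_of_int p * of_int q \<ge> 4" by (metis of_int_le_iff of_int_mult of_int_numeral)
    then show ?thesis using that(1)[OF pq] nn by simp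
  next
    case 2
    then show ?thesis using that(2)[OF pq, of 2] by simp
  next
    case 3
    have "p * 1 \<le> p * q" "1 * q \<le> p * q" using 3 by (intro mult_left_mono mult_right_mono; simp)+
    then have "p = 1 \<or> p = 2 \<or> p = 3" "q = 1 \<or> q = 2 \<or> q = 3" using 3 by linarith+
    then have "(p = 1 \<and> q = 1) \<or> (p = 1 \<and> q = 2 \<or> p = 2 \<and> q = 1) \<or> (p = 1 \<and> q = 3 \<or> p = 3 \<and> q = 1)"
      using 3 by auto
    then show ?thesis using that(2)[OF pq, of 3] that(2)[OF pq, of 4] that(2)[OF pq, of 6] by auto
  qed
qed

text \<open>
  The hypothesis says that multiplying the alternating word by the reflection in \<open>i\<close> does not make it
  shorter. In a finite dihedral group this bounds its length by the order \<open>m\<close>, since from length \<open>m\<close>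
  on the braid relation lets the word begin with \<open>i\<close>.
\<close>

lemma reduced_alt_word_pos:
  assumes ij: "i \<noteq> j"
    and red: "\<And>zs. set zs \<subseteq> {i, j} \<Longrightarrow> s i \<circ> word_prod (alt_word j i k) = word_prod zs \<Longrightarrow> k \<le> length zs"
  shows "\<exists>x y. x \<ge> 0 \<and> y \<ge> 0 \<and> (x > 0 \<or> y > 0) \<and>
        (\<forall>v. \<alpha> i (word_prod (alt_word j i k) v) = x * \<alpha> i v + y * \<alpha> j v)"
proof (cases rule: cartan_rank_two[OF ij])
  case (1 a b)
  then show ?thesis using infinite_rank_two(1)[of i j a b 1 0 k] by simp
next
  case (2 a b m)
  have "k < m"
  proof (rule ccontr)
    assume "\<not> k < m"
    then obtain n where n: "k = m + n" by (metis le_iff_add not_less)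
    then obtain zs where zs: "set zs \<subseteq> {j, i}" "alt_word j i k = alt_word j i m @ zs"
      using alt_word_add by blast
    obtain m' where m': "m = Suc m'" using 2(3) by (metis not0_implies_Suc zero_neq_numeral)
    have "word_prod (alt_word j i k) = s i \<circ> word_prod (alt_word j i m' @ zs)"
      using braid[OF 2] unfolding zs(2) word_prod_append by (simp add: m' comp_assoc[symmetric])
    then have "s i \<circ> word_prod (alt_word j i k) = word_prod (alt_word j i m' @ zs)"
      by (simp add: srefl_comp flip: comp_assoc)
    then have "k \<le> length (alt_word j i m' @ zs)"
      using red zs(1) set_alt_word[of j i m'] by (metis Un_subset_iff insert_commute set_append)
    moreover have "length (alt_word j i m' @ zs) < k"
      using arg_cong[OF zs(2), of length] m' by simp
    ultimately show False by simp
  qed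
  then show ?thesis using finite_rank_two[OF 2] by blast
qed

section \<open>The sign of a real root on the fundamental chamber\<close>

definition root_pos :: "('v \<Rightarrow> real) \<Rightarrow> bool" where
  "root_pos \<beta> \<longleftrightarrow> (\<forall>v\<in>C. \<beta> v > 0)"

lemma chamber_iff: "v \<in> C \<longleftrightarrow> (\<forall>i. \<alpha> i v > 0)"
  by (simp add: chamber_def std_face_def)

text \<open>
  Let \<open>j\<close> be the first letter of a reduced word of \<open>w\<close>; it differs from \<open>i\<close>.
  Write \<open>w\<close> as a word in the letters \<open>i\<close> and \<open>j\<close> times an element \<open>v\<close> that is shortest in its coset. By
  induction \<open>v\<close> makes both simple roots positive, and by the rank two case the word in \<open>i\<close> and \<open>j\<close>
  turns the root of \<open>i\<close> into a nonnegative combination of these two.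
\<close>

theorem root_pos_of_len:
  assumes "w \<in> Wv D" "len w \<le> len (s i \<circ> w)"
  shows "root_pos (\<alpha> i \<circ> w)"
  using assms
proof (induction "len w" arbitrary: w i rule: less_induct)
  case less
  obtain xs where xs: "word_prod xs = w" "length xs = len w" using reduced_word_exists[OF less.prems(1)] .
  show ?case
  proof (cases xs)
    case Nil
    then show ?thesis using xs by (auto simp: root_pos_def chamber_iff)
  next
    case (Cons j ys)
    define w' where "w' = word_prod ys"
    have w': "w' \<in> Wv D" "w = s j \<circ> w'" using xs Cons unfolding w'_def Wv_eq_words by auto
    have lw': "len w' < len w" using len_le_length[of ys] xs Cons unfolding w'_def by simp
    have "s j \<circ> w = w'" unfolding w'(2) by (simp add: srefl_comp flip: comp_assoc)
    then have ij: "i \<noteq> j" using lw' less.prems(2) by auto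
    \<comment> \<open>the possible right factors of reduced factorizations of w whose left factor is a word in i and j\<close>
    define P where "P = (\<lambda>v. v \<in> Wv D \<and> (\<exists>zs. set zs \<subseteq> {i, j} \<and> w = word_prod zs \<circ> v \<and> length zs + len v = len w))"
    have "len w = Suc (len w')"
      using lw' len_append[OF w'(1), of "[j]"] w'(2) by simp
    then have "P w'" unfolding P_def using w' by (intro conjI exI[of _ "[j]"]) auto
    then obtain v where v: "P v" "\<And>v'. P v' \<Longrightarrow> len v \<le> len v'"
      using ex_has_least_nat[of P w' len] by blast
    obtain zs where zs: "set zs \<subseteq> {i, j}" "w = word_prod zs \<circ> v" "length zs + len v = len w" and vW: "v \<in> Wv D"
      using v(1) unfolding P_def by blast
    have lv: "len v < len w" using v(2)[OF \<open>P w'\<close>] lw' by simp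
    \<comment> \<open>otherwise a letter could be moved from v to the word, against the minimality of v\<close>
    have up: "len v \<le> len (s r \<circ> v)" if r: "r \<in> {i, j}" for r
    proof (rule ccontr)
      assume "\<not> ?thesis"
      moreover have W: "s r \<circ> v \<in> Wv D" using vW by (rule Wv_comp[OF Wv_srefl])
      moreover have eq: "w = word_prod (zs @ [r]) \<circ> (s r \<circ> v)"
        unfolding zs(2) by (simp add: word_prod_append fun_eq_iff srefl_invol)
      moreover have "len w \<le> length (zs @ [r]) + len (s r \<circ> v)"
        using len_append[OF W, of "zs @ [r]"] unfolding eq[symmetric] .
      ultimately have "P (s r \<circ> v)" "len (s r \<circ> v) < len v"
        unfolding P_def using zs(1,3) r by (auto intro!: exI[of _ "zs @ [r]"])
      then show False using v(2) by fastforce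
    qed
    have pos: "root_pos (\<alpha> i \<circ> v)" "root_pos (\<alpha> j \<circ> v)"
      using less.hyps[OF lv vW] up by auto
    have min1: "length zs \<le> length us" if "word_prod us = word_prod zs" for us
      using len_append[OF vW, of us] zs(2,3) that by simp
    have min2: "length zs \<le> length us" if "s i \<circ> word_prod zs = word_prod us" for us
      using len_append[OF vW, of us] zs(2,3) that[symmetric] less.prems(2) by (simp add: comp_assoc)
    have "zs = alt_word j i (length zs)"
    proof (cases "zs = []")
      case False
      then obtain n where n: "length zs = Suc n" by (cases zs) auto
      have False if *: "zs = alt_word i j (length zs)"
      proof -
        have "s i \<circ> word_prod zs = word_prod (alt_word j i n)"
          by (subst *) (simp add: n srefl_comp flip: comp_assoc)
        then show False using min2 n by fastforce
      qed
      then show ?thesis using word_alt_or_shorter[OF zs(1)] min1 by fastforce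
    qed simp
    then obtain k where k: "zs = alt_word j i k" by blast
    have "\<exists>x y. x \<ge> 0 \<and> y \<ge> 0 \<and> (x > 0 \<or> y > 0) \<and>
        (\<forall>v. \<alpha> i (word_prod (alt_word j i k) v) = x * \<alpha> i v + y * \<alpha> j v)"
      using min2 unfolding k by (intro reduced_alt_word_pos[OF ij]) auto
    then obtain x y where xy: "x \<ge> 0" "y \<ge> 0" "x > 0 \<or> y > 0" "\<And>u. \<alpha> i (word_prod zs u) = x * \<alpha> i u + y * \<alpha> j u"
      unfolding k by blast
    have "x * \<alpha> i (v u) + y * \<alpha> j (v u) > 0" if u: "u \<in> C" for u
    proof -
      have "\<alpha> i (v u) > 0" "\<alpha> j (v u) > 0" using pos u unfolding root_pos_def by auto
      then show ?thesis using xy(1-3) by (metis add_nonneg_pos add_pos_nonneg less_imp_le mult_nonneg_nonneg mult_pos_pos)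
    qed
    then show ?thesis unfolding root_pos_def zs(2) by (simp add: xy(4))
  qed
qed

theorem root_sign:
  assumes "w \<in> Wv D"
  shows "(\<forall>v\<in>C. \<alpha> i (w v) > 0) \<or> (\<forall>v\<in>C. \<alpha> i (w v) < 0)"
proof (cases "len w \<le> len (s i \<circ> w)")
  case True
  then show ?thesis using root_pos_of_len[OF assms True] by (simp add: root_pos_def)
next
  case False
  have "s i \<circ> (s i \<circ> w) = w" by (simp add: srefl_comp flip: comp_assoc)
  then have "root_pos (\<alpha> i \<circ> (s i \<circ> w))"
    using False assms by (intro root_pos_of_len) (auto intro: Wv_comp)
  then show ?thesis by (simp add: root_pos_def root_srefl root_coroot)
qed

text \<open>
  This is where the linear independence of the simple roots is used: a proper range would lie in the
  kernel of a nonzero linear form, that is, of a linear relation between the roots.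
\<close>

lemma root_surj: "\<exists>v. \<forall>i. \<alpha> i v = c i"
proof -
  define T :: "'v \<Rightarrow> real ^ 'i" where "T = (\<lambda>v. \<chi> i. \<alpha> i v)"
  have lin: "linear T"
    by (rule linearI) (auto simp: T_def root_simps vec_eq_iff)
  have "range T = UNIV"
  proof (rule ccontr)
    assume "range T \<noteq> UNIV"
    moreover have sub: "subspace (range T)" using lin by (rule linear_subspace_image) simp
    ultimately have "span (range T) \<noteq> UNIV" by (metis span_eq_iff)
    then obtain a where a: "a \<noteq> 0" "\<forall>x\<in>span (range T). a \<bullet> x = 0"
      using span_not_UNIV_orthogonal by blast
    have "(\<Sum>i\<in>UNIV. a $ i * \<alpha> i v) = 0" for v
      using a(2)[rule_format, of "T v"] by (auto simp: T_def inner_vec_def intro: span_base)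
    then have "a $ i = 0" for i using root_indep[of "\<lambda>i. a $ i"] by blast
    then show False using a(1) by (simp add: vec_eq_iff)
  qed
  then obtain v where "T v = (\<chi> i. c i)" by (metis UNIV_I imageE)
  then show ?thesis by (auto simp: T_def vec_eq_iff)
qed

lemma chamber_nonempty: "C \<noteq> {}"
proof -
  obtain v where "\<And>i. \<alpha> i v = 1" using root_surj[of "\<lambda>_. 1"] by blast
  then have "v \<in> C" by (simp add: chamber_iff)
  then show ?thesis by blast
qed

text \<open>
  The first letter of a nonempty reduced word of \<open>w\<close> belongs to a simple root that \<open>w\<close> makes negative.
\<close>

lemma Wv_eq_id:
  assumes w: "w \<in> Wv D" and pos: "\<And>v i. v \<in> C \<Longrightarrow> \<alpha> i (w v) > 0"
  shows "w = id"
proof -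
  obtain xs where xs: "word_prod xs = w" "length xs = len w" using reduced_word_exists[OF w] .
  show ?thesis
  proof (cases xs)
    case Nil
    then show ?thesis using xs by simp
  next
    case (Cons j ys)
    define w' where "w' = word_prod ys"
    have w': "w' \<in> Wv D" "w = s j \<circ> w'" using xs Cons unfolding w'_def Wv_eq_words by auto
    have lw': "len w' < len w" using len_le_length[of ys] xs Cons unfolding w'_def by simp
    have "root_pos (\<alpha> j \<circ> w')"
      using root_pos_of_len[OF w'(1), of j] lw' w'(2) by simp
    moreover obtain v where "v \<in> C" using chamber_nonempty by blast
    ultimately show ?thesis
      using pos[of v j] unfolding w'(2) root_pos_def by (simp add: root_srefl root_coroot) (metis not_less_iff_gr_or_eq)
  qed
qed

end

section \<open>Vectorial chambers\<close>

definition sector :: "'v::real_vector \<Rightarrow> 'v set \<Rightarrow> 'v set" where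
  "sector x X = (+) x ` X"

lemma mem_sector: "y \<in> sector x X \<longleftrightarrow> y - x \<in> X"
  by (force simp: sector_def)

lemma eventually_local_face:
  fixes x :: "'v::real_normed_vector"
  shows "eventually P (local_face x X) \<longleftrightarrow> (\<exists>e>0. \<forall>y. dist y x < e \<and> y - x \<in> X \<longrightarrow> P y)"
  unfolding local_face_def germ_def eventually_inf_principal eventually_nhds_metric
  by (auto simp: mem_sector simp flip: sector_def)

lemma filter_le_principal_iff: "F \<le> principal S \<longleftrightarrow> eventually (\<lambda>x. x \<in> S) F"
  by (rule le_principal)

context apartment_model
begin

text \<open>
  Chambers of both signs, since the notion of a local chamber that covers a panel does not prescribe a
  sign.
\<close>

definition chambers :: "'v set set" where
  "chambers = signed_faces D {{}}"

lemma chambersE: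
  assumes "X \<in> chambers"
  obtains \<sigma> w where "\<sigma> = 1 \<or> \<sigma> = - 1" "w \<in> Wv D" "X = (\<lambda>v. \<sigma> *\<^sub>R w v) ` C"
proof -
  have "\<exists>w. w \<in> Wv D \<and> (X = (\<lambda>v. 1 *\<^sub>R w v) ` C \<or> X = (\<lambda>v. (- 1) *\<^sub>R w v) ` C)"
    using assms unfolding chambers_def signed_faces_def vec_faces_def chamber_def by blast
  then show ?thesis using that by blast
qed

lemma chambersI:
  assumes "\<sigma> = 1 \<or> \<sigma> = - 1" "w \<in> Wv D"
  shows "(\<lambda>v. \<sigma> *\<^sub>R w v) ` C \<in> chambers"
  using assms unfolding chambers_def signed_faces_def vec_faces_def chamber_def by auto

lemma Wv_inv_cancel:
  assumes "w \<in> Wv D"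
  shows "w (inv w v) = v" "inv w (w v) = v"
  using Wv_bij[OF assms] by (simp_all add: bij_is_surj surj_f_inv_f bij_is_inj inv_f_f)

lemma mem_chamber_iff:
  assumes \<sigma>: "\<sigma> = 1 \<or> \<sigma> = - 1" and w: "w \<in> Wv D"
  shows "v \<in> (\<lambda>v. \<sigma> *\<^sub>R w v) ` C \<longleftrightarrow> (\<forall>i. \<sigma> * \<alpha> i (inv w v) > 0)"
proof -
  have lin: "linear w" "linear (inv w)" using w Wv_inv Wv_linear by auto
  have "v = \<sigma> *\<^sub>R w u \<longleftrightarrow> u = \<sigma> *\<^sub>R inv w v" for u
  proof
    assume "v = \<sigma> *\<^sub>R w u"
    then show "u = \<sigma> *\<^sub>R inv w v" using \<sigma> by (auto simp: linear_cmul[OF lin(2)] Wv_inv_cancel[OF w] linear_neg[OF lin(2)])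
  next
    assume "u = \<sigma> *\<^sub>R inv w v"
    then show "v = \<sigma> *\<^sub>R w u" using \<sigma> by (auto simp: linear_cmul[OF lin(1)] Wv_inv_cancel[OF w] linear_neg[OF lin(1)])
  qed
  then have "v \<in> (\<lambda>v. \<sigma> *\<^sub>R w v) ` C \<longleftrightarrow> \<sigma> *\<^sub>R inv w v \<in> C"
    unfolding image_iff by (metis (no_types))
  then show ?thesis by (simp add: chamber_iff root_simps)
qed

text \<open>
  No wall meets a chamber, so a chamber is determined by the signs of the roots at one of its points
  (\<open>chambers_meet\<close>).
\<close>

lemma chamber_root_sign:
  assumes X: "X \<in> chambers" and w: "w \<in> Wv D"
  shows "(\<forall>v\<in>X. \<alpha> i (w v) > 0) \<or> (\<forall>v\<in>X. \<alpha> i (w v) < 0)"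
proof -
  obtain \<sigma> u where u: "\<sigma> = 1 \<or> \<sigma> = - 1" "u \<in> Wv D" "X = (\<lambda>v. \<sigma> *\<^sub>R u v) ` C" using X by (rule chambersE)
  have "\<alpha> i (w (\<sigma> *\<^sub>R u v)) = \<sigma> * \<alpha> i ((w \<circ> u) v)" for v
    by (simp add: linear_cmul[OF Wv_linear[OF w]] root_simps)
  then show ?thesis using root_sign[OF Wv_comp[OF w u(2)], of i] u(1,3) by auto
qed

lemma chambers_meet:
  assumes X: "X \<in> chambers" and Y: "Y \<in> chambers" and v: "v \<in> X" "v \<in> Y"
  shows "X = Y"
proof -
  have "Y \<subseteq> X" if X: "X \<in> chambers" and Y: "Y \<in> chambers" and v: "v \<in> X" "v \<in> Y" for X Y
  proof
    obtain \<sigma> w where w: "\<sigma> = 1 \<or> \<sigma> = - 1" "w \<in> Wv D" "X = (\<lambda>v. \<sigma> *\<^sub>R w v) ` C" using X by (rule chambersE)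
    fix y assume y: "y \<in> Y"
    have "\<sigma> * \<alpha> i (inv w y) > 0" for i
      using chamber_root_sign[OF Y Wv_inv[OF w(2)], of i] v y w(1)
      unfolding w(3) mem_chamber_iff[OF w(1,2)] by (metis (no_types, opaque_lifting) mult_1 mult_minus1 neg_0_less_iff_less order_less_asym)
    then show "y \<in> X" unfolding w(3) mem_chamber_iff[OF w(1,2)] by blast
  qed
  then show ?thesis using X Y v by blast
qed

lemma C_chamber [simp]: "C \<in> chambers"
  using chambersI[of 1 id] by simp

lemma Wv_image_chamber:
  assumes "X \<in> chambers" "w \<in> Wv D"
  shows "w ` X \<in> chambers"
proof -
  obtain \<sigma> u where u: "\<sigma> = 1 \<or> \<sigma> = - 1" "u \<in> Wv D" "X = (\<lambda>v. \<sigma> *\<^sub>R u v) ` C" using assms(1) by (rule chambersE)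
  have "w ` X = (\<lambda>v. \<sigma> *\<^sub>R (w \<circ> u) v) ` C"
    unfolding u(3) image_image by (simp add: linear_cmul[OF Wv_linear[OF assms(2)]])
  then show ?thesis using chambersI[OF u(1) Wv_comp[OF assms(2) u(2)]] by simp
qed

lemma chambers_nonempty: "X \<in> chambers \<Longrightarrow> X \<noteq> {}"
  using chamber_nonempty by (auto elim: chambersE)

lemma chambers_open: "X \<in> chambers \<Longrightarrow> open X"
proof (erule chambersE)
  fix \<sigma> w assume w: "\<sigma> = 1 \<or> \<sigma> = - 1" "w \<in> Wv D" "X = (\<lambda>v. \<sigma> *\<^sub>R w v) ` C"
  have "continuous_on UNIV (\<lambda>v. \<sigma> * \<alpha> i (inv w v))" for i
  proof -
    have "linear (\<alpha> i \<circ> inv w)" using linear_compose[OF Wv_linear[OF Wv_inv[OF w(2)]] linear_root] .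
    then have "continuous_on UNIV (\<alpha> i \<circ> inv w)" unfolding linear_conv_bounded_linear by (rule linear_continuous_on)
    then show ?thesis unfolding o_def by (intro continuous_intros)
  qed
  then have "open {v. 0 < \<sigma> * \<alpha> i (inv w v)}" for i
    by (intro open_Collect_less continuous_on_const)
  then have "open (\<Inter>i. {v. 0 < \<sigma> * \<alpha> i (inv w v)})" by (intro open_INT) auto
  moreover have "X = (\<Inter>i. {v. 0 < \<sigma> * \<alpha> i (inv w v)})"
    using mem_chamber_iff[OF w(1,2)] w(3) by auto
  ultimately show "open X" by simp
qed

lemma chambers_add: "X \<in> chambers \<Longrightarrow> x \<in> X \<Longrightarrow> y \<in> X \<Longrightarrow> x + y \<in> X"
proof (erule chambersE)
  fix \<sigma> w assume w: "\<sigma> = 1 \<or> \<sigma> = - 1" "w \<in> Wv D" "X = (\<lambda>v. \<sigma> *\<^sub>R w v) ` C" and xy: "x \<in> X" "y \<in> X"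
  have "linear (inv w)" using w Wv_inv Wv_linear by auto
  then show "x + y \<in> X" using xy unfolding w(3) mem_chamber_iff[OF w(1,2)]
    by (simp add: linear_add root_simps distrib_left add_pos_pos)
qed

lemma chambers_scale: "X \<in> chambers \<Longrightarrow> x \<in> X \<Longrightarrow> t > 0 \<Longrightarrow> t *\<^sub>R x \<in> X"
proof (erule chambersE)
  fix \<sigma> w assume w: "\<sigma> = 1 \<or> \<sigma> = - 1" "w \<in> Wv D" "X = (\<lambda>v. \<sigma> *\<^sub>R w v) ` C" and xy: "x \<in> X" "t > 0"
  have "linear (inv w)" using w Wv_inv Wv_linear by auto
  then show "t *\<^sub>R x \<in> X" using xy unfolding w(3) mem_chamber_iff[OF w(1,2)]
    by (simp add: linear_cmul root_simps mult.left_commute[of \<sigma>])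
qed

lemma chambers_small:
  assumes "X \<in> chambers" "e > 0"
  obtains v where "v \<in> X" "norm v < e"
proof -
  obtain x where x: "x \<in> X" using chambers_nonempty[OF assms(1)] by blast
  define t where "t = e / (norm x + 1)"
  have "norm x + 1 > 0" by (smt (verit) norm_ge_zero)
  then have "t > 0" "norm (t *\<^sub>R x) < e"
    using assms(2) by (simp_all add: t_def field_simps)
  then show ?thesis using that chambers_scale[OF assms(1) x] by blast
qed

text \<open>
  Two parallel sectors meet, and their intersection contains a sector: an open cone contains
  translates of any bounded set.
\<close>

lemma chambers_absorb:
  assumes "X \<in> chambers"
  obtains \<xi> where "\<xi> \<in> X" "\<xi> - a \<in> X"
proof -
  obtain v where v: "v \<in> X" using chambers_nonempty[OF assms] by blast
  obtain e where e: "e > 0" "\<And>y. dist y v < e \<Longrightarrow> y \<in> X"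
    using chambers_open[OF assms] v unfolding open_dist by blast
  define t where "t = e / (norm a + 1)"
  have n: "norm a + 1 > 0" by (smt (verit) norm_ge_zero)
  have t: "t > 0" using e n by (simp add: t_def)
  have "dist (v - t *\<^sub>R a) v < e" using e n by (simp add: dist_norm t_def field_simps)
  then have "(1 / t) *\<^sub>R (v - t *\<^sub>R a) \<in> X" using e t by (intro chambers_scale[OF assms]) auto
  then have "(1 / t) *\<^sub>R v - a \<in> X" using t by (simp add: scaleR_diff_right)
  moreover have "(1 / t) *\<^sub>R v \<in> X" using t v by (intro chambers_scale[OF assms]) auto
  ultimately show ?thesis using that by blast
qed

text \<open>
  Otherwise a conjugate of \<open>inv w' \<circ> w\<close> would be a nontrivial element that preserves the fundamental
  chamber.
\<close>

lemma Wv_eq_of_chamber: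
  assumes X: "X \<in> chambers" and w: "w \<in> Wv D" "w' \<in> Wv D" and eq: "w ` X = w' ` X"
  shows "w = w'"
proof -
  obtain \<sigma> u where u: "\<sigma> = 1 \<or> \<sigma> = - 1" "u \<in> Wv D" "X = (\<lambda>v. \<sigma> *\<^sub>R u v) ` C" using X by (rule chambersE)
  define z where "z = inv u \<circ> (inv w' \<circ> (w \<circ> u))"
  have z: "z \<in> Wv D" unfolding z_def by (intro Wv_comp Wv_inv w u)
  have "\<alpha> i (z v) > 0" if v: "v \<in> C" for v i
  proof -
    have "\<sigma> *\<^sub>R u v \<in> X" using v u by blast
    then have "w (\<sigma> *\<^sub>R u v) \<in> w' ` X" using eq by blast
    then obtain v' where v': "v' \<in> C" "w (\<sigma> *\<^sub>R u v) = w' (\<sigma> *\<^sub>R u v')" unfolding u(3) by blast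
    then have "\<sigma> *\<^sub>R w (u v) = \<sigma> *\<^sub>R w' (u v')"
      by (simp add: linear_cmul[OF Wv_linear] w)
    then have "w (u v) = w' (u v')" using u(1) by auto
    then have "z v = v'" by (simp add: z_def Wv_inv_cancel w u)
    then show ?thesis using v' by (simp add: chamber_iff)
  qed
  then have "z = id" by (rule Wv_eq_id[OF z])
  then have "u \<circ> z = u" by simp
  then have "inv w' \<circ> (w \<circ> u) = u" unfolding z_def by (simp add: fun_eq_iff Wv_inv_cancel u)
  then have "w' \<circ> (inv w' \<circ> (w \<circ> u)) = w' \<circ> u" by simp
  then have "w \<circ> u = w' \<circ> u" by (simp add: fun_eq_iff Wv_inv_cancel w)
  then show ?thesis by (metis Wv_bij u(2) bij_is_surj surj_fun_eq comp_apply image_eqI UNIV_I fun_eq_iff Wv_inv_cancel(1))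
qed

definition panel :: "'i \<Rightarrow> 'v set" where
  "panel i = std_face D {i}"

lemma mem_panel: "v \<in> panel i \<longleftrightarrow> \<alpha> i v = 0 \<and> (\<forall>j. j \<noteq> i \<longrightarrow> \<alpha> j v > 0)"
  by (auto simp: panel_def std_face_def)

lemma panel_scale: "v \<in> panel i \<Longrightarrow> t > 0 \<Longrightarrow> t *\<^sub>R v \<in> panel i"
  by (simp add: mem_panel root_simps)

lemma panel_nonempty: "panel i \<noteq> {}"
proof -
  obtain v where "\<And>j. \<alpha> j v = (if j = i then 0 else 1)"
    using root_surj[of "\<lambda>j. if j = i then 0 else 1"] by blast
  then have "v \<in> panel i" by (simp add: mem_panel)
  then show ?thesis by blast
qed

lemma panel_small:
  assumes "e > 0"
  obtains v where "v \<in> panel i" "norm v < e"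
proof -
  obtain x where x: "x \<in> panel i" using panel_nonempty by blast
  define t where "t = e / (norm x + 1)"
  have "norm x + 1 > 0" by (smt (verit) norm_ge_zero)
  then have "t > 0" "norm (t *\<^sub>R x) < e"
    using assms by (simp_all add: t_def field_simps)
  then show ?thesis using that panel_scale[OF x] by blast
qed

lemma chamber_of_panel_positive:
  assumes X: "X \<in> chambers" and cl: "panel i \<subseteq> closure X" and pos: "\<forall>v\<in>X. \<alpha> i v > 0"
  shows "X = C"
proof -
  obtain u where u: "u \<in> panel i" using panel_nonempty by blast
  have "\<alpha> j v > 0" if v: "v \<in> X" for j v
  proof (cases "j = i")
    case False
    show ?thesis
    proof (rule ccontr)
      assume "\<not> ?thesis"
      then have "\<forall>v\<in>X. \<alpha> j v < 0" using chamber_root_sign[OF X Wv_id, of j] v by force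
      then have "X \<subseteq> {v. \<alpha> j v \<le> 0}" by force
      moreover have "closed {v. \<alpha> j v \<le> 0}"
        using linear_root[of j] by (intro closed_Collect_le continuous_intros) (simp add: linear_continuous_on linear_conv_bounded_linear)
      ultimately have "\<alpha> j u \<le> 0" using cl u closure_minimal by blast
      then show False using u False by (force simp: mem_panel)
    qed
  qed (use pos v in auto)
  then have "X \<subseteq> C" by (auto simp: chamber_iff)
  then show ?thesis using chambers_meet[OF X C_chamber] chambers_nonempty[OF X] by blast
qed

text \<open>
  After a reflection the root \<open>\<alpha>\<^sub>i\<close> is positive on \<open>X\<close>. The other simple roots are positive on the
  panel, so by constancy of the sign they are positive on \<open>X\<close>, too. Hence \<open>X\<close> is contained in the
  fundamental chamber. The argument does not distinguish the sign of \<open>X\<close>, so for finite \<open>W\<^sup>v\<close> it also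
  covers the negative chambers.
\<close>

theorem chambers_of_panel:
  assumes X: "X \<in> chambers" and cl: "panel i \<subseteq> closure X"
  shows "X = C \<or> X = s i ` C"
proof (cases "\<forall>v\<in>X. \<alpha> i v > 0")
  case True
  then show ?thesis using chamber_of_panel_positive[OF X cl] by blast
next
  case False
  then have neg: "\<forall>v\<in>X. \<alpha> i v < 0" using chamber_root_sign[OF X Wv_id, of i] by auto
  have sX: "s i ` X \<in> chambers" by (rule Wv_image_chamber[OF X Wv_srefl])
  have "s i ` panel i = panel i"
    by (force simp: srefl_def mem_panel image_iff)
  moreover have "s i ` closure X \<subseteq> closure (s i ` X)"
    by (rule closure_linear_image_subset[OF linear_srefl])
  ultimately have "panel i \<subseteq> closure (s i ` X)" using cl by blast
  moreover have "\<forall>v\<in>s i ` X. \<alpha> i v > 0" using neg by (auto simp: root_srefl root_coroot)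
  ultimately have "s i ` X = C" using chamber_of_panel_positive[OF sX] by blast
  then have "s i ` s i ` X = s i ` C" by simp
  then show ?thesis by (simp add: image_image srefl_invol)
qed

section \<open>The affine Weyl group\<close>

lemma root_pairsE:
  assumes "(\<beta>, b) \<in> root_pairs D"
  obtains w i where "w \<in> Wv D" "\<beta> = \<alpha> i \<circ> inv w" "b = w (h i)"
  using assms unfolding root_pairs_def by blast

lemma root_pair_reflection:
  assumes "w \<in> Wv D"
  shows "v - (\<alpha> i (inv w v) + k) *\<^sub>R w (h i) = (w \<circ> (s i \<circ> inv w)) v + (- k) *\<^sub>R w (h i)"
proof -
  have "w (s i (inv w v)) = v - \<alpha> i (inv w v) *\<^sub>R w (h i)"
    using Wv_linear[OF assms] by (simp add: srefl_def linear_diff linear_cmul Wv_inv_cancel[OF assms])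
  then show ?thesis by (simp add: algebra_simps)
qed

abbreviation Wa_gens :: "('v \<Rightarrow> 'v) set" where
  "Wa_gens \<equiv> {(\<lambda>v. v - (\<beta> v + k) *\<^sub>R b) | \<beta> b k. (\<beta>, b) \<in> root_pairs D \<and> k \<in> Lam D \<beta>}"

lemma Wa_gen_affine:
  assumes "r \<in> Wa_gens"
  obtains L c where "L \<in> Wv D" "r = (\<lambda>v. L v + c)" "r \<circ> r = id"
proof -
  obtain \<beta> b k where r: "r = (\<lambda>v. v - (\<beta> v + k) *\<^sub>R b)" "(\<beta>, b) \<in> root_pairs D" using assms by blast
  obtain w i where w: "w \<in> Wv D" "\<beta> = \<alpha> i \<circ> inv w" "b = w (h i)" using r(2) by (rule root_pairsE)
  have lin: "linear \<beta>" unfolding w(2) by (rule linear_compose[OF Wv_linear[OF Wv_inv[OF w(1)]] linear_root])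
  have "\<beta> b = 2" by (simp add: w Wv_inv_cancel root_coroot)
  then have "(r \<circ> r) v = id v" for v
    unfolding r(1) o_apply id_apply by (simp add: linear_diff[OF lin] linear_add[OF lin] linear_cmul[OF lin] algebra_simps)
  moreover have "r = (\<lambda>v. (w \<circ> (s i \<circ> inv w)) v + (- k) *\<^sub>R w (h i))"
    unfolding r(1) w(2,3) o_apply[of "\<alpha> i"] root_pair_reflection[OF w(1)] ..
  moreover have "w \<circ> (s i \<circ> inv w) \<in> Wv D" by (intro Wv_comp Wv_srefl Wv_inv w)
  ultimately show ?thesis using that[OF _ _ ext] by blast
qed

lemma Wa_gen_bij: "r \<in> Wa_gens \<Longrightarrow> bij r"
  by (erule Wa_gen_affine) (rule o_bij)

lemma Wa_affine:
  assumes "u \<in> Wa D"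
  obtains L c where "L \<in> Wv D" "u = (\<lambda>v. L v + c)"
proof -
  have "\<exists>L\<in>Wv D. \<exists>c. u = (\<lambda>v. L v + c)"
    using assms unfolding Wa_def
  proof induction
    case gen_id
    show ?case by (rule bexI[OF _ Wv_id], rule exI[of _ 0]) auto
  next
    case (gen_step r u)
    obtain L c where L: "L \<in> Wv D" "u = (\<lambda>v. L v + c)" using gen_step by blast
    obtain L' c' where L': "L' \<in> Wv D" "r = (\<lambda>v. L' v + c')" using Wa_gen_affine[OF gen_step(1)] .
    have "r \<circ> u = (\<lambda>v. (L' \<circ> L) v + (L' c + c'))"
      unfolding L L' by (auto simp: linear_add[OF Wv_linear[OF L'(1)]] algebra_simps)
    then show ?case using Wv_comp[OF L'(1) L(1)] by blast
  next
    case (gen_inv r u)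
    obtain L c where L: "L \<in> Wv D" "u = (\<lambda>v. L v + c)" using gen_inv by blast
    obtain L' c' where L': "L' \<in> Wv D" "r = (\<lambda>v. L' v + c')" "r \<circ> r = id" using Wa_gen_affine[OF gen_inv(1)] .
    have "inv r \<circ> u = (\<lambda>v. (L' \<circ> L) v + (L' c + c'))"
      unfolding inv_unique_comp[OF L'(3) L'(3)] unfolding L L' by (auto simp: linear_add[OF Wv_linear[OF L'(1)]] algebra_simps)
    then show ?case using Wv_comp[OF L'(1) L(1)] by blast
  qed
  then show ?thesis using that by blast
qed

lemma Wa_comp: "u \<in> Wa D \<Longrightarrow> v \<in> Wa D \<Longrightarrow> u \<circ> v \<in> Wa D"
  unfolding Wa_def by (rule generated_comp)

lemma Wa_bij: "u \<in> Wa D \<Longrightarrow> bij u"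
  unfolding Wa_def by (erule generated_bij[rotated]) (rule Wa_gen_bij)

lemma Wa_inv: "u \<in> Wa D \<Longrightarrow> inv u \<in> Wa D"
  unfolding Wa_def by (erule generated_inv[rotated]) (rule Wa_gen_bij)

lemma Wa_inv_cancel:
  assumes "u \<in> Wa D"
  shows "u (inv u v) = v" "inv u (u v) = v"
  using Wa_bij[OF assms] by (simp_all add: bij_is_surj surj_f_inv_f bij_is_inj inv_f_f)

lemma Wa_id: "id \<in> Wa D"
  unfolding Wa_def by (rule generated.gen_id)

lemma srefl_Wa: "s i \<in> Wa D"
proof -
  have "(\<alpha> i \<circ> inv id, id (h i)) \<in> root_pairs D" unfolding root_pairs_def using Wv_id by blast
  then have rp: "(\<alpha> i, h i) \<in> root_pairs D" by simp
  then have "\<alpha> i \<in> real_roots D" unfolding real_roots_def by force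
  then have "0 \<in> Lam D (\<alpha> i)" using Lam_root by blast
  then have "(\<lambda>v. v - (\<alpha> i v + 0) *\<^sub>R h i) \<in> Wa_gens" using rp by blast
  moreover have "s i = (\<lambda>v. v - (\<alpha> i v + 0) *\<^sub>R h i)" by (auto simp: srefl_def)
  ultimately show ?thesis unfolding Wa_def by (metis (no_types, lifting) generated_base)
qed

lemma Wv_Wa: "w \<in> Wv D \<Longrightarrow> w \<in> Wa D"
proof -
  have "word_prod xs \<in> Wa D" for xs
    by (induction xs) (simp_all only: word_prod_Nil word_prod_Cons Wa_id Wa_comp srefl_Wa)
  then show "w \<in> Wv D \<Longrightarrow> w \<in> Wa D" unfolding Wv_eq_words by auto
qed

text \<open>
  Together with \<open>Wa_eq_of_open\<close>: an element of \<open>W\<^sup>a\<close> is determined by its values near one point. This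
  makes isomorphisms of apartments that agree locally agree everywhere.
\<close>

lemma affine_eq_id_on_open:
  fixes L :: "'v \<Rightarrow> 'v"
  assumes L: "linear L" and S: "open S" "x \<in> S" and fixed: "\<And>v. v \<in> S \<Longrightarrow> L v + c = v"
  shows "(\<lambda>v. L v + c) = id"
proof -
  obtain e where e: "e > 0" "\<And>y. dist y x < e \<Longrightarrow> y \<in> S" using S unfolding open_dist by blast
  have "L v = v" for v
  proof -
    define t where "t = e / (norm v + 1)"
    have n: "norm v + 1 > 0" by (smt (verit) norm_ge_zero)
    have t: "t > 0" using e n by (simp add: t_def)
    have "dist (x + t *\<^sub>R v) x < e" using e n by (simp add: dist_norm t_def field_simps)
    then have "L (x + t *\<^sub>R v) + c = x + t *\<^sub>R v" "L x + c = x" using fixed e S by auto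
    then have "(L (x + t *\<^sub>R v) + c) - (L x + c) = t *\<^sub>R v" by simp
    then have "t *\<^sub>R L v = t *\<^sub>R v" by (simp add: linear_add[OF L] linear_cmul[OF L])
    then show ?thesis using t by simp
  qed
  moreover from this have "c = 0" using fixed[OF S(2)] by simp
  ultimately show ?thesis by auto
qed

lemma Wa_eq_of_open:
  assumes u: "u \<in> Wa D" "u' \<in> Wa D" and S: "open S" "x \<in> S" and eq: "\<And>v. v \<in> S \<Longrightarrow> u v = u' v"
  shows "u = u'"
proof -
  have "inv u' \<circ> u \<in> Wa D" by (intro Wa_comp Wa_inv u)
  then obtain L c where L: "L \<in> Wv D" "inv u' \<circ> u = (\<lambda>v. L v + c)" by (rule Wa_affine)
  have "(inv u' \<circ> u) v = v" if "v \<in> S" for v using eq[OF that] by (simp add: Wa_inv_cancel u)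
  then have "inv u' \<circ> u = id"
    unfolding L(2) by (intro affine_eq_id_on_open[OF Wv_linear[OF L(1)] S]) auto
  then have "u' \<circ> (inv u' \<circ> u) = u'" by simp
  then show ?thesis by (simp add: fun_eq_iff Wa_inv_cancel u)
qed

end

section \<open>Enclosures\<close>

text \<open>
  The filter \<open>F + F\<^sup>v\<close> whose enclosure is the chimney \<open>\<rr>(F, F\<^sup>v)\<close>, with \<open>F\<close> the local face at \<open>x\<close> in the
  direction \<open>F1\<close>.
\<close>

definition face_plus_cone :: "'v::real_normed_vector \<Rightarrow> 'v set \<Rightarrow> 'v set \<Rightarrow> 'v filter" where
  "face_plus_cone x F1 Fv = filtermap (\<lambda>(u, v). u + v) (prod_filter (local_face x F1) (principal Fv))"

lemma chimney_eq: "chimney D x F1 Fv = encl D (face_plus_cone x F1 Fv)"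
  by (simp add: chimney_def face_plus_cone_def)

lemma face_plus_cone_le_iff:
  "face_plus_cone x F1 Fv \<le> principal S \<longleftrightarrow> (\<forall>\<^sub>F u in local_face x F1. \<forall>v\<in>Fv. u + v \<in> S)"
  (is "?l \<longleftrightarrow> ?r")
proof
  assume ?l
  then obtain P Q where P: "eventually P (local_face x F1)" "\<forall>v\<in>Fv. Q v" "\<And>u v. P u \<Longrightarrow> Q v \<Longrightarrow> u + v \<in> S"
    unfolding face_plus_cone_def filter_le_principal_iff eventually_filtermap eventually_prod_filter
      eventually_principal case_prod_conv by blast
  then show ?r by (auto elim: eventually_mono)
next
  assume ?r
  then show ?l
    unfolding face_plus_cone_def filter_le_principal_iff eventually_filtermap eventually_prod_filter
      eventually_principal case_prod_conv
    by (intro exI[of _ "\<lambda>u. \<forall>v\<in>Fv. u + v \<in> S"] exI[of _ "\<lambda>v. v \<in> Fv"]) blast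
qed

lemma le_encl: "F \<le> encl D F"
  unfolding encl_def by (rule INF_greatest) simp

lemma encl_le_iff:
  assumes "enclosed D E"
  shows "encl D F \<le> principal E \<longleftrightarrow> F \<le> principal E"
  using order_trans[OF le_encl] assms unfolding encl_def by (auto intro: INF_lower)

lemma encl_eqI:
  assumes "\<And>E. enclosed D E \<Longrightarrow> F \<le> principal E \<longleftrightarrow> F' \<le> principal E"
  shows "encl D F = encl D F'"
  unfolding filter_eq_iff eventually_encl using assms by blast

context apartment_model
begin

text \<open>
  If all simple roots vanish at \<open>z\<close>, then bracketing with \<open>z\<close> is a derivation that kills all
  generators of the Kac--Moody algebra, hence the whole algebra, so its eigenvalue \<open>\<gamma> z\<close> is zero.
\<close>

lemma imaginary_root_linear_null:
  assumes "\<gamma> \<in> imaginary_roots D"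
  shows "linear \<gamma>" and "(\<And>i. \<alpha> i z = 0) \<Longrightarrow> \<gamma> z = 0"
proof -
  obtain x where x: "x \<noteq> 0" "\<And>v. lie D (cartan D v) x = \<gamma> v *\<^sub>R x"
    using assms unfolding imaginary_roots_def kac_moody_roots_def by blast
  note K = Lie_algebra[unfolded kac_moody_algebra_def]
  have bil: "bilinear (lie D)" using K by simp
  have alt: "lie D y y = 0" for y using K by simp
  have jac: "lie D a (lie D b c) + lie D b (lie D c a) + lie D c (lie D a b) = 0" for a b c using K by simp
  have car: "linear (cartan D)" using K by simp
  have cc: "lie D (cartan D u) (cartan D v) = 0" for u v using K by simp
  have ce: "lie D (cartan D v) (gen_e D i) = \<alpha> i v *\<^sub>R gen_e D i" for v i using K by simp
  have cf: "lie D (cartan D v) (gen_f D i) = - (\<alpha> i v *\<^sub>R gen_f D i)" for v i using K by simp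
  have gen: "subspace U \<Longrightarrow> range (cartan D) \<union> range (gen_e D) \<union> range (gen_f D) \<subseteq> U \<Longrightarrow>
      (\<forall>x\<in>U. \<forall>y\<in>U. lie D x y \<in> U) \<Longrightarrow> U = UNIV" for U
    using K[THEN conjunct2, THEN conjunct2, THEN conjunct2, THEN conjunct2, THEN conjunct2, THEN conjunct2,
      THEN conjunct2, THEN conjunct2, THEN conjunct2, THEN conjunct1] by blast
  show "linear \<gamma>"
  proof (rule linearI)
    fix u v
    have "\<gamma> (u + v) *\<^sub>R x = (\<gamma> u + \<gamma> v) *\<^sub>R x"
      unfolding x(2)[symmetric] scaleR_add_left by (simp add: linear_add[OF car] bilinear_ladd[OF bil])
    then show "\<gamma> (u + v) = \<gamma> u + \<gamma> v" using x(1) by simp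
  next
    fix c v
    have "\<gamma> (c *\<^sub>R v) *\<^sub>R x = (c * \<gamma> v) *\<^sub>R x"
      unfolding x(2)[symmetric] scaleR_scaleR[symmetric] by (simp add: linear_cmul[OF car] bilinear_lmul[OF bil])
    then show "\<gamma> (c *\<^sub>R v) = c *\<^sub>R \<gamma> v" using x(1) by simp
  qed
  assume z: "\<And>i. \<alpha> i z = 0"
  define a where "a = cartan D z"
  define U where "U = {y. lie D a y = 0}"
  have anti: "lie D y w = - lie D w y" for y w
    using alt[of "y + w", unfolded bilinear_ladd[OF bil] bilinear_radd[OF bil]]
    by (simp add: alt eq_neg_iff_add_eq_0 add.commute)
  have "U = UNIV"
  proof (rule gen)
    show "subspace U"
      unfolding subspace_def U_def by (simp add: bilinear_rzero[OF bil] bilinear_radd[OF bil] bilinear_rmul[OF bil])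
    show "range (cartan D) \<union> range (gen_e D) \<union> range (gen_f D) \<subseteq> U"
      by (auto simp: U_def a_def cc ce cf z)
    show "\<forall>x\<in>U. \<forall>y\<in>U. lie D x y \<in> U"
    proof (intro ballI)
      fix y w assume "y \<in> U" "w \<in> U"
      then have "lie D a y = 0" "lie D w a = 0" using anti[of w a] by (simp_all add: U_def)
      then show "lie D y w \<in> U"
        using jac[of a y w] by (simp add: U_def bilinear_rzero[OF bil])
    qed
  qed
  then have "lie D a x = 0" by (auto simp: U_def)
  then show "\<gamma> z = 0" using x by (simp add: a_def)
qed

lemma Wv_fixes_root_kernel:
  assumes "w \<in> Wv D" "\<And>i. \<alpha> i z = 0"
  shows "w z = z"
proof -
  have "s i z = z" for i by (simp add: srefl_def assms(2))
  then have "word_prod xs z = z" for xs by (induction xs) simp_all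
  then show ?thesis using assms(1) unfolding Wv_eq_words by auto
qed

lemma root_linear_null:
  assumes "\<beta> \<in> real_roots D \<union> imaginary_roots D"
  shows "linear \<beta>" and "(\<And>i. \<alpha> i z = 0) \<Longrightarrow> \<beta> z = 0"
proof -
  have "linear \<beta> \<and> ((\<forall>i. \<alpha> i z = 0) \<longrightarrow> \<beta> z = 0)"
  proof (cases "\<beta> \<in> real_roots D")
    case True
    then obtain w i where w: "w \<in> Wv D" "\<beta> = \<alpha> i \<circ> inv w"
      unfolding real_roots_def root_pairs_def by force
    then show ?thesis
      using linear_compose[OF Wv_linear[OF Wv_inv[OF w(1)]] linear_root] Wv_fixes_root_kernel[OF Wv_inv[OF w(1)]] by auto
  qed (use assms imaginary_root_linear_null in auto)
  then show "linear \<beta>" and "(\<And>i. \<alpha> i z = 0) \<Longrightarrow> \<beta> z = 0" by auto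
qed

text \<open>
  The two properties of the half-spaces that the geometry uses: they are given by linear forms, and
  these forms vanish wherever all simple roots do.
\<close>

lemma enclosed_halfspaces:
  assumes "enclosed D E"
  shows "\<exists>B :: (('v \<Rightarrow> real) \<times> real) set.
     (\<forall>\<beta> k. (\<beta>, k) \<in> B \<longrightarrow> linear \<beta> \<and> (\<forall>z. (\<forall>i. \<alpha> i z = 0) \<longrightarrow> \<beta> z = 0)) \<and>
     (\<forall>v. v \<in> E \<longleftrightarrow> (\<forall>\<beta> k. (\<beta>, k) \<in> B \<longrightarrow> \<beta> v + k \<ge> 0))"
proof -
  obtain \<kappa> where "E = {v. \<forall>\<beta>\<in>real_roots D \<union> imaginary_roots D. \<forall>k. \<kappa> \<beta> = Some k \<longrightarrow> \<beta> v + k \<ge> 0}"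
    using assms unfolding enclosed_def by blast
  then show ?thesis
    using root_linear_null
    by (intro exI[of _ "{(\<beta>, k). \<beta> \<in> real_roots D \<union> imaginary_roots D \<and> \<kappa> \<beta> = Some k}"]) auto
qed

lemma enclosed_closed:
  assumes "enclosed D E"
  shows "closed E"
proof -
  obtain B :: "(('v \<Rightarrow> real) \<times> real) set" where B': "\<forall>\<beta> k. (\<beta>, k) \<in> B \<longrightarrow> linear \<beta> \<and> (\<forall>z. (\<forall>i. \<alpha> i z = 0) \<longrightarrow> \<beta> z = 0)"
    and B2: "\<forall>v. v \<in> E \<longleftrightarrow> (\<forall>\<beta> k. (\<beta>, k) \<in> B \<longrightarrow> \<beta> v + k \<ge> 0)"
    using enclosed_halfspaces[OF assms] by blast
  have B: "\<And>\<beta> k. (\<beta>, k) \<in> B \<Longrightarrow> linear \<beta>" "\<And>v. v \<in> E \<longleftrightarrow> (\<forall>\<beta> k. (\<beta>, k) \<in> B \<longrightarrow> \<beta> v + k \<ge> 0)"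
    "\<And>\<beta> k z. (\<beta>, k) \<in> B \<Longrightarrow> (\<And>i. \<alpha> i z = 0) \<Longrightarrow> \<beta> z = 0"
    using B' B2 by blast+
  have "closed {v. 0 \<le> \<beta> v + k}" if "(\<beta>, k) \<in> B" for \<beta> k
    using linear_continuous_on[of \<beta> UNIV] B(1)[OF that] unfolding linear_conv_bounded_linear
    by (intro closed_Collect_le continuous_on_const continuous_on_add) auto
  then have "closed (\<Inter>(\<beta>, k)\<in>B. {v. 0 \<le> \<beta> v + k})" by (intro closed_INT) auto
  moreover have "E = (\<Inter>(\<beta>, k)\<in>B. {v. 0 \<le> \<beta> v + k})" using B(2) by auto
  ultimately show ?thesis by simp
qed

text \<open>
  A half-space that contains one sector with direction \<open>X\<close> has a linear form that is nonnegative on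
  \<open>X\<close>, so with a point \<open>y\<close> it contains the sector based at \<open>y\<close>.
\<close>

lemma enclosed_recession:
  assumes E: "enclosed D E" and X: "X \<in> chambers" and sub: "sector \<zeta> X \<subseteq> E" and y: "y \<in> E"
  shows "sector y X \<subseteq> E"
proof
  fix v assume "v \<in> sector y X"
  then have v: "v - y \<in> X" by (simp add: mem_sector)
  obtain B :: "(('v \<Rightarrow> real) \<times> real) set" where B': "\<forall>\<beta> k. (\<beta>, k) \<in> B \<longrightarrow> linear \<beta> \<and> (\<forall>z. (\<forall>i. \<alpha> i z = 0) \<longrightarrow> \<beta> z = 0)"
    and B2: "\<forall>v. v \<in> E \<longleftrightarrow> (\<forall>\<beta> k. (\<beta>, k) \<in> B \<longrightarrow> \<beta> v + k \<ge> 0)"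
    using enclosed_halfspaces[OF E] by blast
  have B: "\<And>\<beta> k. (\<beta>, k) \<in> B \<Longrightarrow> linear \<beta>" "\<And>v. v \<in> E \<longleftrightarrow> (\<forall>\<beta> k. (\<beta>, k) \<in> B \<longrightarrow> \<beta> v + k \<ge> 0)"
    "\<And>\<beta> k z. (\<beta>, k) \<in> B \<Longrightarrow> (\<And>i. \<alpha> i z = 0) \<Longrightarrow> \<beta> z = 0"
    using B' B2 by blast+
  show "v \<in> E"
    unfolding B(2)
  proof (intro allI impI)
    fix \<beta> k assume bk: "(\<beta>, k) \<in> B"
    note lin = B(1)[OF bk]
    have "\<beta> (v - y) \<ge> 0"
    proof (rule ccontr)
      assume neg: "\<not> ?thesis"
      \<comment> \<open>far enough along the ray from zeta to leave the half-space\<close>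
      define t where "t = (\<bar>\<beta> \<zeta> + k\<bar> + 1) / (- \<beta> (v - y))"
      have "t > 0" unfolding t_def using neg by (intro divide_pos_pos) auto
      then have "\<zeta> + t *\<^sub>R (v - y) \<in> E"
        using sub chambers_scale[OF X v] by (auto simp: sector_def)
      then have "\<beta> (\<zeta> + t *\<^sub>R (v - y)) + k \<ge> 0" using bk B(2) by blast
      then have "\<beta> \<zeta> + t * \<beta> (v - y) + k \<ge> 0" by (simp add: linear_add[OF lin] linear_cmul[OF lin])
      moreover have "t * \<beta> (v - y) = - (\<bar>\<beta> \<zeta> + k\<bar> + 1)" using neg by (simp add: t_def)
      ultimately show False by linarith
    qed
    moreover have "\<beta> y + k \<ge> 0" using B(2) bk y by blast
    ultimately show "\<beta> v + k \<ge> 0" by (simp add: linear_diff[OF lin])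
  qed
qed

text \<open>
  The smallest vectorial face. As a direction it changes no enclosure, which makes a point a closed
  face and a closed chamber a chimney.
\<close>

definition root_kernel :: "'v set" where
  "root_kernel = std_face D UNIV"

lemma mem_root_kernel: "z \<in> root_kernel \<longleftrightarrow> (\<forall>i. \<alpha> i z = 0)"
  by (simp add: root_kernel_def std_face_def)

lemma zero_root_kernel: "0 \<in> root_kernel"
  by (simp add: mem_root_kernel root_simps)

lemma root_kernel_face: "root_kernel \<in> signed_faces D UNIV"
proof -
  have "root_kernel = (\<lambda>v. 1 *\<^sub>R id v) ` std_face D UNIV" by (simp add: root_kernel_def)
  then show ?thesis unfolding signed_faces_def vec_faces_def using Wv_id by blast
qed

lemma enclosed_add_root_kernel:
  assumes E: "enclosed D E" and "y \<in> E" "z \<in> root_kernel"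
  shows "y + z \<in> E"
proof -
  obtain B :: "(('v \<Rightarrow> real) \<times> real) set" where B': "\<forall>\<beta> k. (\<beta>, k) \<in> B \<longrightarrow> linear \<beta> \<and> (\<forall>z. (\<forall>i. \<alpha> i z = 0) \<longrightarrow> \<beta> z = 0)"
    and B2: "\<forall>v. v \<in> E \<longleftrightarrow> (\<forall>\<beta> k. (\<beta>, k) \<in> B \<longrightarrow> \<beta> v + k \<ge> 0)"
    using enclosed_halfspaces[OF E] by blast
  have B: "\<And>\<beta> k. (\<beta>, k) \<in> B \<Longrightarrow> linear \<beta>" "\<And>v. v \<in> E \<longleftrightarrow> (\<forall>\<beta> k. (\<beta>, k) \<in> B \<longrightarrow> \<beta> v + k \<ge> 0)"
    "\<And>\<beta> k z. (\<beta>, k) \<in> B \<Longrightarrow> (\<And>i. \<alpha> i z = 0) \<Longrightarrow> \<beta> z = 0"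
    using B' B2 by blast+
  have "\<beta> (y + z) = \<beta> y" if "(\<beta>, k) \<in> B" for \<beta> k
    using B(3)[OF that] assms(3) by (simp add: linear_add[OF B(1)[OF that]] mem_root_kernel)
  then show ?thesis using assms(2) unfolding B(2) by metis
qed

lemma local_face_root_kernel_le_iff:
  assumes E: "enclosed D E"
  shows "local_face y root_kernel \<le> principal E \<longleftrightarrow> y \<in> E"
proof
  assume "local_face y root_kernel \<le> principal E"
  then obtain e where "e > 0" "\<And>v. dist v y < e \<Longrightarrow> v - y \<in> root_kernel \<Longrightarrow> v \<in> E"
    unfolding filter_le_principal_iff eventually_local_face by blast
  then show "y \<in> E" by (simp add: zero_root_kernel)
next
  assume "y \<in> E"
  then have "v \<in> E" if "v - y \<in> root_kernel" for v using enclosed_add_root_kernel[OF E, of y "v - y"] that by simp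
  then show "local_face y root_kernel \<le> principal E"
    unfolding filter_le_principal_iff eventually_local_face by (intro exI[of _ 1]) auto
qed

lemma encl_local_root_kernel: "encl D (local_face y root_kernel) = encl D (principal {y})"
  by (rule encl_eqI) (simp add: local_face_root_kernel_le_iff)

text \<open>
  Through this lemma (MA4) applies to a sector germ and a point.
\<close>

lemma closed_point_face: "encl D (principal {y}) \<in> closed_faces D"
  unfolding closed_faces_def
  by (intro CollectI exI conjI) (rule encl_local_root_kernel[symmetric], rule root_kernel_face)

section \<open>Chimneys and sector germs\<close>

lemma vec_faces_mono: "\<J> \<subseteq> \<J>' \<Longrightarrow> vec_faces D \<sigma> \<J> \<subseteq> vec_faces D \<sigma> \<J>'"
  unfolding vec_faces_def by blast

lemma signed_faces_mono: "\<J> \<subseteq> \<J>' \<Longrightarrow> signed_faces D \<J> \<subseteq> signed_faces D \<J>'"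
  unfolding signed_faces_def using vec_faces_mono by blast

lemma empty_spherical: "{} \<in> spherical_types D"
proof -
  have "w = id" if "w \<in> generated {}" for w :: "'v \<Rightarrow> 'v"
    using that by induction auto
  then have "Wv_par D {} \<subseteq> {id}" unfolding Wv_par_def by auto
  then show ?thesis unfolding spherical_types_def using finite_subset by blast
qed

lemma chambers_faces: "X \<in> chambers \<Longrightarrow> X \<in> signed_faces D UNIV"
  and chambers_spherical: "X \<in> chambers \<Longrightarrow> X \<in> signed_faces D (spherical_types D)"
  unfolding chambers_def using signed_faces_mono empty_spherical by blast+

text \<open>
  The germ of \<open>X\<close> at \<open>x\<close> contains arbitrarily small vectors, and enclosed sets are closed.
\<close>

lemma chamber_cone_le_iff:
  assumes E: "enclosed D E" and X: "X \<in> chambers"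
  shows "face_plus_cone x X X \<le> principal E \<longleftrightarrow> sector x X \<subseteq> E"
proof
  assume "face_plus_cone x X X \<le> principal E"
  then obtain e where e: "e > 0" "\<And>u v. dist u x < e \<Longrightarrow> u - x \<in> X \<Longrightarrow> v \<in> X \<Longrightarrow> u + v \<in> E"
    unfolding face_plus_cone_le_iff eventually_local_face by blast
  show "sector x X \<subseteq> E"
  proof
    fix p assume "p \<in> sector x X"
    then have p: "p - x \<in> X" by (simp add: mem_sector)
    have "p \<in> closure E"
      unfolding closure_approachable
    proof (intro allI impI)
      fix d :: real assume "d > 0"
      then obtain c where c: "c \<in> X" "norm c < min d e" using chambers_small[OF X, of "min d e"] e(1) by auto
      then have "(x + c) + (p - x) \<in> E" using p by (intro e) (auto simp: dist_norm)
      then show "\<exists>y\<in>E. dist y p < d" using c by (intro bexI[of _ "(x + c) + (p - x)"]) (auto simp: dist_norm)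
    qed
    then show "p \<in> E" using enclosed_closed[OF E] by simp
  qed
next
  assume sub: "sector x X \<subseteq> E"
  have "u + v \<in> E" if "u - x \<in> X" "v \<in> X" for u v
    using sub chambers_add[OF X that] by (auto simp: mem_sector algebra_simps)
  then show "face_plus_cone x X X \<le> principal E"
    unfolding face_plus_cone_le_iff eventually_local_face by (intro exI[of _ 1]) auto
qed

text \<open>
  The germ depends only on the direction, so the base point 0 stands for any point. With \<open>X\<close> itself
  as the local face, the filter under the enclosure is the sector (\<open>chamber_cone_le_iff\<close>).
\<close>

definition sector_germ :: "'v set \<Rightarrow> 'v filter" where
  "sector_germ X = chimney_germ D 0 X X"

lemma eventually_chamber_chimney:
  assumes "X \<in> chambers"
  shows "eventually P (chimney D x X X) \<longleftrightarrow> (\<exists>E. enclosed D E \<and> sector x X \<subseteq> E \<and> (\<forall>v\<in>E. P v))"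
  unfolding chimney_eq eventually_encl using chamber_cone_le_iff[OF _ assms] by blast

lemma eventually_sector_germ:
  assumes X: "X \<in> chambers"
  shows "eventually P (sector_germ X) \<longleftrightarrow> (\<exists>\<xi>\<in>X. \<exists>E. enclosed D E \<and> sector \<xi> X \<subseteq> E \<and> (\<forall>v\<in>E. P v))"
proof -
  have "eventually P (sector_germ X) \<longleftrightarrow> (\<exists>\<xi>\<in>X. eventually P (chimney D (0 + \<xi>) X X))"
    unfolding sector_germ_def chimney_germ_def
  proof (rule eventually_INF_base)
    show "X \<noteq> {}" by (rule chambers_nonempty[OF X])
    have "chimney D (0 + (a + b)) X X \<le> chimney D (0 + a) X X" if "a \<in> X" "b \<in> X" for a b
    proof -
      have "sector (a + b) X \<subseteq> sector a X"
        using chambers_add[OF X that(2)] by (force simp: mem_sector algebra_simps sector_def)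
      then show ?thesis unfolding le_filter_def eventually_chamber_chimney[OF X] by (metis add_0 order_trans)
    qed
    note le = this
    show "\<exists>x\<in>X. chimney D (0 + x) X X \<le> inf (chimney D (0 + a) X X) (chimney D (0 + b) X X)"
      if "a \<in> X" "b \<in> X" for a b
      using le[OF that] le[OF that(2,1)] chambers_add[OF X that]
      by (intro bexI[of _ "a + b"]) (auto simp: add.commute)
  qed
  then show ?thesis unfolding eventually_chamber_chimney[OF X] by simp
qed

lemma sector_germ_splayed: "X \<in> chambers \<Longrightarrow> sector_germ X \<in> splayed_chimney_germs D"
  unfolding splayed_chimney_germs_def sector_germ_def using chambers_faces chambers_spherical by blast

text \<open>
  A filter whose members have nonempty interior has full support, and only the identity fixes all of
  V.
\<close>

lemma solidI:
  assumes "\<And>S. F \<le> principal S \<Longrightarrow> \<exists>U. open U \<and> U \<noteq> {} \<and> U \<subseteq> S"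
  shows "solid D F"
proof -
  have "E = UNIV" if aff: "affine E" and FE: "F \<le> principal E" for E
  proof -
    obtain U where U: "open U" "U \<noteq> {}" "U \<subseteq> E" using assms[OF FE] by blast
    then have "affine hull U = UNIV" by (intro affine_hull_open)
    moreover have "affine hull U \<subseteq> E" using U(3) aff by (rule hull_minimal)
    ultimately show ?thesis by blast
  qed
  then have supp: "support F = UNIV" unfolding support_def by (intro equalityI subset_UNIV Inter_greatest) blast
  have "w = id" if "\<forall>u\<in>support F. \<forall>v\<in>support F. w (v - u) = v - u" for w
  proof
    show "w v = id v" for v using that[rule_format, of 0 v] supp by simp
  qed
  then have "{w \<in> Wv D. \<forall>u\<in>support F. \<forall>v\<in>support F. w (v - u) = v - u} \<subseteq> {id}" by blast
  then show ?thesis unfolding solid_def by (rule finite_subset) simp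
qed

lemma sector_germ_solid: "X \<in> chambers \<Longrightarrow> sector_germ X \<in> solid_chimney_germs D"
proof -
  assume X: "X \<in> chambers"
  have "solid D (chimney D 0 X X)"
  proof (rule solidI)
    fix S assume "chimney D 0 X X \<le> principal S"
    then have "sector 0 X \<subseteq> S"
      unfolding filter_le_principal_iff eventually_chamber_chimney[OF X] by blast
    then show "\<exists>U. open U \<and> U \<noteq> {} \<and> U \<subseteq> S"
      using chambers_open[OF X] chambers_nonempty[OF X] by (intro exI[of _ X]) (auto simp: sector_def)
  qed
  then show ?thesis
    unfolding solid_chimney_germs_def sector_germ_def using chambers_faces[OF X] by blast
qed

lemma local_chamber_open:
  assumes X: "X \<in> chambers" and le: "local_face x X \<le> principal S"
  shows "\<exists>U. open U \<and> U \<noteq> {} \<and> U \<subseteq> S"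
proof -
  obtain e where e: "e > 0" "\<And>u. dist u x < e \<Longrightarrow> u - x \<in> X \<Longrightarrow> u \<in> S"
    using le unfolding filter_le_principal_iff eventually_local_face by blast
  obtain c where c: "c \<in> X" "norm c < e" using chambers_small[OF X e(1)] .
  have "open (ball x e \<inter> (+) x ` X)" using open_translation[OF chambers_open[OF X]] by auto
  moreover have "x + c \<in> ball x e \<inter> (+) x ` X" using c by (auto simp: dist_norm)
  moreover have "ball x e \<inter> (+) x ` X \<subseteq> S" using e(2) by (auto simp: dist_commute)
  ultimately show ?thesis by blast
qed

lemma closed_chamber_chimney: "chimney D x X root_kernel = encl D (local_face x X)"
  unfolding chimney_eq
proof (rule encl_eqI)
  fix E assume E: "enclosed D E"
  show "face_plus_cone x X root_kernel \<le> principal E \<longleftrightarrow> local_face x X \<le> principal E"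
    unfolding face_plus_cone_le_iff unfolding filter_le_principal_iff
  proof (rule eventually_cong[OF always_eventually], rule allI)
    show "(\<forall>v\<in>root_kernel. u + v \<in> E) \<longleftrightarrow> u \<in> E" for u
      using enclosed_add_root_kernel[OF E] zero_root_kernel by force
  qed
qed

text \<open>
  Closed chambers do not occur in (MA2) by name. They do as solid chimneys, with \<open>root_kernel\<close> as
  direction.
\<close>

lemma closed_chamber_solid:
  assumes X: "X \<in> chambers"
  shows "encl D (local_face x X) \<in> solid_chimneys D"
proof -
  have "solid D (chimney D x X root_kernel)"
    unfolding closed_chamber_chimney
    by (rule solidI, rule local_chamber_open[OF X]) (erule order_trans[OF le_encl])
  then show ?thesis
    unfolding solid_chimneys_def closed_chamber_chimney[symmetric] using chambers_faces[OF X] root_kernel_face by blast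
qed

lemma closed_chamber_face:
  "X \<in> chambers \<Longrightarrow> encl D (local_face x X) \<in> closed_faces D"
  unfolding closed_faces_def using chambers_faces by blast

section \<open>Local chambers that cover a panel\<close>

lemma filter_closure_le:
  "F \<le> principal S \<Longrightarrow> filter_closure F \<le> principal (closure S)"
  unfolding filter_closure_def by (rule INF_lower) simp

lemma filter_closure_le_enclosed:
  "enclosed D E \<Longrightarrow> F \<le> principal E \<Longrightarrow> filter_closure F \<le> principal E"
  using filter_closure_le[of F E] enclosed_closed[of E] by simp

lemma filter_closure_le_encl: "filter_closure F \<le> encl D F"
  unfolding encl_def by (rule INF_greatest) (auto intro: filter_closure_le_enclosed)

lemma Wa_affine_diff:
  assumes "L \<in> Wv D" "u = (\<lambda>v. L v + c)"
  shows "u v - u x = L (v - x)"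
  using assms by (simp add: linear_diff[OF Wv_linear])

lemma affine_continuous: "linear L \<Longrightarrow> continuous_on A (\<lambda>v. L v + c)"
  for L :: "'v \<Rightarrow> 'v"
  unfolding linear_conv_bounded_linear by (intro continuous_intros linear_continuous_on)

lemma Wa_local_face:
  assumes L: "L \<in> Wv D" "u = (\<lambda>v. L v + c)"
  shows "filtermap u (local_face x X) = local_face (u x) (L ` X)"
proof -
  have lin: "linear L" and bij: "bij L" using L Wv_linear Wv_bij by auto
  have cont: "continuous_on UNIV u" unfolding L(2) using affine_continuous[OF lin] .
  have "open (u ` S)" if "open S" for S
  proof -
    have "u ` S = (+) c ` L ` S" unfolding L(2) image_image by (simp add: add.commute)
    then show ?thesis using open_surjective_linear_image[OF that lin bij_is_surj[OF bij]] open_translation by metis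
  qed
  then have nh: "filtermap u (nhds x) = nhds (u x)"
    using cont by (intro filtermap_nhds_open_map) (auto simp: continuous_on_eq_continuous_at)
  have mem: "u v - u x \<in> L ` X \<longleftrightarrow> v - x \<in> X" for v
    unfolding Wa_affine_diff[OF L] using bij_is_inj[OF bij] by (rule inj_image_mem_iff)
  show ?thesis
    unfolding filter_eq_iff eventually_filtermap local_face_def germ_def eventually_inf_principal
      nh[symmetric] sector_def[symmetric] mem_sector mem by simp
qed

text \<open>
  A local panel need not contain its base point, so it is not obvious that a local chamber which
  covers it has the same base point. It has, because the panel accumulates at one point and the
  closed local chamber at the other. The inclusion of directions then follows from homogeneity.
\<close>

lemma panel_covered_by_chamber:
  assumes X: "X \<in> chambers" and L: "L \<in> Wv D" "u = (\<lambda>v. L v + c)" and bij: "bij u"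
    and le: "local_face 0 (panel i) \<le> filtermap u (filter_closure (local_face x X))"
  shows "u x = 0" and "panel i \<subseteq> closure (L ` X)"
proof -
  have lin: "linear L" using L Wv_linear by auto
  have cont: "continuous_on A u" for A unfolding L(2) using affine_continuous[OF lin] .
  have cover: "\<exists>e>0. \<forall>v\<in>panel i. norm v < e \<longrightarrow> v \<in> u ` closure S" if "local_face x X \<le> principal S" for S
  proof -
    have "local_face 0 (panel i) \<le> filtermap u (principal (closure S))"
      by (rule order_trans[OF le filtermap_mono[OF filter_closure_le[OF that]]])
    then have "local_face 0 (panel i) \<le> principal (u ` closure S)" by (simp add: filtermap_principal)
    then show ?thesis unfolding filter_le_principal_iff eventually_local_face by (auto simp: dist_norm)
  qed
  have "dist x (inv u 0) \<le> e" if e: "e > 0" for e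
  proof -
    have "local_face x X \<le> principal (cball x e)"
      unfolding filter_le_principal_iff eventually_local_face using e by (auto simp: dist_commute intro!: exI[of _ e])
    from cover[OF this] obtain d where d: "d > 0" "\<And>v. v \<in> panel i \<Longrightarrow> norm v < d \<Longrightarrow> v \<in> u ` cball x e"
      by (auto simp: closure_closed[OF closed_cball])
    have "0 \<in> closure (u ` cball x e)"
      unfolding closure_approachable
    proof (intro allI impI)
      fix r :: real assume "r > 0"
      then obtain v where "v \<in> panel i" "norm v < min d r" using panel_small[of "min d r" i] d(1) by auto
      then show "\<exists>y\<in>u ` cball x e. dist y 0 < r" using d(2) by (intro bexI[of _ v]) auto
    qed
    moreover have "closed (u ` cball x e)"
      by (intro compact_imp_closed compact_continuous_image cont compact_cball)
    ultimately have "0 \<in> u ` cball x e" by (simp only: closure_closed)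
    then obtain p where "p \<in> cball x e" "u p = 0" by (metis imageE)
    then show ?thesis using bij by (metis bij_is_inj inv_f_f mem_cball)
  qed
  then have "dist x (inv u 0) \<le> 0" by (rule field_le_epsilon) simp
  then have x: "x = inv u 0" by simp
  then show ux: "u x = 0" using bij by (simp add: bij_is_surj surj_f_inv_f)
  have "local_face x X \<le> principal ((+) x ` X)"
    unfolding local_face_def germ_def by simp
  from cover[OF this] obtain d where d: "d > 0" "\<And>v. v \<in> panel i \<Longrightarrow> norm v < d \<Longrightarrow> v \<in> u ` closure ((+) x ` X)"
    by blast
  have LX: "L ` X \<in> chambers" by (rule Wv_image_chamber[OF X L(1)])
  show "panel i \<subseteq> closure (L ` X)"
  proof
    fix v assume v: "v \<in> panel i"
    define t where "t = d / (norm v + 1)"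
    have n: "norm v + 1 > 0" by (smt (verit) norm_ge_zero)
    have t: "t > 0" "norm (t *\<^sub>R v) < d" using d(1) n by (simp_all add: t_def field_simps)
    then obtain q where q: "q \<in> closure X" "t *\<^sub>R v = u (x + q)"
      using d(2)[OF panel_scale[OF v t(1)]] by (auto simp: closure_translation)
    have "u (x + q) = L q" using Wa_affine_diff[OF L, of "x + q" x] ux by simp
    then have "t *\<^sub>R v \<in> closure (L ` X)" using q closure_linear_image_subset[OF lin, of X] by auto
    then have "(1 / t) *\<^sub>R t *\<^sub>R v \<in> (*\<^sub>R) (1 / t) ` closure (L ` X)" by blast
    then have "v \<in> closure ((*\<^sub>R) (1 / t) ` L ` X)" using t by (simp add: closure_scaleR)
    moreover have "(*\<^sub>R) (1 / t) ` L ` X \<subseteq> L ` X" using chambers_scale[OF LX] t by auto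
    ultimately show "v \<in> closure (L ` X)" using closure_mono by blast
  qed
qed

end

section \<open>Charts of apartments and the group\<close>

lemma filtermap_cong_eventually:
  assumes "eventually (\<lambda>x. f x = g x) F"
  shows "filtermap f F = filtermap g F"
proof (rule filter_eqI)
  fix P
  have "eventually (\<lambda>x. P (f x) \<longleftrightarrow> P (g x)) F" using assms by (auto elim: eventually_mono)
  then show "eventually P (filtermap f F) \<longleftrightarrow> eventually P (filtermap g F)"
    unfolding eventually_filtermap by (rule eventually_subst)
qed

lemma filtercomap_filtermap_inj:
  assumes "inj f"
  shows "filtercomap f (filtermap f F) = F"
proof (rule antisym[OF _ filtercomap_filtermap])
  show "filtercomap f (filtermap f F) \<le> F"
  proof (rule filter_leI)
    fix P assume "eventually P F"
    then have "eventually (\<lambda>y. P (inv f y)) (filtermap f F)"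
      unfolding eventually_filtermap inv_f_f[OF assms] .
    then show "eventually P (filtercomap f (filtermap f F))"
      unfolding eventually_filtercomap
      by (rule exI[of _ "\<lambda>y. P (inv f y)", OF conjI]) (simp add: inv_f_f[OF assms])
  qed
qed

lemma filtermap_le_range: "filtermap f F \<le> principal (range f)"
  by (simp add: filter_le_principal_iff eventually_filtermap)

context apartment_model
begin

text \<open>
  Stated by additivity instead of the formula \<open>u v = L v + c\<close>, so that composition of linear parts
  needs no computation.
\<close>

definition linear_part :: "('v \<Rightarrow> 'v) \<Rightarrow> ('v \<Rightarrow> 'v) \<Rightarrow> bool" where
  "linear_part u L \<longleftrightarrow> L \<in> Wv D \<and> (\<forall>x v. u (x + v) = u x + L v)"

lemma linear_part_exists:
  assumes "u \<in> Wa D"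
  obtains L where "linear_part u L"
proof -
  obtain L c where L: "L \<in> Wv D" "u = (\<lambda>v. L v + c)" using assms by (rule Wa_affine)
  then have "linear_part u L" by (simp add: linear_part_def linear_add[OF Wv_linear[OF L(1)]])
  then show ?thesis by (rule that)
qed

lemma linear_part_comp:
  "linear_part u L \<Longrightarrow> linear_part u' L' \<Longrightarrow> linear_part (u \<circ> u') (L \<circ> L')"
  by (simp add: linear_part_def Wv_comp)

lemma linear_part_srefl: "linear_part (s i) (s i)"
  by (simp add: linear_part_def linear_add[OF linear_srefl])

lemma linear_partD:
  assumes "linear_part u L"
  shows "L \<in> Wv D" "u (x + v) = u x + L v" "u = (\<lambda>v. L v + u 0)"
proof -
  show "L \<in> Wv D" "u (x + v) = u x + L v" using assms by (auto simp: linear_part_def)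
  show "u = (\<lambda>v. L v + u 0)"
  proof
    show "u v = L v + u 0" for v using assms[unfolded linear_part_def] by (metis add.commute add_0)
  qed
qed

lemma linear_part_sector:
  assumes "linear_part u L"
  shows "u ` sector x X = sector (u x) (L ` X)"
  unfolding sector_def image_image by (simp add: linear_partD(2)[OF assms])

lemma linear_part_inv:
  assumes u: "u \<in> Wa D" and L: "linear_part u L"
  shows "linear_part (inv u) (inv L)"
  unfolding linear_part_def
proof (intro conjI allI)
  note W = linear_partD(1)[OF L]
  show "inv L \<in> Wv D" by (rule Wv_inv[OF W])
  fix x v
  have "u (inv u x + inv L v) = x + v"
    by (simp add: linear_partD(2)[OF L] Wa_inv_cancel[OF u] Wv_inv_cancel[OF W])
  then show "inv u (x + v) = inv u x + inv L v" by (metis Wa_inv_cancel(2)[OF u])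
qed

end

locale masure_group = apartment_model M
  for M :: "('v::euclidean_space, 'i::finite, 'g::real_vector, 'd) masure_datum" +
  fixes G :: "('d \<Rightarrow> 'd) set"
  assumes masure: "masure M"
    and thick: "thick M"
    and group: "automorphism_group M G"
    and vectorial: "\<forall>g\<in>G. vectorially_Weyl M g"
    and transitive: "strongly_transitive_masure M G"
begin

lemmas masure_conditions = masure[unfolded masure_def]
lemmas MA1 = masure_conditions[THEN conjunct2, THEN conjunct2, THEN conjunct1]
lemmas MA2 = masure_conditions[THEN conjunct2, THEN conjunct2, THEN conjunct2, THEN conjunct1]
lemmas MA3 = masure_conditions[THEN conjunct2, THEN conjunct2, THEN conjunct2, THEN conjunct2, THEN conjunct1]

lemma G_id: "id \<in> G"
  and G_inv: "g \<in> G \<Longrightarrow> inv g \<in> G"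
  and G_comp: "g \<in> G \<Longrightarrow> g' \<in> G \<Longrightarrow> g \<circ> g' \<in> G"
  and G_bij: "g \<in> G \<Longrightarrow> bij g"
  and G_apts: "g \<in> G \<Longrightarrow> (`) g ` apts M = apts M"
  using group unfolding automorphism_group_def Aut_masure_def by auto

lemma G_inv_cancel:
  assumes "g \<in> G"
  shows "g (inv g v) = v" "inv g (g v) = v"
  using G_bij[OF assms] by (simp_all add: bij_is_surj surj_f_inv_f bij_is_inj inv_f_f)

definition chart :: "('v \<Rightarrow> 'd) \<Rightarrow> bool" where
  "chart f \<longleftrightarrow> (\<exists>A\<in>apts M. f \<in> charts M A)"

lemma charts_bij:
  assumes "A \<in> apts M" "f \<in> charts M A"
  shows "inj f" "range f = A"
proof -
  obtain f0 w where "bij_betw f0 UNIV A" "f = f0 \<circ> w" "w \<in> Wa M" using MA1 assms by blast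
  then have "bij_betw f UNIV A" using Wa_bij bij_betw_trans by blast
  then show "inj f" "range f = A" by (auto simp: bij_betw_def)
qed

lemma chartI: "A \<in> apts M \<Longrightarrow> f \<in> charts M A \<Longrightarrow> chart f"
  by (auto simp: chart_def)

lemma chartD:
  assumes "chart f"
  shows "inj f" "range f \<in> apts M" "f \<in> charts M (range f)"
  using assms charts_bij unfolding chart_def by auto

lemma chart_exists:
  assumes "A \<in> apts M"
  obtains f where "chart f" "range f = A"
proof -
  obtain f0 where "charts M A = {f0 \<circ> w | w. w \<in> Wa M}" using MA1 assms by blast
  then have "f0 \<circ> id \<in> charts M A" using Wa_id by blast
  then show ?thesis using that charts_bij[OF assms] chartI[OF assms] by blast
qed

lemma chart_comp:
  assumes "chart f" "u \<in> Wa M"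
  shows "chart (f \<circ> u)"
proof -
  obtain f0 where f0: "charts M (range f) = {f0 \<circ> w | w. w \<in> Wa M}" using MA1 chartD(2)[OF assms(1)] by blast
  then obtain w where w: "w \<in> Wa M" "f = f0 \<circ> w" using chartD(3)[OF assms(1)] by blast
  have "f \<circ> u = f0 \<circ> (w \<circ> u)" using w by (simp add: comp_assoc)
  then have "f \<circ> u \<in> charts M (range f)" using f0 Wa_comp[OF w(1) assms(2)] by blast
  then show ?thesis using chartI chartD(2)[OF assms(1)] by blast
qed

lemma range_chart_comp: "u \<in> Wa M \<Longrightarrow> range (f \<circ> u) = range f"
  using Wa_bij[of u] by (metis bij_is_surj image_comp)

lemma charts_related:
  assumes "chart f" "chart f'" "range f = range f'"
  obtains u where "u \<in> Wa M" "f' = f \<circ> u"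
proof -
  obtain f0 where f0: "charts M (range f) = {f0 \<circ> w | w. w \<in> Wa M}" using MA1 chartD(2)[OF assms(1)] by blast
  obtain w where w: "w \<in> Wa M" "f = f0 \<circ> w" using chartD(3)[OF assms(1)] f0 by blast
  obtain w' where w': "w' \<in> Wa M" "f' = f0 \<circ> w'" using chartD(3)[OF assms(2)] f0 assms(3) by auto
  have "f' = f \<circ> (inv w \<circ> w')" by (simp add: w(2) w'(2) fun_eq_iff Wa_inv_cancel[OF w(1)])
  then show ?thesis using that Wa_comp[OF Wa_inv[OF w(1)] w'(1)] by blast
qed

lemma chart_Weyl_iso:
  assumes f: "chart f" and A': "A' \<in> apts M" and g: "Weyl_iso M (range f) A' g"
  shows "chart (g \<circ> f)" "range (g \<circ> f) = A'"
proof -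
  obtain f' where f': "chart f'" "range f' = A'" using chart_exists[OF A'] .
  have bij: "bij_betw g (range f) A'" and W: "inv f' \<circ> g \<circ> f \<in> Wa M"
    using g chartD(3)[OF f] chartD(3)[OF f'(1)] f'(2) unfolding Weyl_iso_def iso_within_def by auto
  have "g (f v) = f' (inv f' (g (f v)))" for v
    using bij f'(2) by (metis bij_betw_def f_inv_into_f image_eqI rangeI)
  then have "g \<circ> f = f' \<circ> (inv f' \<circ> g \<circ> f)" by (simp add: fun_eq_iff)
  then show "chart (g \<circ> f)" using chart_comp[OF f'(1) W] by simp
  show "range (g \<circ> f) = A'" using bij by (auto simp: bij_betw_def)
qed

lemma encl_in_chart:
  assumes "chart f"
  shows "encl_in M f (filtermap f F) = filtermap f (encl M F)"
  unfolding encl_in_def filtercomap_filtermap_inj[OF chartD(1)[OF assms]] ..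

lemma fixing_enclosed:
  assumes "chart f" "Weyl_iso_fixing M A A' (filtermap f (encl M F)) g"
  obtains E where "enclosed M E" "F \<le> principal E" "\<And>v. v \<in> E \<Longrightarrow> g (f v) = f v"
  using assms(2) unfolding Weyl_iso_fixing_def eventually_filtermap eventually_encl by blast

text \<open>
  (MA4) with the isomorphism taken in \<open>G\<close>, in terms of charts. The enclosure of \<open>R \<union> F\<close> need not be a
  set, so the conclusion speaks of one enclosed member \<open>E\<close> which is fixed pointwise.
\<close>

lemma MA4_group:
  assumes f: "chart f" and A': "A' \<in> apts M"
    and R: "R \<in> splayed_chimney_germs M" and F: "F \<in> closed_faces M \<union> solid_chimney_germs M"
    and le: "filtermap f R \<le> principal A'" "filtermap f F \<le> principal A'"
  obtains g E where "g \<in> G" "chart (g \<circ> f)" "range (g \<circ> f) = A'"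
    "enclosed M E" "R \<le> principal E" "F \<le> principal E" "\<And>v. v \<in> E \<Longrightarrow> g (f v) = f v"
proof -
  note A = chartD(2,3)[OF f]
  have "filtermap f R \<in> transferred M (splayed_chimney_germs M)"
    "filtermap f F \<in> transferred M (closed_faces M \<union> solid_chimney_germs M)"
    unfolding transferred_def using A R F by blast+
  then have "(filtermap f R, filtermap f F) \<in> MA3_pairs M" unfolding MA3_pairs_def by blast
  moreover have "sup (filtermap f R) (filtermap f F) \<le> principal (range f)"
    by (simp add: filtermap_le_range)
  moreover have "sup (filtermap f R) (filtermap f F) \<le> principal A'" using le by simp
  ultimately have "(range f, A', encl_in M f (sup (filtermap f R) (filtermap f F))) \<in> MA4_situations M"
    unfolding MA4_situations_def using A A' by blast
  then have "(range f, A', filtermap f (encl M (sup R F))) \<in> MA4_situations M"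
    unfolding filtermap_sup[symmetric] encl_in_chart[OF f] .
  then obtain g where g: "g \<in> G" "Weyl_iso_fixing M (range f) A' (filtermap f (encl M (sup R F))) g"
    using transitive unfolding strongly_transitive_masure_def by blast
  obtain E where E: "enclosed M E" "sup R F \<le> principal E" "\<And>v. v \<in> E \<Longrightarrow> g (f v) = f v"
    using fixing_enclosed[OF f g(2)] by blast
  have "Weyl_iso M (range f) A' g" using g(2) unfolding Weyl_iso_fixing_def by blast
  then show ?thesis using that[OF g(1) chart_Weyl_iso[OF f A'] E(1) _ _ E(3)] E(2) by simp
qed

text \<open>
  (MA2) in the same form. The last conclusion puts closed points of \<open>A \<inter> A'\<close> into \<open>A'\<close>, which
  prepares an application of (MA4) to them.
\<close>

lemma MA2_group:
  assumes f: "chart f" and A': "A' \<in> apts M" and F: "F \<in> MA2_filters M"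
    and le: "filtermap f F \<le> principal A'"
  obtains g E where "g \<in> G" "chart (g \<circ> f)" "range (g \<circ> f) = A'"
    "enclosed M E" "F \<le> principal E" "\<And>v. v \<in> E \<Longrightarrow> g (f v) = f v"
    "filtermap f (encl M F) \<le> principal A'"
proof -
  note A = chartD(2,3)[OF f]
  have "(range f, A', encl_in M f (filtermap f F)) \<in> MA2_situations M"
    unfolding MA2_situations_def using A A' F le by blast
  then have sit: "(range f, A', filtermap f (encl M F)) \<in> MA2_situations M"
    unfolding encl_in_chart[OF f] .
  then have "filtermap f (encl M F) \<le> principal (range f \<inter> A')" using MA2 by blast
  then have K: "filtermap f (encl M F) \<le> principal A'" by (rule order_trans) simp
  obtain g where g: "g \<in> G" "Weyl_iso_fixing M (range f) A' (filtermap f (encl M F)) g"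
    using transitive sit unfolding strongly_transitive_masure_def by blast
  obtain E where E: "enclosed M E" "F \<le> principal E" "\<And>v. v \<in> E \<Longrightarrow> g (f v) = f v"
    using fixing_enclosed[OF f g(2)] by blast
  have "Weyl_iso M (range f) A' g" using g(2) unfolding Weyl_iso_fixing_def by blast
  then show ?thesis using that[OF g(1) chart_Weyl_iso[OF f A'] E K] by blast
qed

lemma MA3_charts:
  assumes "chart f" "chart f'" "R \<in> splayed_chimney_germs M" "F \<in> closed_faces M \<union> solid_chimney_germs M"
  obtains A where "A \<in> apts M" "filtermap f R \<le> principal A" "filtermap f' F \<le> principal A"
proof -
  have "filtermap f R \<in> transferred M (splayed_chimney_germs M)"
    "filtermap f' F \<in> transferred M (closed_faces M \<union> solid_chimney_germs M)"
    unfolding transferred_def using chartD assms by blast+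
  then have "(filtermap f R, filtermap f' F) \<in> MA3_pairs M" unfolding MA3_pairs_def by blast
  then show ?thesis using MA3 that by blast
qed

text \<open>
  Both apartments share a sector germ with a third one. A sector germ is both splayed and solid,
  so in (MA4) it can play both roles at once.
\<close>

lemma apartments_transitive:
  assumes f: "chart f" "chart f'"
  obtains g u where "g \<in> G" "u \<in> Wa M" "g \<circ> f = f' \<circ> u"
proof -
  note R = sector_germ_splayed[OF C_chamber] and F = UnI2[OF sector_germ_solid[OF C_chamber]]
  obtain A where A: "A \<in> apts M" "filtermap f (sector_germ C) \<le> principal A" "filtermap f' (sector_germ C) \<le> principal A"
    using MA3_charts[OF f R F] .
  obtain g where g: "g \<in> G" "chart (g \<circ> f)" "range (g \<circ> f) = A"
    using MA4_group[OF f(1) A(1) R F A(2,2)] by blast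
  obtain g' where g': "g' \<in> G" "chart (g' \<circ> f')" "range (g' \<circ> f') = A"
    using MA4_group[OF f(2) A(1) R F A(3,3)] by blast
  obtain u where u: "u \<in> Wa M" "g \<circ> f = g' \<circ> f' \<circ> u"
    using charts_related[OF g'(2) g(2)] g(3) g'(3) by auto
  have "inv g' \<circ> g \<circ> f = f' \<circ> u"
    using u(2) by (simp add: fun_eq_iff G_inv_cancel[OF g'(1)])
  then show ?thesis using that[OF G_comp[OF G_inv[OF g'(1)] g(1)] u(1)] by blast
qed

section \<open>Reflections in the stabilizer of an apartment\<close>

text \<open>
  Here \<open>f3\<close> describes a third local chamber on the panel of type \<open>i\<close> at the origin of the chart
  \<open>f\<close>. An apartment which contains it and the germ of the sector \<open>X\<close> is the image of \<open>range f\<close> under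
  some \<open>g\<close> that fixes \<open>X\<close> and so maps the other side \<open>Y\<close> to the third chamber; it is also the
  image of \<open>range f3\<close> under some \<open>g'\<close> that fixes the third chamber. The comparison of the two charts is
  \<open>u\<close>, hence \<open>L ` X3 = Y\<close>.
\<close>

lemma unfold_along_panel:
  assumes f: "chart f" and XY: "X = C \<and> Y = s i ` C \<or> X = s i ` C \<and> Y = C"
    and f3: "chart f3" and X3: "X3 \<in> chambers"
    and cover: "filtermap f (local_face 0 (panel i)) \<le> filtermap f3 (filter_closure (local_face x3 X3))"
    and other: "filtermap f3 (local_face x3 X3) \<noteq> filtermap f (local_face 0 X)"
  obtains g g' u L where "g \<in> G" "g' \<in> G" "u \<in> Wa M" "linear_part u L" "g' \<circ> f3 = g \<circ> f \<circ> u" "L ` X3 = Y"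
proof -
  have X: "X \<in> chambers" using XY Wv_image_chamber[OF C_chamber Wv_srefl] by auto
  note R = sector_germ_splayed[OF X]
  obtain A where A: "A \<in> apts M" "filtermap f (sector_germ X) \<le> principal A"
    "filtermap f3 (encl M (local_face x3 X3)) \<le> principal A"
    using MA3_charts[OF f f3 R UnI1[OF closed_chamber_face[OF X3]]] .
  have "filtermap f (local_face 0 (panel i)) \<le> principal A"
    using order_trans[OF cover order_trans[OF filtermap_mono[OF filter_closure_le_encl] A(3)]] .
  then obtain e where e: "e > 0" "\<And>y. y \<in> panel i \<Longrightarrow> norm y < e \<Longrightarrow> f y \<in> A"
    unfolding filter_le_principal_iff eventually_filtermap eventually_local_face by auto
  \<comment> \<open>the enclosure of the sector germ and of y contains the sector based at y\<close>
  have fixing_at: "\<exists>g\<in>G. chart (g \<circ> f) \<and> range (g \<circ> f) = A \<and> g (f y) = f y \<and> (\<forall>v\<in>sector y X. g (f v) = f v)"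
    if y: "y \<in> panel i" "norm y < e" for y
  proof -
    have pt: "principal {y} \<in> MA2_filters M" unfolding MA2_filters_def by blast
    have "filtermap f (principal {y}) \<le> principal A" using e(2)[OF y] by (simp add: filtermap_principal)
    then have le: "filtermap f (encl M (principal {y})) \<le> principal A"
      using MA2_group[OF f A(1) pt] by blast
    obtain g E where g: "g \<in> G" "chart (g \<circ> f)" "range (g \<circ> f) = A"
      and E: "enclosed M E" "sector_germ X \<le> principal E" "encl M (principal {y}) \<le> principal E"
        "\<And>v. v \<in> E \<Longrightarrow> g (f v) = f v"
      using MA4_group[OF f A(1) R UnI1[OF closed_point_face] A(2) le] by blast
    have "y \<in> E" using E(3) unfolding encl_le_iff[OF E(1)] by simp
    moreover obtain \<xi> where "sector \<xi> X \<subseteq> E"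
      using E(2) unfolding filter_le_principal_iff eventually_sector_germ[OF X] by blast
    ultimately have "sector y X \<subseteq> E" using enclosed_recession[OF E(1) X] by blast
    then show ?thesis using g E(4) \<open>y \<in> E\<close> by blast
  qed
  obtain y0 where y0: "y0 \<in> panel i" "norm y0 < e" using panel_small[OF e(1)] .
  obtain g where g: "g \<in> G" "chart (g \<circ> f)" "range (g \<circ> f) = A" "\<And>v. v \<in> sector y0 X \<Longrightarrow> g (f v) = f v"
    using fixing_at[OF y0] by blast
  \<comment> \<open>the isomorphisms for different points y agree on a common subsector, so they are equal\<close>
  have all: "g (f y) = f y \<and> (\<forall>v\<in>sector y X. g (f v) = f v)" if y: "y \<in> panel i" "norm y < e" for y
  proof -
    obtain g1 where g1: "g1 \<in> G" "chart (g1 \<circ> f)" "range (g1 \<circ> f) = A" "g1 (f y) = f y"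
      "\<And>v. v \<in> sector y X \<Longrightarrow> g1 (f v) = f v"
      using fixing_at[OF y] by blast
    obtain u where u: "u \<in> Wa M" "g1 \<circ> f = g \<circ> f \<circ> u"
      using charts_related[OF g(2) g1(2)] g(3) g1(3) by auto
    obtain \<xi> where \<xi>: "\<xi> \<in> X" "\<xi> - (y0 - y) \<in> X" using chambers_absorb[OF X] .
    have "u = id"
    proof (rule Wa_eq_of_open[OF u(1) Wa_id])
      show "open (sector y X \<inter> sector y0 X)"
        unfolding sector_def using open_translation[OF chambers_open[OF X]] by (intro open_Int) auto
      show "y + \<xi> \<in> sector y X \<inter> sector y0 X" using \<xi> by (simp add: mem_sector algebra_simps)
      fix v assume "v \<in> sector y X \<inter> sector y0 X"
      then have "g (f v) = f v" "g1 (f v) = f v" using g(4) g1(5) by auto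
      then have "(g \<circ> f) (u v) = (g \<circ> f) v" using fun_cong[OF u(2), of v] by (metis comp_apply)
      then show "u v = id v" using injD[OF chartD(1)[OF g(2)]] by simp
    qed
    then have "g1 \<circ> f = g \<circ> f" using u(2) by simp
    then show ?thesis using g1(4,5) by (metis comp_apply)
  qed
  have k_panel: "eventually (\<lambda>v. (g \<circ> f) v = f v) (local_face 0 (panel i))"
    unfolding eventually_local_face using all e(1) by (intro exI[of _ e]) (auto simp: dist_norm)
  \<comment> \<open>the sectors based at points of the panel near 0 exhaust X\<close>
  have k_X: "(g \<circ> f) v = f v" if v: "v \<in> X" for v
  proof -
    obtain d where d: "d > 0" "\<And>y. dist y v < d \<Longrightarrow> y \<in> X" using chambers_open[OF X] v unfolding open_dist by blast
    obtain y where y: "y \<in> panel i" "norm y < min d e" using panel_small[of "min d e" i] d(1) e(1) by auto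
    have "v \<in> sector y X" unfolding mem_sector using y by (intro d(2)) (simp add: dist_norm)
    then show ?thesis using all[OF y(1)] y(2) by simp
  qed
  \<comment> \<open>a closed chamber is a solid chimney, so (MA2) provides an element that fixes it and maps its apartment onto A\<close>
  have sol: "encl M (local_face x3 X3) \<in> MA2_filters M"
    unfolding MA2_filters_def using closed_chamber_solid[OF X3] by blast
  obtain g' E where g': "g' \<in> G" "chart (g' \<circ> f3)" "range (g' \<circ> f3) = A"
    and E: "enclosed M E" "encl M (local_face x3 X3) \<le> principal E" "\<And>v. v \<in> E \<Longrightarrow> g' (f3 v) = f3 v"
    using MA2_group[OF f3 A(1) sol A(3)] by blast
  have lE: "local_face x3 X3 \<le> principal E" using E(2) unfolding encl_le_iff[OF E(1)] .
  have agree: "eventually (\<lambda>v. (g' \<circ> f3) v = f3 v) F" if "F \<le> principal E" for F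
    using that E(3) unfolding filter_le_principal_iff by (auto elim: eventually_mono)
  obtain u where u: "u \<in> Wa M" "g' \<circ> f3 = g \<circ> f \<circ> u"
    using charts_related[OF g(2) g'(2)] g(3) g'(3) by auto
  obtain L where L: "linear_part u L" using linear_part_exists[OF u(1)] .
  have "filtermap (g \<circ> f) (local_face 0 (panel i)) = filtermap f (local_face 0 (panel i))"
    by (rule filtermap_cong_eventually[OF k_panel])
  also have "\<dots> \<le> filtermap (g' \<circ> f3) (filter_closure (local_face x3 X3))"
    unfolding filtermap_cong_eventually[OF agree[OF filter_closure_le_enclosed[OF E(1) lE]]] by (rule cover)
  also have "\<dots> = filtermap (g \<circ> f) (filtermap u (filter_closure (local_face x3 X3)))"
    unfolding u(2) filtermap_filtermap by (simp add: comp_def)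
  finally have "local_face 0 (panel i) \<le> filtermap u (filter_closure (local_face x3 X3))"
    unfolding filtermap_mono_strong[OF chartD(1)[OF g(2)]] .
  note pos = panel_covered_by_chamber[OF X3 linear_partD(1,3)[OF L] Wa_bij[OF u(1)] this]
  have "L ` X3 = C \<or> L ` X3 = s i ` C"
    by (rule chambers_of_panel[OF Wv_image_chamber[OF X3 linear_partD(1)[OF L]] pos(2)])
  moreover have "L ` X3 \<noteq> X"
  proof
    assume eq: "L ` X3 = X"
    have "filtermap f3 (local_face x3 X3) = filtermap (g' \<circ> f3) (local_face x3 X3)"
      by (rule filtermap_cong_eventually[OF agree[OF lE], symmetric])
    also have "\<dots> = filtermap (g \<circ> f) (filtermap u (local_face x3 X3))"
      unfolding u(2) filtermap_filtermap by (simp add: comp_def)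
    also have "filtermap u (local_face x3 X3) = local_face 0 X"
      using Wa_local_face[OF linear_partD(1,3)[OF L], of x3 X3] unfolding pos(1) eq .
    also have "filtermap (g \<circ> f) (local_face 0 X) = filtermap f (local_face 0 X)"
      by (rule filtermap_cong_eventually) (use k_X in \<open>auto simp: eventually_local_face intro!: exI[of _ 1]\<close>)
    finally show False using other by blast
  qed
  ultimately have "L ` X3 = Y" using XY by auto
  then show ?thesis using that[OF g(1) g'(1) u(1) L u(2)] by blast
qed

text \<open>
  The two ways of folding \<open>A\<close> along the panel, towards the third chamber from either side, are
  composed through the third chamber.
\<close>

lemma panel_reflection:
  assumes f: "chart f"
  obtains n u L where "n \<in> G" "u \<in> Wa M" "linear_part u L" "n \<circ> f = f \<circ> u" "L ` C = s i ` C"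
proof -
  have "panel i = (\<lambda>v. 1 *\<^sub>R id v) ` std_face M {i}" by (simp add: panel_def)
  moreover have "{i} \<in> {J. card J = 1}" by simp
  ultimately have "panel i \<in> signed_faces M {J. card J = 1}"
    unfolding signed_faces_def vec_faces_def using Wv_id by blast
  then have "filtermap f (local_face 0 (panel i)) \<in> local_panels M"
    unfolding local_panels_def transferred_def using chartD[OF f] by blast
  then obtain \<C> where c: "\<C> \<subseteq> covering_chambers M (filtermap f (local_face 0 (panel i)))" "finite \<C>" "card \<C> = 3"
    using thick unfolding thick_def by blast
  have "\<not> \<C> \<subseteq> {filtermap f (local_face 0 C), filtermap f (local_face 0 (s i ` C))}"
  proof
    assume "\<C> \<subseteq> {filtermap f (local_face 0 C), filtermap f (local_face 0 (s i ` C))}"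
    then have "card \<C> \<le> card {filtermap f (local_face 0 C), filtermap f (local_face 0 (s i ` C))}"
      by (rule card_mono[rotated]) simp
    also have "\<dots> \<le> 2" by (rule order_trans[OF card_insert_le_m1]) auto
    finally show False using c(3) by simp
  qed
  then obtain F3 where F3: "F3 \<in> covering_chambers M (filtermap f (local_face 0 (panel i)))"
    "F3 \<noteq> filtermap f (local_face 0 C)" "F3 \<noteq> filtermap f (local_face 0 (s i ` C))"
    using c(1) by blast
  obtain A f3 x3 X3 where A: "A \<in> apts M" "f3 \<in> charts M A" and X3: "X3 \<in> chambers"
    and F3': "F3 = filtermap f3 (local_face x3 X3)"
    and cover: "filtermap f (local_face 0 (panel i)) \<le> filtermap f3 (filter_closure (local_face x3 X3))"
    using F3(1) unfolding covering_chambers_def chambers_def by blast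
  note f3 = chartI[OF A]
  obtain g1 h1 u1 L1 where 1: "g1 \<in> G" "h1 \<in> G" "u1 \<in> Wa M" "linear_part u1 L1" "h1 \<circ> f3 = g1 \<circ> f \<circ> u1" "L1 ` X3 = C"
    using unfold_along_panel[OF f _ f3 X3 cover, of "s i ` C" C] F3(3)[unfolded F3'] by blast
  obtain g2 h2 u2 L2 where 2: "g2 \<in> G" "h2 \<in> G" "u2 \<in> Wa M" "linear_part u2 L2" "h2 \<circ> f3 = g2 \<circ> f \<circ> u2" "L2 ` X3 = s i ` C"
    using unfold_along_panel[OF f _ f3 X3 cover, of C "s i ` C"] F3(2)[unfolded F3'] by blast
  have a: "g1 (f v) = h1 (f3 (inv u1 v))" for v
    using fun_cong[OF 1(5), of "inv u1 v"] by (simp add: Wa_inv_cancel[OF 1(3)])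
  have b: "h2 (f3 v) = g2 (f (u2 v))" for v using fun_cong[OF 2(5), of v] by simp
  have "(inv g2 \<circ> (h2 \<circ> (inv h1 \<circ> g1))) \<circ> f = f \<circ> (u2 \<circ> inv u1)"
    by (simp add: fun_eq_iff a G_inv_cancel[OF 1(2)] b G_inv_cancel[OF 2(1)])
  moreover have "inv g2 \<circ> (h2 \<circ> (inv h1 \<circ> g1)) \<in> G" by (intro G_comp G_inv 1 2)
  moreover have "u2 \<circ> inv u1 \<in> Wa M" by (intro Wa_comp Wa_inv 1 2)
  moreover have "linear_part (u2 \<circ> inv u1) (L2 \<circ> inv L1)"
    by (intro linear_part_comp linear_part_inv 1 2)
  moreover have "(L2 \<circ> inv L1) ` C = s i ` C"
  proof -
    have "inv L1 ` C = X3"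
      unfolding 1(6)[symmetric] image_image Wv_inv_cancel[OF linear_partD(1)[OF 1(4)]] by simp
    then show ?thesis using 2(6) by (metis image_comp)
  qed
  ultimately show ?thesis using that by blast
qed

text \<open>
  Since \<open>panel_reflection\<close> holds in every chart, the galleries of \<open>A\<close> can be followed panel by panel. The
  induction runs over the first letter, which changes the chart from \<open>f\<close> to \<open>f \<circ> s i\<close>.
\<close>

lemma chamber_stabilizer_transitive:
  assumes f: "chart f" and w: "w \<in> Wv M"
  shows "\<exists>n\<in>G. \<exists>u\<in>Wa M. \<exists>L. linear_part u L \<and> n \<circ> f = f \<circ> u \<and> L ` C = w ` C"
proof -
  obtain xs where "w = word_prod xs" using w unfolding Wv_eq_words by blast
  have "\<exists>n\<in>G. \<exists>u\<in>Wa M. \<exists>L. linear_part u L \<and> n \<circ> f = f \<circ> u \<and> L ` C = word_prod xs ` C"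
    using f
  proof (induction xs arbitrary: f)
    case Nil
    have "linear_part id id" by (simp add: linear_part_def)
    then have "linear_part id id \<and> id \<circ> f = f \<circ> id \<and> id ` C = word_prod [] ` C" by simp
    then show ?case using G_id Wa_id by blast
  next
    case (Cons i xs)
    obtain n1 u1 L1 where 1: "n1 \<in> G" "u1 \<in> Wa M" "linear_part u1 L1" "n1 \<circ> f = f \<circ> u1" "L1 ` C = s i ` C"
      using panel_reflection[OF Cons.prems] .
    obtain n u L where 2: "n \<in> G" "u \<in> Wa M" "linear_part u L" "n \<circ> (f \<circ> s i) = f \<circ> s i \<circ> u" "L ` C = word_prod xs ` C"
      using Cons.IH[OF chart_comp[OF Cons.prems srefl_Wa]] by blast
    define u' where "u' = s i \<circ> (u \<circ> (s i \<circ> u1))"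
    have a: "n1 (f v) = f (u1 v)" for v using fun_cong[OF 1(4)] by simp
    have b: "n (f v) = f (s i (u (s i v)))" for v using fun_cong[OF 2(4), of "s i v"] by (simp add: srefl_invol)
    have "(n \<circ> n1) \<circ> f = f \<circ> u'" by (simp add: fun_eq_iff a b u'_def)
    moreover have "n \<circ> n1 \<in> G" by (intro G_comp 1 2)
    moreover have "u' \<in> Wa M" unfolding u'_def by (intro Wa_comp srefl_Wa 1 2)
    moreover have "linear_part u' (s i \<circ> (L \<circ> (s i \<circ> L1)))"
      unfolding u'_def by (intro linear_part_comp linear_part_srefl 1 2)
    moreover have "(s i \<circ> (L \<circ> (s i \<circ> L1))) ` C = word_prod (i # xs) ` C"
    proof -
      have "(s i \<circ> L1) ` C = C" unfolding image_comp[symmetric] 1(5) by (simp add: image_image srefl_invol)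
      then show ?thesis by (metis image_comp 2(5) word_prod_Cons)
    qed
    ultimately show ?case by blast
  qed
  then show ?thesis using \<open>w = word_prod xs\<close> by simp
qed

end

context masure_group
begin

section \<open>Sectors common to two apartments\<close>

lemma signed_facesE:
  assumes "Fv \<in> signed_faces M \<J>"
  obtains \<sigma> w J where "\<sigma> = 1 \<or> \<sigma> = - 1" "w \<in> Wv M" "J \<in> \<J>" "Fv = (\<lambda>v. \<sigma> *\<^sub>R w v) ` std_face M J"
  using assms unfolding signed_faces_def vec_faces_def by blast

lemma generic_ray:
  assumes X: "X \<in> chambers" and c: "c \<in> X"
  shows "{z + t *\<^sub>R c | t. t \<ge> 0} \<in> generic_rays M"
proof -
  have c0: "c \<noteq> 0"
    using chamber_root_sign[OF X Wv_id, of undefined] c by (auto simp: root_simps)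
  obtain \<sigma> w where w: "\<sigma> = 1 \<or> \<sigma> = - 1" "w \<in> Wv M" "X = (\<lambda>v. \<sigma> *\<^sub>R w v) ` C" using X by (rule chambersE)
  have "(\<lambda>v. 1 *\<^sub>R w v) ` std_face M {} \<in> vec_faces M 1 (spherical_types M)"
    unfolding vec_faces_def using w(2) empty_spherical by blast
  then have "w v \<in> tits_cone_sph M" if "v \<in> C" for v
    using that unfolding tits_cone_sph_def chamber_def by auto
  then have "c \<in> tits_cone_sph M \<or> - c \<in> tits_cone_sph M" using c w(1,3) by auto
  then have "apt_less_sph M z (z + c) \<or> apt_less_sph M (z + c) z" by (simp add: apt_less_sph_def)
  moreover have "{z + t *\<^sub>R c | t. t \<ge> 0} = {z + t *\<^sub>R ((z + c) - z) | t. t \<ge> 0}" by simp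
  moreover have "z \<noteq> z + c" using c0 by simp
  ultimately show ?thesis unfolding generic_rays_def by blast
qed

text \<open>
  (MA2) for a generic ray: along the ray the change of charts is an element of \<open>W\<^sup>a\<close>, which may
  depend on the ray.
\<close>

lemma chart_change_on_ray:
  assumes f: "chart f" "chart f'" and X: "X \<in> chambers" and c: "c \<in> X"
    and ray: "\<And>t. t \<ge> 0 \<Longrightarrow> f (z + t *\<^sub>R c) \<in> range f'"
  obtains u L where "u \<in> Wa M" "linear_part u L" "\<And>t. t \<ge> 0 \<Longrightarrow> f (z + t *\<^sub>R c) = f' (u z + t *\<^sub>R L c)"
proof -
  define r where "r = {z + t *\<^sub>R c | t. t \<ge> 0}"
  have "principal r \<in> MA2_filters M" unfolding r_def MA2_filters_def using generic_ray[OF X c] by blast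
  moreover have "filtermap f (principal r) \<le> principal (range f')"
    using ray by (auto simp: filtermap_principal r_def)
  ultimately obtain g E where g: "g \<in> G" "chart (g \<circ> f)" "range (g \<circ> f) = range f'"
    and E: "principal r \<le> principal E" "\<And>v. v \<in> E \<Longrightarrow> g (f v) = f v"
    using MA2_group[OF f(1) chartD(2)[OF f(2)]] by metis
  obtain u where u: "u \<in> Wa M" "g \<circ> f = f' \<circ> u" using charts_related[OF f(2) g(2)] g(3) by auto
  obtain L where L: "linear_part u L" using linear_part_exists[OF u(1)] .
  have "f (z + t *\<^sub>R c) = f' (u z + t *\<^sub>R L c)" if t: "t \<ge> 0" for t
  proof -
    have "z + t *\<^sub>R c \<in> E" using E(1) t unfolding r_def by auto
    then have "f (z + t *\<^sub>R c) = f' (u (z + t *\<^sub>R c))" using E(2) fun_cong[OF u(2)] by simp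
    also have "u (z + t *\<^sub>R c) = u z + t *\<^sub>R L c"
      by (simp add: linear_partD(2)[OF L] linear_cmul[OF Wv_linear[OF linear_partD(1)[OF L]]])
    finally show ?thesis .
  qed
  then show ?thesis using that u(1) L by blast
qed

lemma sector_ray:
  assumes "X \<in> chambers" "z \<in> sector y X" "c \<in> X" "t \<ge> 0"
  shows "z + t *\<^sub>R c \<in> sector y X"
proof (cases "t = 0")
  case False
  then show ?thesis
    using assms chambers_add[OF assms(1), of "z - y" "t *\<^sub>R c"] chambers_scale[OF assms(1,3), of t]
    by (simp add: mem_sector algebra_simps)
qed (use assms in simp)

text \<open>
  If the set is a sector in one apartment, an element of \<open>W\<^sup>a\<close> maps a ray of the sector into the
  sector-face of the other apartment. If the latter were smaller than a sector, a real root would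
  vanish on the direction of the ray, which lies in a chamber.
\<close>

lemma sector_type:
  assumes f: "chart f" "chart f'" and X: "X \<in> chambers"
    and F: "\<sigma> = 1 \<or> \<sigma> = - 1" "w \<in> Wv M" "Fv = (\<lambda>v. \<sigma> *\<^sub>R w v) ` std_face M J"
    and eq: "f ` sector y X = f' ` sector y' Fv"
  shows "J = {}"
proof (rule ccontr)
  assume "J \<noteq> {}"
  then obtain i where i: "i \<in> J" by blast
  obtain c where c: "c \<in> X" using chambers_nonempty[OF X] by blast
  have z: "y + c \<in> sector y X" using c by (simp add: mem_sector)
  have im: "f (y + c + t *\<^sub>R c) \<in> f' ` sector y' Fv" if "t \<ge> 0" for t
    using sector_ray[OF X z c that] unfolding eq[symmetric] by blast
  then have "\<And>t. t \<ge> 0 \<Longrightarrow> f (y + c + t *\<^sub>R c) \<in> range f'" by blast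
  from chart_change_on_ray[OF f X c this] obtain u L where u: "u \<in> Wa M" "linear_part u L"
    "\<And>t. t \<ge> 0 \<Longrightarrow> f (y + c + t *\<^sub>R c) = f' (u (y + c) + t *\<^sub>R L c)" by metis
  have mem: "u (y + c) + t *\<^sub>R L c - y' \<in> Fv" if "t \<ge> 0" for t
    using im[OF that] unfolding u(3)[OF that] inj_image_mem_iff[OF chartD(1)[OF f(2)]] mem_sector .
  note W = Wv_inv[OF F(2)]
  have zero: "\<alpha> i (inv w p) = 0" if "p \<in> Fv" for p
    using that i F(1) unfolding F(3) std_face_def
    by (auto simp: Wv_inv_cancel[OF F(2)] linear_cmul[OF Wv_linear[OF W]] linear_neg[OF Wv_linear[OF W]] root_simps)
  have "\<alpha> i (inv w (u (y + c) + 1 *\<^sub>R L c - y')) - \<alpha> i (inv w (u (y + c) + 0 *\<^sub>R L c - y')) = 0"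
    using zero[OF mem[of 1]] zero[OF mem[of 0]] by simp
  then have "\<alpha> i ((inv w \<circ> L) c) = 0"
    by (simp add: linear_add[OF Wv_linear[OF W]] linear_diff[OF Wv_linear[OF W]] root_simps)
  then show False
    using chamber_root_sign[OF X Wv_comp[OF W linear_partD(1)[OF u(2)]], of i] c by force
qed

lemma sector_type_chamber:
  assumes f: "chart f" "chart f'" and X: "X \<in> chambers" and F: "Fv \<in> signed_faces M \<J>"
    and eq: "f ` sector y X = f' ` sector y' Fv"
  shows "Fv \<in> chambers"
proof -
  obtain \<sigma> w J where *: "\<sigma> = 1 \<or> \<sigma> = - 1" "w \<in> Wv M" "Fv = (\<lambda>v. \<sigma> *\<^sub>R w v) ` std_face M J"
    using F by (rule signed_facesE)
  have "J = {}" using sector_type[OF f X * eq] .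
  then show ?thesis using chambersI[OF *(1,2)] *(3) by (simp add: chamber_def)
qed

text \<open>
  The change of charts along each ray maps the direction of the ray into \<open>Y\<close>, so its linear part is
  the unique \<open>L\<close> with \<open>L ` X = Y\<close>, independently of the ray. Any two points of the sector are joined by
  two rays that meet, hence the change of charts is one affine map.
\<close>

lemma chart_change_on_sector:
  assumes f: "chart f" "chart f'" and X: "X \<in> chambers" and Y: "Y \<in> chambers"
    and eq: "f ` sector y X = f' ` sector y' Y"
  obtains u L where "u \<in> Wa M" "linear_part u L" "L ` X = Y" "\<And>v. v \<in> sector y X \<Longrightarrow> f v = f' (u v)"
proof -
  obtain \<sigma> w where w: "\<sigma> = 1 \<or> \<sigma> = - 1" "w \<in> Wv M" "Y = (\<lambda>v. \<sigma> *\<^sub>R w v) ` C" using Y by (rule chambersE)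
  note W = Wv_inv[OF w(2)]
  note lin = Wv_linear[OF W]
  have loc: "\<exists>u L. u \<in> Wa M \<and> linear_part u L \<and> L ` X = Y \<and> f z = f' (u z) \<and> f (z + c) = f' (u z + L c)"
    if z: "z \<in> sector y X" and c: "c \<in> X" for z c
  proof -
    have im: "f (z + t *\<^sub>R c) \<in> f' ` sector y' Y" if "t \<ge> 0" for t
      using sector_ray[OF X z c that] unfolding eq[symmetric] by blast
    then have "\<And>t. t \<ge> 0 \<Longrightarrow> f (z + t *\<^sub>R c) \<in> range f'" by blast
    from chart_change_on_ray[OF f X c this] obtain u L where u: "u \<in> Wa M" "linear_part u L"
      "\<And>t. t \<ge> 0 \<Longrightarrow> f (z + t *\<^sub>R c) = f' (u z + t *\<^sub>R L c)" by metis
    have mem: "u z + t *\<^sub>R L c - y' \<in> Y" if "t \<ge> 0" for t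
      using im[OF that] unfolding u(3)[OF that] inj_image_mem_iff[OF chartD(1)[OF f(2)]] mem_sector .
    \<comment> \<open>the image ray stays in the sector, so no root of Y can decrease along it, nor be constant\<close>
    have "\<sigma> * \<alpha> i (inv w (L c)) > 0" for i
    proof -
      define p q where "p = \<sigma> * \<alpha> i (inv w (u z - y'))" and "q = \<sigma> * \<alpha> i (inv w (L c))"
      have pos: "p + t * q > 0" if "t \<ge> 0" for t
      proof -
        have "\<sigma> * \<alpha> i (inv w ((u z - y') + t *\<^sub>R L c)) > 0"
          using mem[OF that] unfolding w(3) mem_chamber_iff[OF w(1,2)] by (simp add: algebra_simps)
        then show ?thesis
          unfolding p_def q_def linear_add[OF lin] linear_cmul[OF lin] by (simp add: root_simps distrib_left mult.left_commute)
      qed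
      have "q \<noteq> 0"
        using chamber_root_sign[OF X Wv_comp[OF W linear_partD(1)[OF u(2)]], of i] c w(1) by (force simp: q_def)
      moreover have "\<not> q < 0"
      proof
        assume q: "q < 0"
        have "p > 0" using pos[of 0] by simp
        then have "p + (p / - q) * q > 0" using q by (intro pos divide_nonneg_pos) auto
        then show False using q by simp
      qed
      ultimately show ?thesis unfolding q_def[symmetric] by linarith
    qed
    then have "L c \<in> Y" unfolding w(3) mem_chamber_iff[OF w(1,2)] by blast
    then have "L ` X = Y"
      using chambers_meet[OF Wv_image_chamber[OF X linear_partD(1)[OF u(2)]] Y] c by blast
    then show ?thesis using u(1,2) u(3)[of 0] u(3)[of 1] by (intro exI[of _ u] exI[of _ L]) simp
  qed
  obtain c0 where c0: "c0 \<in> X" using chambers_nonempty[OF X] by blast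
  define z0 where "z0 = y + c0"
  have z0: "z0 \<in> sector y X" using c0 by (simp add: z0_def mem_sector)
  obtain u L where u: "u \<in> Wa M" "linear_part u L" "L ` X = Y" "f z0 = f' (u z0)"
    using loc[OF z0 c0] by blast
  define \<tau> where "\<tau> v = inv f' (f v)" for v
  have f'_inv: "inv f' (f' v) = v" for v using chartD(1)[OF f(2)] by simp
  have step: "\<tau> (z + c) = \<tau> z + L c" and f_tau: "f z = f' (\<tau> z)" if z: "z \<in> sector y X" and c: "c \<in> X" for z c
  proof -
    obtain u1 L1 where 1: "linear_part u1 L1" "L1 ` X = Y" "f z = f' (u1 z)" "f (z + c) = f' (u1 z + L1 c)"
      using loc[OF z c] by blast
    have "L1 = L" using Wv_eq_of_chamber[OF X linear_partD(1)[OF 1(1)] linear_partD(1)[OF u(2)]] 1(2) u(3) by simp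
    then show "\<tau> (z + c) = \<tau> z + L c" "f z = f' (\<tau> z)" using 1(3,4) by (simp_all add: \<tau>_def f'_inv)
  qed
  note linL = Wv_linear[OF linear_partD(1)[OF u(2)]]
  have "f v = f' (u v)" if v: "v \<in> sector y X" for v
  proof -
    obtain \<xi> where \<xi>: "\<xi> \<in> X" "\<xi> - (z0 - v) \<in> X" using chambers_absorb[OF X] .
    have "\<tau> v + L \<xi> = \<tau> (v + \<xi>)" using step[OF v \<xi>(1)] by simp
    also have "v + \<xi> = z0 + (\<xi> - (z0 - v))" by simp
    also have "\<tau> \<dots> = \<tau> z0 + L (\<xi> - (z0 - v))" by (rule step[OF z0 \<xi>(2)])
    finally have "\<tau> v = \<tau> z0 + L (\<xi> - (z0 - v)) - L \<xi>" by (metis add_diff_cancel_right')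
    also have "\<dots> = \<tau> z0 + L (v - z0)" by (simp add: linear_diff[OF linL])
    finally have "\<tau> v = \<tau> z0 + L (v - z0)" .
    also have "\<tau> z0 = u z0" by (simp add: \<tau>_def u(4) f'_inv)
    also have "u z0 + L (v - z0) = u v" by (simp flip: linear_partD(2)[OF u(2)])
    finally show ?thesis using f_tau[OF v c0] by simp
  qed
  then show ?thesis using that u by blast
qed

section \<open>Parallel classes of sectors\<close>

lemma shortening_eq:
  "shortening M p q \<longleftrightarrow> (\<exists>f x Fv \<xi>. chart f \<and> Fv \<in> signed_faces M (spherical_types M) \<and> \<xi> \<in> Fv \<and>
     p = f ` sector x Fv \<and> q = f ` sector (x + \<xi>) Fv)"
  unfolding shortening_def chart_def sector_def by blast

lemma parallel_eq:
  "parallel M p q \<longleftrightarrow> (\<exists>f x x' Fv. chart f \<and> Fv \<in> signed_faces M (spherical_types M) \<and>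
     shortening M p (f ` sector x Fv) \<and> shortening M q (f ` sector x' Fv))"
  unfolding parallel_def chart_def sector_def by blast

lemma shorteningE:
  assumes "shortening M p q"
  obtains f x Fv \<xi> where "chart f" "Fv \<in> signed_faces M (spherical_types M)" "\<xi> \<in> Fv"
    "p = f ` sector x Fv" "q = f ` sector (x + \<xi>) Fv"
  using assms unfolding shortening_eq by (elim exE conjE) (rule that)

lemma parallelE:
  assumes "parallel M p q"
  obtains f x x' Fv where "chart f" "Fv \<in> signed_faces M (spherical_types M)"
    "shortening M p (f ` sector x Fv)" "shortening M q (f ` sector x' Fv)"
  using assms unfolding parallel_eq by (elim exE conjE) (rule that)

lemma shorteningI:
  assumes "chart f" "Fv \<in> signed_faces M (spherical_types M)" "\<xi> \<in> Fv"
  shows "shortening M (f ` sector x Fv) (f ` sector (x + \<xi>) Fv)"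
  unfolding shortening_eq by (intro exI conjI) (rule assms refl)+

lemma parallelI:
  assumes "chart f" "Fv \<in> signed_faces M (spherical_types M)"
    "shortening M p (f ` sector x Fv)" "shortening M q (f ` sector x' Fv)"
  shows "parallel M p q"
  unfolding parallel_eq by (intro exI conjI) (rule assms)+

lemma sector_subset:
  assumes "X \<in> chambers" "x' - x \<in> X"
  shows "sector x' X \<subseteq> sector x X"
  using chambers_add[OF assms] by (force simp: sector_def mem_sector algebra_simps)

text \<open>
  An apartment that witnesses parallelism contains a shortening of the first sector. By
  \<open>chart_change_on_sector\<close> this shortening is a subsector in the chart \<open>f\<close> as well, so it contains a
  subsector that is also a shortening of the translate, and this one is again a sector of the
  witnessing apartment.
\<close>

lemma parallel_translate:
  assumes f: "chart f" and X: "X \<in> chambers" and par: "parallel M (f ` sector x X) t"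
  shows "parallel M (f ` sector x' X) t"
proof -
  obtain f2 x1 x2 F2 where 2: "chart f2" "F2 \<in> signed_faces M (spherical_types M)"
    "shortening M (f ` sector x X) (f2 ` sector x1 F2)" "shortening M t (f2 ` sector x2 F2)"
    using par by (rule parallelE)
  obtain f3 x3 F3 \<xi>3 where 3: "chart f3" "F3 \<in> signed_faces M (spherical_types M)" "\<xi>3 \<in> F3"
    "f ` sector x X = f3 ` sector x3 F3" "f2 ` sector x1 F2 = f3 ` sector (x3 + \<xi>3) F3"
    using 2(3) by (rule shorteningE)
  have F3: "F3 \<in> chambers" by (rule sector_type_chamber[OF f 3(1) X 3(2,4)])
  have F2: "F2 \<in> chambers" by (rule sector_type_chamber[OF 3(1) 2(1) F3 2(2) 3(5)[symmetric]])
  obtain u L where u: "u \<in> Wa M" "linear_part u L" "L ` X = F3" "\<And>v. v \<in> sector x X \<Longrightarrow> f v = f3 (u v)"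
    using chart_change_on_sector[OF f 3(1) X F3 3(4)] by metis
  define a where "a = inv u (x3 + \<xi>3)"
  have ua: "u ` sector a X = sector (x3 + \<xi>3) F3"
    unfolding linear_part_sector[OF u(2)] u(3) a_def Wa_inv_cancel[OF u(1)] ..
  have "f3 ` u ` sector x X = f3 ` sector x3 F3"
    using 3(4) u(4) by (simp add: image_image)
  then have "u ` sector x X = sector x3 F3"
    by (simp only: inj_image_eq_iff[OF chartD(1)[OF 3(1)]])
  then have "u ` sector a X \<subseteq> u ` sector x X"
    unfolding ua using sector_subset[OF F3, of "x3 + \<xi>3" x3] 3(3) by simp
  then have ax: "sector a X \<subseteq> sector x X"
    by (simp only: inj_image_subset_iff[OF bij_is_inj[OF Wa_bij[OF u(1)]]])
  have "f ` sector a X = f3 ` u ` sector a X"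
    unfolding image_image using ax u(4) by (intro image_cong) auto
  then have eq: "f ` sector a X = f2 ` sector x1 F2" unfolding ua 3(5) .
  obtain u' L' where u': "u' \<in> Wa M" "linear_part u' L'" "L' ` X = F2" "\<And>v. v \<in> sector a X \<Longrightarrow> f v = f2 (u' v)"
    using chart_change_on_sector[OF f 2(1) X F2 eq] by metis
  obtain \<xi> where \<xi>: "\<xi> \<in> X" "\<xi> - (a - x') \<in> X" using chambers_absorb[OF X] .
  define \<zeta> where "\<zeta> = x' + \<xi>"
  have \<zeta>: "sector \<zeta> X \<subseteq> sector a X"
    using \<xi>(2) by (intro sector_subset[OF X]) (simp add: \<zeta>_def algebra_simps)
  have "f ` sector \<zeta> X = f2 ` u' ` sector \<zeta> X"
    unfolding image_image using \<zeta> u'(4) by (intro image_cong) auto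
  also have "\<dots> = f2 ` sector (u' \<zeta>) F2" unfolding linear_part_sector[OF u'(2)] u'(3) ..
  finally have "shortening M (f ` sector x' X) (f2 ` sector (u' \<zeta>) F2)"
    using shorteningI[OF f chambers_spherical[OF X] \<xi>(1), of x'] unfolding \<zeta>_def by simp
  then show ?thesis using parallelI[OF 2(1,2) _ 2(4)] by blast
qed

lemma ideal_chamber_translate:
  assumes "chart f" "X \<in> chambers"
  shows "Collect (parallel M (f ` sector x X)) = Collect (parallel M (f ` sector x' X))"
  using parallel_translate[OF assms] by blast

text \<open>
  The type of an ideal face is passed along the shortenings that witness parallelism, each time by
  \<open>sector_type\<close>.
\<close>

lemma ideal_chamber_in_apartment:
  assumes A: "A \<in> apts M" and c: "c \<in> ideal_faces_in M A 1 UNIV" "c \<in> ideal_chambers M 1"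
  obtains f x w where "chart f" "range f = A" "w \<in> Wv M" "c = Collect (parallel M (f ` sector x (w ` C)))"
proof -
  obtain f x Fv where f: "f \<in> charts M A" "Fv \<in> vec_faces M 1 (UNIV \<inter> spherical_types M)"
    "c = Collect (parallel M (f ` sector x Fv))"
    using c(1) unfolding ideal_faces_in_def sector_def by blast
  have cf: "chart f" "range f = A" using chartI[OF A f(1)] charts_bij[OF A f(1)] by auto
  obtain A' f' x' X where f': "A' \<in> apts M" "f' \<in> charts M A'" "X \<in> vec_faces M 1 ({{}} \<inter> spherical_types M)"
    "c = Collect (parallel M (f' ` sector x' X))"
    using c(2) unfolding ideal_chambers_def ideal_faces_in_def sector_def by blast
  note cf' = chartI[OF f'(1,2)]
  have X: "X \<in> chambers"
    using f'(3) unfolding chambers_def signed_faces_def vec_faces_def by blast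
  obtain \<xi> where \<xi>: "\<xi> \<in> X" using chambers_nonempty[OF X] by blast
  have "parallel M (f' ` sector x' X) (f' ` sector x' X)"
    using shorteningI[OF cf' chambers_spherical[OF X] \<xi>] by (intro parallelI[OF cf' chambers_spherical[OF X]])
  then have "parallel M (f ` sector x Fv) (f' ` sector x' X)" using f(3) f'(4) by blast
  then obtain f2 x1 x2 F2 where 2: "chart f2" "F2 \<in> signed_faces M (spherical_types M)"
    "shortening M (f ` sector x Fv) (f2 ` sector x1 F2)" "shortening M (f' ` sector x' X) (f2 ` sector x2 F2)"
    by (rule parallelE)
  obtain f3 x3 F3 \<xi>3 where 3: "chart f3" "F3 \<in> signed_faces M (spherical_types M)" "\<xi>3 \<in> F3"
    "f' ` sector x' X = f3 ` sector x3 F3" "f2 ` sector x2 F2 = f3 ` sector (x3 + \<xi>3) F3"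
    using 2(4) by (rule shorteningE)
  obtain f4 x4 F4 \<xi>4 where 4: "chart f4" "F4 \<in> signed_faces M (spherical_types M)" "\<xi>4 \<in> F4"
    "f ` sector x Fv = f4 ` sector x4 F4" "f2 ` sector x1 F2 = f4 ` sector (x4 + \<xi>4) F4"
    using 2(3) by (rule shorteningE)
  have "F3 \<in> chambers" by (rule sector_type_chamber[OF cf' 3(1) X 3(2,4)])
  then have "F2 \<in> chambers" by (rule sector_type_chamber[OF 3(1) 2(1) _ 2(2) 3(5)[symmetric]])
  then have F4: "F4 \<in> chambers" by (rule sector_type_chamber[OF 2(1) 4(1) _ 4(2,5)])
  obtain w J where w: "w \<in> Wv M" "Fv = (\<lambda>v. 1 *\<^sub>R w v) ` std_face M J"
    using f(2) unfolding vec_faces_def by blast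
  have "J = {}" by (rule sector_type[OF 4(1) cf(1) F4 _ w 4(4)[symmetric]]) simp
  then have "Fv = w ` C" using w(2) by (simp add: chamber_def)
  then show ?thesis using that[OF cf w(1)] f(3) by blast
qed

section \<open>The action on the boundary\<close>

text \<open>
  This is where the group is required to be vectorially Weyl. It guarantees that signs and types of
  sector-faces are preserved.
\<close>

lemma G_chart:
  assumes g: "g \<in> G" and f: "chart f"
  obtains f' w c where "chart f'" "range f' = g ` range f" "w \<in> Wv M" "g \<circ> f = f' \<circ> (\<lambda>v. w v + c)"
proof -
  have gA: "g ` range f \<in> apts M" using G_apts[OF g] chartD(2)[OF f] by blast
  obtain f' where f': "chart f'" "range f' = g ` range f" using chart_exists[OF gA] .
  have "vectorially_Weyl_iso M (range f) (g ` range f) g"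
    using vectorial g chartD(2)[OF f] unfolding vectorially_Weyl_def by blast
  then have "inv f' \<circ> g \<circ> f \<in> vectorial_Weyl_affine M"
    using chartD(3)[OF f] chartD(3)[OF f'(1)] f'(2) unfolding vectorially_Weyl_iso_def iso_within_def by auto
  then obtain w c where w: "w \<in> Wv M" "inv f' \<circ> g \<circ> f = (\<lambda>v. w v + c)"
    unfolding vectorial_Weyl_affine_def by blast
  have "g (f v) = f' (inv f' (g (f v)))" for v
    using f'(2) by (metis f_inv_into_f image_eqI rangeI)
  then have "g \<circ> f = f' \<circ> (inv f' \<circ> g \<circ> f)" by (simp add: fun_eq_iff)
  then show ?thesis using that[OF f' w(1)] unfolding w(2) by blast
qed

lemma affine_sector:
  assumes "w \<in> Wv M"
  shows "(\<lambda>v. w v + c) ` sector x Fv = sector (w x + c) (w ` Fv)"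
  unfolding sector_def image_image by (simp add: linear_add[OF Wv_linear[OF assms]] algebra_simps)

lemma Wv_vec_face:
  assumes w: "w \<in> Wv M" and F: "Fv \<in> vec_faces M \<sigma> \<J>"
  shows "w ` Fv \<in> vec_faces M \<sigma> \<J>"
proof -
  obtain w' J where J: "w' \<in> Wv M" "J \<in> \<J>" "Fv = (\<lambda>v. \<sigma> *\<^sub>R w' v) ` std_face M J"
    using F unfolding vec_faces_def by blast
  have "w ` Fv = (\<lambda>v. \<sigma> *\<^sub>R (w \<circ> w') v) ` std_face M J"
    unfolding J(3) image_image by (simp add: linear_cmul[OF Wv_linear[OF w]])
  then show ?thesis unfolding vec_faces_def using Wv_comp[OF w J(1)] J(2) by blast
qed

lemma Wv_signed_face: "w \<in> Wv M \<Longrightarrow> Fv \<in> signed_faces M \<J> \<Longrightarrow> w ` Fv \<in> signed_faces M \<J>"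
  unfolding signed_faces_def using Wv_vec_face by blast

lemma G_sector:
  assumes "g \<circ> f = f' \<circ> (\<lambda>v. w v + c)" "w \<in> Wv M"
  shows "g ` f ` sector x Fv = f' ` sector (w x + c) (w ` Fv)"
proof -
  have "g ` f ` sector x Fv = f' ` (\<lambda>v. w v + c) ` sector x Fv"
    unfolding image_comp assms(1) ..
  then show ?thesis unfolding affine_sector[OF assms(2)] .
qed

lemma shortening_G:
  assumes g: "g \<in> G" and st: "shortening M p q"
  shows "shortening M (g ` p) (g ` q)"
proof -
  obtain f x Fv \<xi> where f: "chart f" "Fv \<in> signed_faces M (spherical_types M)" "\<xi> \<in> Fv"
    "p = f ` sector x Fv" "q = f ` sector (x + \<xi>) Fv"
    using st by (rule shorteningE)
  obtain f' w c where f': "chart f'" "range f' = g ` range f" "w \<in> Wv M" "g \<circ> f = f' \<circ> (\<lambda>v. w v + c)"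
    using G_chart[OF g f(1)] .
  have e: "w (x + \<xi>) + c = (w x + c) + w \<xi>" by (simp add: linear_add[OF Wv_linear[OF f'(3)]])
  show ?thesis
    unfolding f(4,5) G_sector[OF f'(4,3)] e
    by (rule shorteningI[OF f'(1) Wv_signed_face[OF f'(3) f(2)] imageI[OF f(3)]])
qed

lemma parallel_G:
  assumes g: "g \<in> G" and st: "parallel M p q"
  shows "parallel M (g ` p) (g ` q)"
proof -
  obtain f x x' Fv where f: "chart f" "Fv \<in> signed_faces M (spherical_types M)"
    "shortening M p (f ` sector x Fv)" "shortening M q (f ` sector x' Fv)"
    using st by (rule parallelE)
  obtain f' w c where f': "chart f'" "range f' = g ` range f" "w \<in> Wv M" "g \<circ> f = f' \<circ> (\<lambda>v. w v + c)"
    using G_chart[OF g f(1)] .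
  show ?thesis
    using shortening_G[OF g f(3)] shortening_G[OF g f(4)] unfolding G_sector[OF f'(4,3)]
    by (rule parallelI[OF f'(1) Wv_signed_face[OF f'(3) f(2)]])
qed

lemma G_image_cancel:
  assumes "g \<in> G"
  shows "g ` inv g ` t = t" "inv g ` g ` t = t"
  by (simp_all add: image_image G_inv_cancel[OF assms])

lemma act_ideal_class:
  assumes g: "g \<in> G"
  shows "act_ideal g (Collect (parallel M t)) = Collect (parallel M (g ` t))"
proof
  show "act_ideal g (Collect (parallel M t)) \<subseteq> Collect (parallel M (g ` t))"
    unfolding act_ideal_def using parallel_G[OF g] by blast
  show "Collect (parallel M (g ` t)) \<subseteq> act_ideal g (Collect (parallel M t))"
  proof
    fix r assume "r \<in> Collect (parallel M (g ` t))"
    then have "parallel M t (inv g ` r)"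
      using parallel_G[OF G_inv[OF g], of "g ` t" r] by (simp add: G_image_cancel[OF g])
    then show "r \<in> act_ideal g (Collect (parallel M t))"
      unfolding act_ideal_def using G_image_cancel(1)[OF g, of r] by (metis image_eqI mem_Collect_eq)
  qed
qed

lemma ideal_faces_eq:
  assumes "A \<in> apts M"
  shows "ideal_faces_in M A \<sigma> \<J> = {Collect (parallel M (f ` sector x Fv)) | f x Fv.
        chart f \<and> range f = A \<and> Fv \<in> vec_faces M \<sigma> (\<J> \<inter> spherical_types M)}"
proof -
  have "f \<in> charts M A \<longleftrightarrow> chart f \<and> range f = A" for f
    using chartI[OF assms, of f] charts_bij(2)[OF assms, of f] chartD(3)[of f] by metis
  then show ?thesis unfolding ideal_faces_in_def sector_def by simp
qed

lemma act_ideal_faces_subset: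
  assumes g: "g \<in> G" and A: "A \<in> apts M"
  shows "act_ideal g ` ideal_faces_in M A \<sigma> \<J> \<subseteq> ideal_faces_in M (g ` A) \<sigma> \<J>"
proof
  have gA: "g ` A \<in> apts M" using G_apts[OF g] A by blast
  fix c assume "c \<in> act_ideal g ` ideal_faces_in M A \<sigma> \<J>"
  then obtain f x Fv where f: "chart f" "range f = A" "Fv \<in> vec_faces M \<sigma> (\<J> \<inter> spherical_types M)"
    "c = act_ideal g (Collect (parallel M (f ` sector x Fv)))"
    unfolding ideal_faces_eq[OF A] by blast
  obtain f' w b where f': "chart f'" "range f' = g ` A" "w \<in> Wv M" "g \<circ> f = f' \<circ> (\<lambda>v. w v + b)"
    using G_chart[OF g f(1)] unfolding f(2) .
  have "c = Collect (parallel M (f' ` sector (w x + b) (w ` Fv)))"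
    unfolding f(4) act_ideal_class[OF g] G_sector[OF f'(4,3)] ..
  then show "c \<in> ideal_faces_in M (g ` A) \<sigma> \<J>"
    unfolding ideal_faces_eq[OF gA] using f'(1,2) Wv_vec_face[OF f'(3) f(3)] by blast
qed

lemma act_ideal_faces:
  assumes g: "g \<in> G" and A: "A \<in> apts M"
  shows "act_ideal g ` ideal_faces_in M A \<sigma> \<J> = ideal_faces_in M (g ` A) \<sigma> \<J>"
proof (rule antisym[OF act_ideal_faces_subset[OF g A]])
  have gA: "g ` A \<in> apts M" using G_apts[OF g] A by blast
  show "ideal_faces_in M (g ` A) \<sigma> \<J> \<subseteq> act_ideal g ` ideal_faces_in M A \<sigma> \<J>"
  proof
    fix c assume "c \<in> ideal_faces_in M (g ` A) \<sigma> \<J>"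
    then have "act_ideal (inv g) c \<in> ideal_faces_in M A \<sigma> \<J>"
      using act_ideal_faces_subset[OF G_inv[OF g] gA, of \<sigma> \<J>] by (auto simp: G_image_cancel[OF g])
    moreover have "act_ideal g (act_ideal (inv g) c) = c"
      unfolding act_ideal_def image_image[of "image g" "image (inv g)"] G_image_cancel[OF g] by simp
    ultimately show "c \<in> act_ideal g ` ideal_faces_in M A \<sigma> \<J>" by (metis image_eqI)
  qed
qed

lemma act_twin_apartment:
  assumes "g \<in> G" "A \<in> apts M" "g ` A = A'"
  shows "act_twin g (ideal_faces_in M A (- 1) UNIV, ideal_faces_in M A 1 UNIV) =
     (ideal_faces_in M A' (- 1) UNIV, ideal_faces_in M A' 1 UNIV)"
  unfolding act_twin_def using act_ideal_faces[OF assms(1,2)] assms(3) by simp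

lemma range_of_comp:
  assumes "g \<circ> f = f' \<circ> u" "u \<in> Wa M"
  shows "g ` range f = range f'"
  using range_chart_comp[OF assms(2), of f'] unfolding assms(1)[symmetric] by (simp add: image_comp)

text \<open>
  Both ideal chambers are written in one chart of \<open>A\<close>, as classes of sectors with directions \<open>w ` C\<close>
  and \<open>w2 ` C\<close>. The stabilizer of \<open>A\<close> adjusts the direction, and the base point does not matter.
\<close>

lemma ideal_chambers_transitive:
  assumes A: "A \<in> apts M"
    and c: "c \<in> ideal_faces_in M A 1 UNIV \<inter> ideal_chambers M 1"
    and c': "c' \<in> ideal_faces_in M A 1 UNIV \<inter> ideal_chambers M 1"
  shows "\<exists>g\<in>G. g ` A = A \<and> act_ideal g c = c'"
proof -
  obtain f x w where f: "chart f" "range f = A" "w \<in> Wv M" "c = Collect (parallel M (f ` sector x (w ` C)))"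
    using ideal_chamber_in_apartment[OF A] c by (metis IntE)
  obtain f' x' w' where f': "chart f'" "range f' = A" "w' \<in> Wv M" "c' = Collect (parallel M (f' ` sector x' (w' ` C)))"
    using ideal_chamber_in_apartment[OF A] c' by (metis IntE)
  obtain u0 where u0: "u0 \<in> Wa M" "f' = f \<circ> u0" using charts_related[OF f(1) f'(1)] f(2) f'(2) by auto
  obtain L0 where L0: "linear_part u0 L0" using linear_part_exists[OF u0(1)] .
  define w2 where "w2 = L0 \<circ> w'"
  have w2: "w2 \<in> Wv M" unfolding w2_def by (rule Wv_comp[OF linear_partD(1)[OF L0] f'(3)])
  have w2C: "w2 ` C \<in> chambers" by (rule Wv_image_chamber[OF C_chamber w2])
  have "f' ` sector x' (w' ` C) = f ` sector (u0 x') (w2 ` C)"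
    unfolding u0(2) image_comp[symmetric] linear_part_sector[OF L0] w2_def ..
  then have c2: "c' = Collect (parallel M (f ` sector (u0 x') (w2 ` C)))" using f'(4) by simp
  have fw: "chart (f \<circ> w)" by (rule chart_comp[OF f(1) Wv_Wa[OF f(3)]])
  obtain n u L where n: "n \<in> G" "u \<in> Wa M" "linear_part u L" "n \<circ> (f \<circ> w) = f \<circ> w \<circ> u" "L ` C = (inv w \<circ> w2) ` C"
    using chamber_stabilizer_transitive[OF fw Wv_comp[OF Wv_inv[OF f(3)] w2]] by blast
  have nA: "n ` A = A"
    using range_of_comp[OF n(4,2)] range_chart_comp[OF Wv_Wa[OF f(3)], of f] f(2) by simp
  have lw: "linear_part w w" using f(3) by (simp add: linear_part_def linear_add[OF Wv_linear])
  have sec: "sector x (w ` C) = w ` sector (inv w x) C"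
    unfolding linear_part_sector[OF lw] Wv_inv_cancel[OF f(3)] ..
  have wL: "w ` L ` C = w2 ` C"
    unfolding n(5) image_image by (simp add: Wv_inv_cancel[OF f(3)])
  have "n ` f ` sector x (w ` C) = (n \<circ> (f \<circ> w)) ` sector (inv w x) C"
    unfolding sec by (simp add: image_image)
  also have "\<dots> = f ` w ` u ` sector (inv w x) C" unfolding n(4) by (simp add: image_image)
  also have "\<dots> = f ` sector (w (u (inv w x))) (w2 ` C)"
    unfolding linear_part_sector[OF n(3)] linear_part_sector[OF lw] wL ..
  finally have "act_ideal n c = Collect (parallel M (f ` sector (w (u (inv w x))) (w2 ` C)))"
    unfolding f(4) act_ideal_class[OF n(1)] by simp
  also have "\<dots> = c'" unfolding c2 by (rule ideal_chamber_translate[OF f(1) w2C])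
  finally show ?thesis using n(1) nA by blast
qed

lemma strongly_transitive_at_infinity: "strongly_transitive_boundary M G"
  unfolding strongly_transitive_boundary_def
proof (intro conjI ballI)
  fix P Q assume "P \<in> twin_apartments M" "Q \<in> twin_apartments M"
  then obtain A A' where A: "A \<in> apts M" "P = (ideal_faces_in M A (- 1) UNIV, ideal_faces_in M A 1 UNIV)"
    and A': "A' \<in> apts M" "Q = (ideal_faces_in M A' (- 1) UNIV, ideal_faces_in M A' 1 UNIV)"
    unfolding twin_apartments_def by blast
  obtain f f' where f: "chart f" "range f = A" "chart f'" "range f' = A'"
    using chart_exists A(1) A'(1) by metis
  obtain g u where g: "g \<in> G" "u \<in> Wa M" "g \<circ> f = f' \<circ> u" using apartments_transitive[OF f(1,3)] .
  have "g ` A = A'" using range_of_comp[OF g(3,2)] f by simp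
  then show "\<exists>g\<in>G. act_twin g P = Q"
    using act_twin_apartment[OF g(1) A(1)] g(1) unfolding A(2) A'(2) by blast
next
  fix P c c' assume "P \<in> twin_apartments M"
    and c: "c \<in> snd P \<inter> ideal_chambers M 1" "c' \<in> snd P \<inter> ideal_chambers M 1"
  then obtain A where A: "A \<in> apts M" "P = (ideal_faces_in M A (- 1) UNIV, ideal_faces_in M A 1 UNIV)"
    unfolding twin_apartments_def by blast
  obtain g where g: "g \<in> G" "g ` A = A" "act_ideal g c = c'"
    using ideal_chambers_transitive[OF A(1)] c unfolding A(2) snd_conv by blast
  then show "\<exists>g\<in>G. act_twin g P = P \<and> act_ideal g c = c'"
    using act_twin_apartment[OF g(1) A(1) g(2)] unfolding A(2) by blast
qed

end

theorem proposition4p9: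
  fixes M :: "('v::euclidean_space, 'i::finite, 'g::real_vector, 'd) masure_datum"
    and G :: "('d \<Rightarrow> 'd) set"
  assumes "masure M"
    and "thick M"
    and "automorphism_group M G"
    and "\<forall>g\<in>G. vectorially_Weyl M g"
    and "strongly_transitive_masure M G"
  shows "strongly_transitive_boundary M G"
proof -
  interpret masure_group M G
  proof
    show "model_apartment M" using assms(1) unfolding masure_def by (rule conjunct1)
  qed (rule assms)+
  show ?thesis by (rule strongly_transitive_at_infinity)
qed

end
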